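(* Let $r\ge1$. For any $c\in\mathcal{W}_r$, the reduced remixed Eulerian number $\tilde A_c(q)$ is $\mathrm{psu}\left(\binom r2-H(c)-\sum_j\binom{m_j}{2}\right)$, where $m_1,\dots,m_p$ are the cardinalities of the maximal intervals of the support of $c$. It follows that $A_c(q)$ is $\mathrm{psu}\left(\binom r2-H(c)\right)$.
   Context: $\mathcal{W}_r$ is the set of sequences $c=(c_1,\dots,c_r)$ of nonnegative integers with $c_1+\cdots+c_r=r$. Write $(n)_q=1+q+\cdots+q^{n-1}$ and $(n)_q!=\prod_{1\le i\le n}(i)_q$. Definition of $A_c(q)$. Let $\mathbb{S}_{r+1}$ act on $\mathbb{C}[q,x_1,\dots,x_{r+1}]$ by permuting the indices of the $x_i$, and set $$\partial_{w_o}(f)=\frac{1}{\prod_{1\le i<j\le r+1}(x_i-x_j)}\sum_{\sigma\in\mathbb{S}_{r+1}}\epsilon(\sigma)\sigma(f),$$ with $\epsilon(\sigma)$ the sign of $\sigma$. Put $\langle f\rangle^q_{r+1}=\partial_{w_o}\bigl(f\prod_{1\le i<j-1\le r}(qx_i-x_j)\bigr)$ (product over pairs $(i,j)$ with $1\le i$, $i<j-1$, $j\le r+1$). If $f$ is homogeneous of degree $r$ in the $x_i$, then $\langle f\rangle^q_{r+1}\in\mathbb{C}[q]$. For $c\in\mathcal{W}_r$ the remixed Eulerian number is $$A_c(q)=\bigl\langle x_1^{c_1}(x_1+x_2)^{c_2}\cdots(x_1+\cdots+x_r)^{c_r}\bigr\rangle^q_{r+1}\in\mathbb{C}[q].$$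 The support of $c$ is $\{j: c_j>0\}$; decompose it into its maximal intervals of consecutive integers, with cardinalities $m_1,\dots,m_p$. The reduced remixed Eulerian number is $\tilde A_c(q)=A_c(q)/\prod_j (m_j)_q!$ (a polynomial in $q$). For $i\in\{1,\dots,r\}$ let $h_i(c)=\sum_{1\le j\le i}(c_j-1)$, and $H(c)=\sum_{1\le i\le r-1}h_i(c)$. A polynomial $P(q)$, with valuation (smallest exponent occurring) $d$ and degree $D$, is $\mathrm{psu}(N)$ if it has positive coefficients (in degrees $d,\dots,D$), its coefficient sequence is unimodal, and it is symmetric with respect to $N/2$ (the coefficient of $q^i$ equals that of $q^{N-i}$ for all $i$); so $N=d+D$. *)

theory Defs
  imports
    Complex_Main
    "HOL-Library.Poly_Mapping"
    "HOL-Computational_Algebra.Polynomial"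
    "HOL-Combinatorics.Permutations"
begin

text \<open>
  Polynomials in \<open>q\<close> are elements of \<open>complex poly\<close>. The ring \<open>\<complex>[q, x\<^sub>1, x\<^sub>2, \<dots>]\<close> is realised as
  the convolution ring of finitely supported functions from exponent vectors to \<open>\<complex>[q]\<close>.
  This type has countably many indeterminates; for a given \<open>n\<close> only \<open>x\<^sub>1, \<dots>, x\<^sub>n\<close> are used below.
\<close>

type_synonym qpoly = "complex poly"
type_synonym mpoly_q = "(nat \<Rightarrow>\<^sub>0 nat) \<Rightarrow>\<^sub>0 qpoly"

definition Const :: "qpoly \<Rightarrow> mpoly_q" where
  "Const P = Poly_Mapping.single 0 P"

definition Q :: mpoly_q where
  "Q = Const (monom 1 1)"

definition X :: "nat \<Rightarrow> mpoly_q" where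
  "X i = Poly_Mapping.single (Poly_Mapping.single i 1) 1"

text \<open>
  For a bijection \<open>\<sigma>\<close> this is the substitution \<open>x\<^sub>i \<mapsto> x\<^bsub>\<sigma> i\<^esub>\<close>: the coefficient of
  \<open>x\<^sup>m\<close> in the result is the coefficient of \<open>x\<^bsup>m \<circ> \<sigma>\<^esup>\<close> in \<open>f\<close>.
\<close>

definition perm_act :: "(nat \<Rightarrow> nat) \<Rightarrow> mpoly_q \<Rightarrow> mpoly_q" where
  "perm_act \<sigma> f = Poly_Mapping.map_key (Poly_Mapping.map_key \<sigma>) f"

lemma map_key_inj:
  fixes \<sigma> :: "nat \<Rightarrow> nat"
  assumes "bij \<sigma>"
  shows "inj (Poly_Mapping.map_key \<sigma> :: (nat \<Rightarrow>\<^sub>0 nat) \<Rightarrow> _)"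
proof (rule injI)
  fix m m' :: "nat \<Rightarrow>\<^sub>0 nat"
  assume eq: "Poly_Mapping.map_key \<sigma> m = Poly_Mapping.map_key \<sigma> m'"
  have "Poly_Mapping.lookup m (\<sigma> k) = Poly_Mapping.lookup m' (\<sigma> k)" for k
    using arg_cong[OF eq, of "\<lambda>p. Poly_Mapping.lookup p k"] bij_is_inj[OF assms]
    by (simp add: map_key.rep_eq)
  then have "Poly_Mapping.lookup m j = Poly_Mapping.lookup m' j" for j
    by (metis assms bij_pointE)
  then show "m = m'"
    by (intro poly_mapping_eqI)
qed

lemma perm_act_X:
  assumes "bij \<sigma>"
  shows "perm_act \<sigma> (X i) = X (\<sigma> i)"
proof -
  have "Poly_Mapping.map_key \<sigma> (Poly_Mapping.single (\<sigma> i) (1::nat)) = Poly_Mapping.single i 1"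
    using assms by (simp add: map_key_single bij_is_inj)
  then show ?thesis
    unfolding perm_act_def X_def
    by (metis map_key_single map_key_inj[OF assms])
qed

definition vandermonde :: "nat \<Rightarrow> mpoly_q" where
  "vandermonde n = (\<Prod>(i, j)\<in>{(i, j). 1 \<le> i \<and> i < j \<and> j \<le> n}. X i - X j)"

definition antisymmetrize :: "nat \<Rightarrow> mpoly_q \<Rightarrow> mpoly_q" where
  "antisymmetrize n f = (\<Sum>\<sigma> | \<sigma> permutes {1..n}. of_int (sign \<sigma>) * perm_act \<sigma> f)"

text \<open>
  There is no division on this ring, so each exact quotient, here and in \<open>reduced_remixed_eulerian\<close>,
  is the solution of the corresponding multiplicative equation,
  which is unique because the rings involved are integral domains.
\<close>

definition divided_sym :: "nat \<Rightarrow> mpoly_q \<Rightarrow> mpoly_q" where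
  "divided_sym n f = (THE g. vandermonde n * g = antisymmetrize n f)"

definition q_bracket :: "nat \<Rightarrow> mpoly_q \<Rightarrow> mpoly_q" where
  "q_bracket n f =
     divided_sym n (f * (\<Prod>(i, j)\<in>{(i, j). 1 \<le> i \<and> i + 1 < j \<and> j \<le> n}. Q * X i - X j))"

text \<open>
  A sequence \<open>(c\<^sub>1, \<dots>, c\<^sub>r)\<close> is a function on \<open>nat\<close>, set to zero outside \<open>{1..r}\<close>.
\<close>

definition W :: "nat \<Rightarrow> (nat \<Rightarrow> nat) set" where
  "W r = {c. (\<forall>j. j \<notin> {1..r} \<longrightarrow> c j = 0) \<and> (\<Sum>j=1..r. c j) = r}"

text \<open>
  For \<open>c \<in> W r\<close> the bracket is homogeneous of degree 0 in the \<open>x\<^sub>i\<close>, that is, it lies in the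
  subring \<open>\<complex>[q]\<close>; the polynomial is recovered as the preimage under the embedding \<open>Const\<close>.
\<close>

definition remixed_eulerian :: "nat \<Rightarrow> (nat \<Rightarrow> nat) \<Rightarrow> qpoly" where
  "remixed_eulerian r c =
     (THE P. Const P = q_bracket (r + 1) (\<Prod>i=1..r. (\<Sum>j=1..i. X j) ^ c i))"

definition q_int :: "nat \<Rightarrow> qpoly" where
  "q_int n = (\<Sum>i<n. monom 1 i)"

definition q_fact :: "nat \<Rightarrow> qpoly" where
  "q_fact n = (\<Prod>i=1..n. q_int i)"

definition support :: "nat \<Rightarrow> (nat \<Rightarrow> nat) \<Rightarrow> nat set" where
  "support r c = {j \<in> {1..r}. c j > 0}"

definition intervals_in :: "nat set \<Rightarrow> nat set set" where
  "intervals_in S = {I. I \<subseteq> S \<and> (\<exists>a b. a \<le> b \<and> I = {a..b})}"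

definition max_intervals :: "nat set \<Rightarrow> nat set set" where
  "max_intervals S = {I \<in> intervals_in S. \<forall>J \<in> intervals_in S. I \<subseteq> J \<longrightarrow> J = I}"

definition reduced_remixed_eulerian :: "nat \<Rightarrow> (nat \<Rightarrow> nat) \<Rightarrow> qpoly" where
  "reduced_remixed_eulerian r c =
     (THE P. (\<Prod>I\<in>max_intervals (support r c). q_fact (card I)) * P = remixed_eulerian r c)"

definition h :: "(nat \<Rightarrow> nat) \<Rightarrow> nat \<Rightarrow> int" where
  "h c i = (\<Sum>j=1..i. (int (c j) - 1))"

definition H :: "nat \<Rightarrow> (nat \<Rightarrow> nat) \<Rightarrow> int" where
  "H r c = (\<Sum>i=1..r - 1. h c i)"

definition valuation :: "qpoly \<Rightarrow> nat" where
  "valuation P = (LEAST i. coeff P i \<noteq> 0)"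

definition icoeff :: "qpoly \<Rightarrow> int \<Rightarrow> complex" where
  "icoeff P k = (if k < 0 then 0 else coeff P (nat k))"

definition unimodal :: "(nat \<Rightarrow> real) \<Rightarrow> bool" where
  "unimodal a \<longleftrightarrow> (\<exists>k. (\<forall>i j. i \<le> j \<and> j \<le> k \<longrightarrow> a i \<le> a j) \<and> (\<forall>i j. k \<le> i \<and> i \<le> j \<longrightarrow> a j \<le> a i))"

text \<open>
  The coefficients are complex numbers, so positivity includes being real. The zero polynomial
  has no valuation and is excluded. Coefficients at negative exponents count as 0 in the
  symmetry condition, which therefore forces \<open>N = valuation P + degree P\<close>.
\<close>

definition psu :: "qpoly \<Rightarrow> int \<Rightarrow> bool" where
  "psu P N \<longleftrightarrow>
     P \<noteq> 0 \<and>
     (\<forall>i \<in> {valuation P..degree P}. coeff P i \<in> \<real> \<and> Re (coeff P i) > 0) \<and>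
     unimodal (\<lambda>i. Re (coeff P i)) \<and>
     (\<forall>k. icoeff P k = icoeff P (N - k))"

end

theory Submission
  imports Defs
begin

text \<open>
  Write \<open>y\<^sub>i = x\<^sub>1 + \<dots> + x\<^sub>i\<close>. The remixed Eulerian number \<open>A\<^sub>c(q)\<close> is the bracket of
  the product of the powers \<open>y\<^sub>i\<close> to the \<open>c\<^sub>i\<close>. Think of \<open>c\<close> as a configuration of \<open>r\<close> particles on the
  sites \<open>1, \<dots>, r\<close>.

  The bracket of \<open>f y\<^sub>i (q x\<^sub>i - x\<^bsub>i+1\<^esub>)\<close> vanishes for \<open>f\<close> of degree \<open>r - 2\<close>
  (\<open>bracket_psum_adj\<close>): with the additional factor, all pairs crossing the cut at \<open>i\<close> occur in
  the product. Apart from a factor that is symmetric in each of the two blocks of variables, only a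
  product of one polynomial for each block remains, and the degree of one of the two is too small
  to survive antisymmetrization. Since
  \<open>q x\<^sub>i - x\<^bsub>i+1\<^esub> = (1 + q) y\<^sub>i - q y\<^bsub>i-1\<^esub> - y\<^bsub>i+1\<^esub>\<close>, a surplus particle inside a run of
  occupied sites performs a biased walk, and the bracket as a function of its position is
  \<open>q\<close>-harmonic. Solving for the position in terms of the two exits of the run gives a recurrence
  (\<open>remixed_eulerian_move\<close>) that expresses \<open>A\<^sub>c\<close> by the numbers of at most two configurations with one
  more occupied site. It ends at the all-ones configuration, whose number is \<open>(r)\<^sub>q!\<close>
  (\<open>bracket_all_ones\<close>); this follows from the same relations and from the antisymmetrization of the
  product of all \<open>q x\<^sub>i - x\<^sub>j\<close>, evaluated at \<open>x\<^sub>k = q\<^sup>k\<close>.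

  The recurrence involves a division by \<open>(m + 1)\<^sub>q\<close>, where \<open>m\<close> is the length of the run. For the
  reduced numbers this denominator disappears, and the coefficients become products of powers of
  \<open>q\<close>, of \<open>q\<close>-integers and, when two runs merge, of Gaussian binomial coefficients. All of these are
  positive, symmetric and unimodal, and so are products of such polynomials, as well as sums with a
  common center of symmetry. The statistic \<open>H\<close> records by how much a move shifts the center, and it
  shifts the centers of the two terms to the same place (\<open>reduced_cone_exists\<close>).

  The deepest ingredient is the unimodality of the Gaussian binomial coefficients
  (\<open>psu_cone_qbinom\<close>), which is in fact a special case of the theorem: two runs separated by one
  empty site, all other sites being occupied, with a surplus particle at the outer end of one run.
  It is proved by representing \<open>sl\<^sub>2\<close> on functions on finite sets of natural
  numbers, where raising operators are injective below the middle.
\<close>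

section \<open>Symmetric unimodal polynomials with positive coefficients\<close>

abbreviation qpow :: "nat \<Rightarrow> qpoly" where "qpow k \<equiv> monom 1 k"

lemma qpow_add: "qpow (a + b) = qpow a * qpow b"
  by (simp add: mult_monom)

lemma q_int_0: "q_int 0 = 0"
  by (simp add: q_int_def)

lemma q_int_1: "q_int (Suc 0) = 1"
  by (simp add: q_int_def)

lemma q_int_Suc: "q_int (Suc n) = q_int n + qpow n"
  by (simp add: q_int_def)

lemma q_int_add: "q_int (a + b) = q_int a + qpow a * q_int b"
  by (induction b) (simp_all add: q_int_0 q_int_Suc qpow_add distrib_left algebra_simps)

lemma coeff_q_int: "coeff (q_int n) k = (if k < n then 1 else 0)"
  by (simp add: q_int_def coeff_sum)

lemma q_int_nonzero: "n > 0 \<Longrightarrow> q_int n \<noteq> 0"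
  using coeff_q_int[of n 0] by auto

lemma q_fact_0: "q_fact 0 = 1"
  by (simp add: q_fact_def)

lemma q_fact_Suc: "q_fact (Suc n) = q_fact n * q_int (Suc n)"
  by (simp add: q_fact_def atLeastAtMostSuc_conv mult.commute)

lemma q_fact_nonzero: "q_fact n \<noteq> 0"
  by (induction n) (simp_all add: q_fact_0 q_fact_Suc q_int_nonzero)

text \<open>
  Peels the outermost layer off the trapezoidal coefficient sequence of a product of two
  \<open>q\<close>-integers; iterating it writes the product as a sum of concentric runs of ones.
\<close>

lemma q_int_mult_q_int:
  "q_int (Suc a) * q_int (Suc b) = q_int (Suc (a + b)) + qpow 1 * (q_int a * q_int b)"
proof -
  have 1: "q_int (Suc (a + b)) = q_int (Suc a) + qpow (Suc a) * q_int b"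
    using q_int_add[of "Suc a" b] by simp
  have 2: "q_int (Suc b) = 1 + qpow 1 * q_int b"
    using q_int_add[of 1 b] q_int_1 by simp
  have 3: "qpow (Suc a) = qpow 1 * qpow a" by (simp add: mult_monom)
  show ?thesis unfolding 1 2 3 by (simp add: q_int_Suc algebra_simps)
qed

text \<open>
  The polynomial \<open>q\<^sup>i + \<dots> + q\<^bsup>N - i\<^esup>\<close>: a run of ones symmetric about \<open>N / 2\<close>.
\<close>

definition centered :: "nat \<Rightarrow> nat \<Rightarrow> qpoly" where
  "centered N i = qpow i * q_int (N + 1 - 2 * i)"

lemma coeff_centered:
  assumes "2 * i \<le> N"
  shows "coeff (centered N i) k = (if i \<le> k \<and> i + k \<le> N then 1 else 0)"
  using assms by (auto simp: centered_def coeff_monom_mult coeff_q_int)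

text \<open>
  A positive unimodal polynomial symmetric about \<open>N / 2\<close> is a nonnegative combination of
  centered runs of ones. Taking this cone as the primary notion, instead of the coefficient
  inequalities, makes closure under sums immediate and reduces closure under products to
  products of two runs.
\<close>

inductive psu_cone :: "nat \<Rightarrow> qpoly \<Rightarrow> bool" for N where
  zero: "psu_cone N 0"
| step: "psu_cone N P \<Longrightarrow> 2 * i \<le> N \<Longrightarrow> l \<ge> 0 \<Longrightarrow> psu_cone N (P + smult (complex_of_real l) (centered N i))"

lemma psu_cone_centered: "2 * i \<le> N \<Longrightarrow> psu_cone N (centered N i)"
  using psu_cone.step[OF psu_cone.zero, of i N 1] by simp

lemma psu_cone_q_int: "psu_cone N (q_int (Suc N))"
  using psu_cone_centered[of 0 N] by (simp add: centered_def)

lemma psu_cone_add: "psu_cone N P \<Longrightarrow> psu_cone N R \<Longrightarrow> psu_cone N (P + R)"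
proof (induction P rule: psu_cone.induct)
  case (step P i l)
  then show ?case using psu_cone.step[of N "P + R" i l] by (simp add: ac_simps)
qed simp

lemma psu_cone_sum: "(\<And>i. i \<in> I \<Longrightarrow> psu_cone N (F i)) \<Longrightarrow> psu_cone N (\<Sum>i\<in>I. F i)"
  by (induction I rule: infinite_finite_induct) (auto simp: psu_cone.zero psu_cone_add)

lemma psu_cone_smult: "psu_cone N P \<Longrightarrow> l \<ge> 0 \<Longrightarrow> psu_cone N (smult (complex_of_real l) P)"
proof (induction P rule: psu_cone.induct)
  case (step P i k)
  then show ?case
    using psu_cone.step[of N "smult (complex_of_real l) P" i "l * k"] by (simp add: smult_add_right)
qed (simp add: psu_cone.zero)

lemma psu_cone_shift: "psu_cone N P \<Longrightarrow> psu_cone (N + 2 * k) (qpow k * P)"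
proof (induction P rule: psu_cone.induct)
  case (step P i l)
  have "qpow k * centered N i = centered (N + 2 * k) (i + k)"
    using step.hyps by (simp add: centered_def qpow_add mult.left_commute mult.assoc)
  then show ?case
    using psu_cone.step[of "N + 2 * k" "qpow k * P" "i + k" l] step by (simp add: distrib_left)
qed (simp add: psu_cone.zero)

lemma psu_cone_q_int_mult: "psu_cone (a + b) (q_int (Suc a) * q_int (Suc b))"
proof (induction a arbitrary: b)
  case 0
  then show ?case by (simp add: q_int_1 psu_cone_q_int)
next
  case (Suc a)
  show ?case
  proof (cases b)
    case 0
    then show ?thesis using psu_cone_q_int[of "Suc a"] by (simp add: q_int_1)
  next
    case (Suc b')
    have "psu_cone (a + b' + 2 * 1) (qpow 1 * (q_int (Suc a) * q_int (Suc b')))"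
      by (rule psu_cone_shift) (rule Suc.IH)
    moreover have "psu_cone (a + b' + 2 * 1) (q_int (Suc (Suc a + Suc b')))"
      using psu_cone_q_int[of "a + b' + 2"] by simp
    ultimately show ?thesis
      unfolding Suc q_int_mult_q_int[of "Suc a" "Suc b'"]
      using psu_cone_add by (simp add: add.commute)
  qed
qed

lemma psu_cone_centered_mult:
  assumes "2 * i \<le> N" "2 * j \<le> M"
  shows "psu_cone (N + M) (centered N i * centered M j)"
proof -
  obtain a b where ab: "N = 2 * i + a" "M = 2 * j + b"
    using assms le_Suc_ex by blast
  have "psu_cone (a + b + 2 * (i + j)) (qpow (i + j) * (q_int (Suc a) * q_int (Suc b)))"
    by (rule psu_cone_shift) (rule psu_cone_q_int_mult)
  then show ?thesis by (simp add: ab centered_def qpow_add ac_simps)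
qed

lemma psu_cone_mult: "psu_cone N P \<Longrightarrow> psu_cone M R \<Longrightarrow> psu_cone (N + M) (P * R)"
proof (induction P rule: psu_cone.induct)
  case zero
  then show ?case by (simp add: psu_cone.zero)
next
  case (step P i l)
  have "psu_cone (N + M) (centered N i * R)"
    using step.prems
  proof (induction R rule: psu_cone.induct)
    case zero
    then show ?case by (simp add: psu_cone.zero)
  next
    case (step R j k)
    then have "psu_cone (N + M) (smult (complex_of_real k) (centered N i * centered M j))"
      using psu_cone_centered_mult[OF \<open>2 * i \<le> N\<close>] psu_cone_smult by blast
    then show ?case using step psu_cone_add by (simp add: distrib_left)
  qed
  then have "psu_cone (N + M) (smult (complex_of_real l) (centered N i * R))"
    using step.hyps psu_cone_smult by blast
  then show ?case using step psu_cone_add by (simp add: distrib_right)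
qed

lemma psu_cone_q_fact: "psu_cone (n choose 2) (q_fact n)"
proof (induction n)
  case 0
  have "psu_cone 0 1" using psu_cone_q_int[of 0] by (simp add: q_int_1)
  then show ?case by (simp add: q_fact_0 numeral_2_eq_2)
next
  case (Suc n)
  then have "psu_cone ((n choose 2) + n) (q_fact (Suc n))"
    unfolding q_fact_Suc by (rule psu_cone_mult) (rule psu_cone_q_int)
  then show ?case by (simp add: numeral_2_eq_2 add.commute)
qed

text \<open>
  The weight of the run starting at \<open>q\<^sup>i\<close> is the increment of the coefficient sequence
  at \<open>i\<close>, so the coefficients of the combination telescope.
\<close>

lemma psu_coneI:
  fixes a :: "nat \<Rightarrow> real"
  assumes c: "\<And>k. coeff P k = complex_of_real (a k)" and nonneg: "a 0 \<ge> 0"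
    and big: "\<And>k. k > N \<Longrightarrow> a k = 0" and sym: "\<And>k. k \<le> N \<Longrightarrow> a (N - k) = a k"
    and mono: "\<And>k. 2 * Suc k \<le> N \<Longrightarrow> a k \<le> a (Suc k)"
  shows "psu_cone N P"
proof -
  \<comment> \<open>The increments of \<open>a\<close>, with \<open>a (- 1)\<close> read as zero.\<close>
  define d where "d i = (case i of 0 \<Rightarrow> a 0 | Suc j \<Rightarrow> a i - a j)" for i
  have tel: "(\<Sum>i\<le>k. d i) = a k" for k
    by (induction k) (simp_all add: d_def)
  have "P = (\<Sum>i\<le>N div 2. smult (complex_of_real (d i)) (centered N i))" (is "_ = ?S")
  proof (rule poly_eqI)
    fix k
    have "coeff ?S k = (\<Sum>i\<le>N div 2. if i \<le> k \<and> i + k \<le> N then complex_of_real (d i) else 0)"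
      unfolding coeff_sum by (intro sum.cong) (auto simp: coeff_centered)
    also have "\<dots> = complex_of_real (a k)"
    proof (cases "k \<le> N")
      case False
      then show ?thesis using big by auto
    next
      case True
      have "(\<Sum>i\<le>N div 2. if i \<le> k \<and> i + k \<le> N then complex_of_real (d i) else 0)
          = (\<Sum>i\<le>min k (N - k). complex_of_real (d i))"
        using True by (intro sum.mono_neutral_cong_right) auto
      also have "\<dots> = complex_of_real (a (min k (N - k)))"
        by (simp only: of_real_sum[symmetric] tel)
      also have "a (min k (N - k)) = a k" using sym[OF True] by (simp add: min_def)
      finally show ?thesis .
    qed
    finally show "coeff P k = coeff ?S k" using c by simp
  qed
  also have "psu_cone N \<dots>"
  proof (rule psu_cone_sum)
    fix i assume "i \<in> {..N div 2}"
    then have i: "2 * i \<le> N" by auto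
    then have "d i \<ge> 0" using nonneg mono[of "i - 1"] by (cases i) (auto simp: d_def)
    then show "psu_cone N (smult (complex_of_real (d i)) (centered N i))"
      using psu_cone_centered[OF i] psu_cone_smult by blast
  qed
  finally show ?thesis .
qed

text \<open>
  Each of these properties holds for one run and is preserved by nonnegative combinations.
\<close>

lemma psu_cone_coeff:
  assumes "psu_cone N P"
  shows "coeff P k \<in> \<real>" and "k > N \<Longrightarrow> coeff P k = 0"
    and "k \<le> N \<Longrightarrow> coeff P (N - k) = coeff P k"
    and "i \<le> j \<Longrightarrow> 2 * j \<le> N \<Longrightarrow> Re (coeff P i) \<le> Re (coeff P j)"
    and "Re (coeff P k) \<ge> 0"
  using assms by (induction P rule: psu_cone.induct) (auto simp: coeff_centered intro!: add_mono)

text \<open>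
  The cone allows zero coefficients near the ends of \<open>{0..N}\<close>. There are none between the
  valuation and the degree because the coefficients increase up to the middle and are
  symmetric about it.
\<close>

lemma psu_if_psu_cone:
  assumes P: "psu_cone N P" and nz: "P \<noteq> 0"
  shows "psu P (int N)"
proof -
  let ?a = "\<lambda>i. Re (coeff P i)"
  note co = psu_cone_coeff[OF P]
  have deg: "degree P \<le> N" using co(2) degree_le by blast
  have sym: "?a (N - k) = ?a k" if "k \<le> N" for k using co(3)[OF that] by simp
  have anti: "?a j \<le> ?a i" if "i \<le> j" "N \<le> 2 * i" for i j
  proof (cases "j \<le> N")
    case True
    then show ?thesis using co(4)[of "N - j" "N - i"] sym[of i] sym[of j] that by simp
  next
    case False
    then show ?thesis using co(2)[of j] co(5)[of i] by simp
  qed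
  have pos: "?a k > 0" if "coeff P k \<noteq> 0" for k
    using co(1)[of k] co(5)[of k] that by (metis Reals_cases Re_complex_of_real of_real_0 order_less_le)
  have val: "coeff P (valuation P) \<noteq> 0"
    unfolding valuation_def by (rule LeastI[of _ "degree P"]) (simp add: nz)
  have "?a i > 0" if i: "i \<in> {valuation P..degree P}" for i
  proof (cases "2 * i \<le> N")
    case True
    then show ?thesis using pos[OF val] co(4)[of "valuation P" i] i by auto
  next
    case False
    then show ?thesis using pos[of "degree P"] nz anti[of i "degree P"] i by fastforce
  qed
  moreover have "unimodal ?a"
    unfolding unimodal_def
  proof (intro exI[of _ "N div 2"] conjI allI impI)
    fix i j assume ij: "N div 2 \<le> i \<and> i \<le> j"
    show "?a j \<le> ?a i"
    proof (cases "N \<le> 2 * i")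
      case True
      then show ?thesis using anti ij by blast
    next
      case False
      then have N: "N = 2 * i + 1" using ij by linarith
      show ?thesis
      proof (cases "j = i")
        case False
        then have "?a j \<le> ?a (Suc i)" using anti[of "Suc i" j] ij N by simp
        then show ?thesis using sym[of i] N by simp
      qed simp
    qed
  qed (use co(4) in auto)
  moreover have "icoeff P k = icoeff P (int N - k)" for k
  proof (cases "0 \<le> k \<and> k \<le> int N")
    case True
    then have "nat (int N - k) = N - nat k" "nat k \<le> N" by auto
    then show ?thesis using True co(3)[of "nat k"] by (simp add: icoeff_def)
  next
    case False
    then show ?thesis using co(2) by (auto simp: icoeff_def)
  qed
  ultimately show ?thesis using nz co(1) by (simp add: psu_def)
qed

section \<open>Homogeneous systems with more unknowns than equations\<close>

text \<open>
  Gaussian elimination: solving one equation costs one unknown.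
\<close>

lemma nontrivial_kernel:
  fixes M :: "'a \<Rightarrow> 'b \<Rightarrow> real"
  assumes "finite B" "finite A" "card B < card A"
  shows "\<exists>v. (\<exists>a\<in>A. v a \<noteq> 0) \<and> (\<forall>b\<in>B. (\<Sum>a\<in>A. M a b * v a) = 0)"
  using assms
proof (induction B arbitrary: A M rule: finite_induct)
  case empty
  then obtain a where "a \<in> A" by fastforce
  then show ?case by (intro exI[of _ "\<lambda>_. 1"]) auto
next
  case (insert b B)
  show ?case
  proof (cases "\<forall>a\<in>A. M a b = 0")
    case True
    then show ?thesis using insert.IH[of A M] insert.prems insert.hyps by auto
  next
    case False
    then obtain a0 where a0: "a0 \<in> A" "M a0 b \<noteq> 0" by blast
    let ?A = "A - {a0}"
    \<comment> \<open>Solve the equation \<open>b\<close> for the unknown at \<open>a0\<close> and substitute.\<close>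
    let ?M = "\<lambda>a b'. M a b' - M a b / M a0 b * M a0 b'"
    have "card B < card ?A" using a0 insert.prems insert.hyps by simp
    then obtain v where v: "\<exists>a\<in>?A. v a \<noteq> 0" "\<And>b'. b' \<in> B \<Longrightarrow> (\<Sum>a\<in>?A. ?M a b' * v a) = 0"
      using insert.IH[of ?A ?M] insert.prems(1) by auto
    define u where "u = v(a0 := - (\<Sum>a\<in>?A. M a b * v a) / M a0 b)"
    have split: "(\<Sum>a\<in>A. M a b' * u a) = (\<Sum>a\<in>?A. M a b' * v a) - (\<Sum>a\<in>?A. M a b * v a) / M a0 b * M a0 b'" for b'
    proof -
      have "(\<Sum>a\<in>A. M a b' * u a) = M a0 b' * u a0 + (\<Sum>a\<in>?A. M a b' * u a)"
        using a0(1) insert.prems(1) by (simp add: sum.remove)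
      also have "(\<Sum>a\<in>?A. M a b' * u a) = (\<Sum>a\<in>?A. M a b' * v a)"
        by (intro sum.cong) (auto simp: u_def)
      finally show ?thesis by (simp add: u_def)
    qed
    have "(\<Sum>a\<in>A. M a b' * u a) = (\<Sum>a\<in>?A. ?M a b' * v a)" for b'
      unfolding split by (simp add: left_diff_distrib right_diff_distrib sum_subtractf sum_divide_distrib sum_distrib_left sum_distrib_right mult_ac)
    then have "(\<Sum>a\<in>A. M a b' * u a) = 0" if "b' \<in> B" for b' using v(2)[OF that] by simp
    moreover have "(\<Sum>a\<in>A. M a b * u a) = 0" unfolding split using a0(2) by simp
    moreover have "\<exists>a\<in>A. u a \<noteq> 0" using v(1) by (auto simp: u_def)
    ultimately show ?thesis by auto
  qed
qed

section \<open>Raising and lowering operators on sets\<close>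

text \<open>
  Exchanging the roles of \<open>s\<close> and \<open>s + 1\<close>. When exactly one of them belongs to the set, this moves a
  particle to the neighbouring site and changes the sum of the set by one.
\<close>

definition swap :: "nat \<Rightarrow> nat set \<Rightarrow> nat set" where
  "swap s T = transpose s (Suc s) ` T"

lemma swap_swap [simp]: "swap s (swap s T) = T"
  by (simp add: swap_def image_comp)

lemma mem_swap: "x \<in> swap s T \<longleftrightarrow> transpose s (Suc s) x \<in> T"
  unfolding swap_def by (metis image_eqI imageE transpose_involutory)

lemma mem_swap_simps [simp]:
  "s \<in> swap s T \<longleftrightarrow> Suc s \<in> T" "Suc s \<in> swap s T \<longleftrightarrow> s \<in> T"
  "x \<noteq> s \<Longrightarrow> x \<noteq> Suc s \<Longrightarrow> x \<in> swap s T \<longleftrightarrow> x \<in> T"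
  by (simp_all add: mem_swap transpose_def)

lemma card_swap [simp]: "card (swap s T) = card T"
  unfolding swap_def by (rule card_image) (rule inj_on_subset[OF bij_is_inj[OF bij_transpose] subset_UNIV])

lemma swap_subset: "s < p \<Longrightarrow> T \<subseteq> {..p} \<Longrightarrow> swap s T \<subseteq> {..p}"
  by (auto simp: swap_def transpose_def)

lemma swap_commute:
  "s \<noteq> t \<Longrightarrow> s \<noteq> Suc t \<Longrightarrow> t \<noteq> Suc s \<Longrightarrow> swap s (swap t T) = swap t (swap s T)"
  by (auto simp: mem_swap transpose_def)

lemma sum_swap:
  assumes "finite T" "Suc s \<in> T" "s \<notin> T"
  shows "\<Sum>T = Suc (\<Sum>(swap s T))"
proof -
  have "swap s T = insert s (T - {Suc s})"
    using assms by (auto simp: mem_swap transpose_def split: if_splits)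
  then have "\<Sum>(swap s T) = s + \<Sum>(T - {Suc s})" using assms by simp
  moreover have "\<Sum>T = Suc s + \<Sum>(T - {Suc s})" using assms by (simp add: sum.remove)
  ultimately show ?thesis by simp
qed

definition raise :: "nat \<Rightarrow> (nat set \<Rightarrow> real) \<Rightarrow> nat set \<Rightarrow> real" where
  "raise s v T = (if Suc s \<in> T \<and> s \<notin> T then v (swap s T) else 0)"

definition lower :: "nat \<Rightarrow> (nat set \<Rightarrow> real) \<Rightarrow> nat set \<Rightarrow> real" where
  "lower s v T = (if s \<in> T \<and> Suc s \<notin> T then v (swap s T) else 0)"

definition inner :: "nat \<Rightarrow> (nat set \<Rightarrow> real) \<Rightarrow> (nat set \<Rightarrow> real) \<Rightarrow> real" where
  "inner p u v = (\<Sum>T\<in>Pow {..p}. u T * v T)"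

lemma inner_commute: "inner p u v = inner p v u"
  by (simp add: inner_def mult.commute)

text \<open>
  The exchange \<open>swap s\<close> is an involution of the subsets of \<open>{..p}\<close> that turns the condition
  for raising into the condition for lowering.
\<close>

lemma inner_raise:
  assumes "s < p" shows "inner p (raise s u) v = inner p u (lower s v)"
proof -
  have bij: "bij_betw (swap s) (Pow {..p}) (Pow {..p})"
    using swap_subset[OF assms] by (intro bij_betw_byWitness[of _ "swap s"] image_subsetI ballI) auto
  have "inner p (raise s u) v = (\<Sum>T\<in>Pow {..p}. raise s u (swap s T) * v (swap s T))"
    unfolding inner_def by (rule sum.reindex_bij_betw[OF bij, symmetric])
  also have "\<dots> = inner p u (lower s v)"
    unfolding inner_def by (intro sum.cong) (auto simp: raise_def lower_def)
  finally show ?thesis .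
qed

text \<open>
  If the two sites are neighbours, each composite requires one site to be both occupied and
  empty, so both vanish; otherwise the two exchanges act on disjoint pairs of sites.
\<close>

lemma lower_raise_commute: "s \<noteq> t \<Longrightarrow> lower s (raise t v) T = raise t (lower s v) T"
proof -
  assume st: "s \<noteq> t"
  consider "t = Suc s" | "s = Suc t" | "s \<noteq> Suc t" "t \<noteq> Suc s" by blast
  then show ?thesis
  proof cases
    case 3
    then show ?thesis
      using swap_commute[OF st 3] st by (simp add: raise_def lower_def)
  qed (simp_all add: raise_def lower_def)
qed

text \<open>
  The square root makes the raising and lowering operators adjoint; the squares are the
  structure constants of the irreducible representation of \<open>sl\<^sub>2\<close> of dimension \<open>p + 1\<close>, and
  functions on \<open>l\<close>-element sets form its \<open>l\<close>-th exterior power.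
\<close>

definition weight :: "nat \<Rightarrow> nat \<Rightarrow> real" where
  "weight p s = sqrt (real (Suc s) * real (p - s))"

definition Raise :: "nat \<Rightarrow> (nat set \<Rightarrow> real) \<Rightarrow> nat set \<Rightarrow> real" where
  "Raise p v T = (\<Sum>s<p. weight p s * raise s v T)"

definition Lower :: "nat \<Rightarrow> (nat set \<Rightarrow> real) \<Rightarrow> nat set \<Rightarrow> real" where
  "Lower p v T = (\<Sum>s<p. weight p s * lower s v T)"

lemma inner_sum_sum:
  "inner p (\<lambda>T. \<Sum>s\<in>I. w s * F s T) (\<lambda>T. \<Sum>s\<in>I. w s * G s T)
    = (\<Sum>s\<in>I. \<Sum>t\<in>I. w s * w t * inner p (F s) (G t))"
proof -
  have "inner p (\<lambda>T. \<Sum>s\<in>I. w s * F s T) (\<lambda>T. \<Sum>s\<in>I. w s * G s T)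
    = (\<Sum>T\<in>Pow {..p}. \<Sum>s\<in>I. \<Sum>t\<in>I. w s * w t * (F s T * G t T))"
    unfolding inner_def by (simp add: sum_product ac_simps)
  also have "\<dots> = (\<Sum>s\<in>I. \<Sum>T\<in>Pow {..p}. \<Sum>t\<in>I. w s * w t * (F s T * G t T))"
    by (rule sum.swap)
  also have "\<dots> = (\<Sum>s\<in>I. \<Sum>t\<in>I. \<Sum>T\<in>Pow {..p}. w s * w t * (F s T * G t T))"
    by (intro sum.cong refl) (rule sum.swap)
  finally show ?thesis by (simp add: inner_def sum_distrib_left)
qed

text \<open>
  Summation by parts: the squared weights \<open>f (s + 1)\<close> with \<open>f s = s (p + 1 - s)\<close> have differences
  \<open>p - 2 s\<close>, and \<open>f\<close> vanishes at both ends \<open>0\<close> and \<open>p + 1\<close>.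
\<close>

lemma weighted_telescope:
  fixes \<chi> :: "nat \<Rightarrow> real"
  shows "(\<Sum>s<p. (weight p s)\<^sup>2 * (\<chi> s - \<chi> (Suc s))) = (\<Sum>s\<le>p. (real p - 2 * real s) * \<chi> s)"
proof -
  define f where "f s = real s * (real p + 1 - real s)" for s
  have w: "(weight p s)\<^sup>2 = f (Suc s)" if "s < p" for s
    using that by (simp add: weight_def f_def of_nat_diff)
  have "(\<Sum>s<p. (weight p s)\<^sup>2 * (\<chi> s - \<chi> (Suc s)))
      = (\<Sum>s<p. f (Suc s) * \<chi> s) - (\<Sum>s<p. f (Suc s) * \<chi> (Suc s))"
    using w by (simp add: right_diff_distrib sum_subtractf)
  also have "(\<Sum>s<p. f (Suc s) * \<chi> s) = (\<Sum>s<Suc p. f (Suc s) * \<chi> s)"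
    by (simp add: f_def)
  also have "(\<Sum>s<p. f (Suc s) * \<chi> (Suc s)) = (\<Sum>s<Suc p. f s * \<chi> s)"
    by (subst sum.lessThan_Suc_shift) (simp add: f_def)
  also have "(\<Sum>s<Suc p. f (Suc s) * \<chi> s) - (\<Sum>s<Suc p. f s * \<chi> s) = (\<Sum>s<Suc p. (real p - 2 * real s) * \<chi> s)"
    unfolding sum_subtractf[symmetric] by (intro sum.cong refl) (simp add: f_def algebra_simps)
  finally show ?thesis by (simp only: lessThan_Suc_atMost)
qed

text \<open>
  The commutation relation of \<open>sl\<^sub>2\<close> in the form of an identity of norms. Off-diagonal terms of
  the commutator cancel by commutation, and the diagonal ones add up to the weight of the set.
\<close>

lemma norm_Raise:
  "inner p (Raise p v) (Raise p v) = inner p (Lower p v) (Lower p v)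
     + (\<Sum>T\<in>Pow {..p}. (real (card T) * real p - 2 * real (\<Sum>T)) * (v T)\<^sup>2)"
proof -
  let ?w = "weight p"
  have R: "inner p (Raise p v) (Raise p v) = (\<Sum>s<p. \<Sum>t<p. ?w s * ?w t * inner p v (lower s (raise t v)))"
    using inner_sum_sum[of p ?w "\<lambda>s. raise s v" "{..<p}" "\<lambda>s. raise s v"]
    unfolding Raise_def by (simp add: inner_raise)
  have "inner p (Lower p v) (Lower p v) = (\<Sum>s<p. \<Sum>t<p. ?w s * ?w t * inner p v (raise s (lower t v)))"
    using inner_sum_sum[of p ?w "\<lambda>s. lower s v" "{..<p}" "\<lambda>s. lower s v"] inner_raise inner_commute
    unfolding Lower_def by simp
  also have "\<dots> = (\<Sum>t<p. \<Sum>s<p. ?w s * ?w t * inner p v (raise s (lower t v)))"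
    by (rule sum.swap)
  finally have L: "inner p (Lower p v) (Lower p v) = (\<Sum>s<p. \<Sum>t<p. ?w s * ?w t * inner p v (raise t (lower s v)))"
    by (simp add: ac_simps)
  have "inner p (Raise p v) (Raise p v) - inner p (Lower p v) (Lower p v)
      = (\<Sum>s<p. \<Sum>t<p. ?w s * ?w t * (inner p v (lower s (raise t v)) - inner p v (raise t (lower s v))))"
    unfolding R L by (simp add: sum_subtractf right_diff_distrib)
  also have "\<dots> = (\<Sum>s<p. \<Sum>t<p. if t = s then
      (?w s)\<^sup>2 * (\<Sum>T\<in>Pow {..p}. (of_bool (s \<in> T) - of_bool (Suc s \<in> T)) * (v T)\<^sup>2) else 0)"
  proof (intro sum.cong refl)
    fix s t
    show "?w s * ?w t * (inner p v (lower s (raise t v)) - inner p v (raise t (lower s v)))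
      = (if t = s then (?w s)\<^sup>2 * (\<Sum>T\<in>Pow {..p}. (of_bool (s \<in> T) - of_bool (Suc s \<in> T)) * (v T)\<^sup>2) else 0)"
    proof (cases "t = s")
      case True
      have "inner p v (lower s (raise s v)) - inner p v (raise s (lower s v))
         = (\<Sum>T\<in>Pow {..p}. (of_bool (s \<in> T) - of_bool (Suc s \<in> T)) * (v T)\<^sup>2)"
        unfolding inner_def sum_subtractf[symmetric]
        by (intro sum.cong refl) (auto simp: lower_def raise_def power2_eq_square)
      then show ?thesis using True by (simp add: power2_eq_square)
    next
      case False
      then have "lower s (raise t v) = raise t (lower s v)"
        using lower_raise_commute[of s t v] by (intro ext) simp
      then show ?thesis using False by simp
    qed
  qed
  also have "\<dots> = (\<Sum>s<p. \<Sum>T\<in>Pow {..p}. (?w s)\<^sup>2 * (of_bool (s \<in> T) - of_bool (Suc s \<in> T)) * (v T)\<^sup>2)"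
    by (simp add: sum_distrib_left mult.assoc)
  also have "\<dots> = (\<Sum>T\<in>Pow {..p}. (\<Sum>s<p. (?w s)\<^sup>2 * (of_bool (s \<in> T) - of_bool (Suc s \<in> T))) * (v T)\<^sup>2)"
    by (subst sum.swap) (simp add: sum_distrib_right)
  also have "\<dots> = (\<Sum>T\<in>Pow {..p}. (real (card T) * real p - 2 * real (\<Sum>T)) * (v T)\<^sup>2)"
  proof (intro sum.cong refl)
    fix T assume "T \<in> Pow {..p}"
    then have T: "T \<subseteq> {..p}" by simp
    have "(\<Sum>s\<le>p. (real p - 2 * real s) * of_bool (s \<in> T)) = (\<Sum>s\<in>T. real p - 2 * real s)"
      using T by (intro sum.mono_neutral_cong_right) auto
    also have "\<dots> = real (card T) * real p - 2 * real (\<Sum>T)"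
      by (simp add: sum_subtractf sum_distrib_left)
    finally show "(\<Sum>s<p. (?w s)\<^sup>2 * (of_bool (s \<in> T) - of_bool (Suc s \<in> T))) * (v T)\<^sup>2
        = (real (card T) * real p - 2 * real (\<Sum>T)) * (v T)\<^sup>2"
      by (simp only: weighted_telescope[of p "\<lambda>s. of_bool (s \<in> T)"])
  qed
  finally show ?thesis by simp
qed

definition level :: "nat \<Rightarrow> nat \<Rightarrow> nat \<Rightarrow> nat set set" where
  "level p l i = {T. T \<subseteq> {..p} \<and> card T = l \<and> \<Sum>T = i}"

lemma finite_level [simp]: "finite (level p l i)"
  by (rule finite_subset[of _ "Pow {..p}"]) (auto simp: level_def)

text \<open>
  Below the middle level the norm identity shows that the raising operator is injective, since
  it bounds the norm of an image below by a positive multiple of the norm of the argument.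
  If the next level were smaller, the operator would have a nontrivial kernel.
\<close>

lemma card_level_mono:
  assumes "2 * i < l * p"
  shows "card (level p l i) \<le> card (level p l (Suc i))"
proof (rule ccontr)
  let ?A = "level p l i" and ?B = "level p l (Suc i)"
  let ?M = "\<lambda>S T. \<Sum>s<p. weight p s * of_bool (Suc s \<in> T \<and> s \<notin> T \<and> swap s T = S)"
  assume "\<not> card ?A \<le> card ?B"
  then obtain u where u: "\<exists>S\<in>?A. u S \<noteq> 0" "\<And>T. T \<in> ?B \<Longrightarrow> (\<Sum>S\<in>?A. ?M S T * u S) = 0"
    using nontrivial_kernel[of ?B ?A ?M] by auto
  \<comment> \<open>Extended by zero, so that \<open>Raise p v\<close> vanishes outside the next level for degree reasons.\<close>
  define v where "v S = (if S \<in> ?A then u S else 0)" for S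
  have R: "Raise p v T = (\<Sum>S\<in>?A. ?M S T * u S)" for T
  proof -
    have "(\<Sum>S\<in>?A. ?M S T * u S)
        = (\<Sum>s<p. \<Sum>S\<in>?A. weight p s * of_bool (Suc s \<in> T \<and> s \<notin> T \<and> swap s T = S) * u S)"
      unfolding sum_distrib_right by (rule sum.swap)
    also have "\<dots> = (\<Sum>s<p. weight p s * raise s v T)"
    proof (intro sum.cong refl)
      fix s
      have "(\<Sum>S\<in>?A. weight p s * of_bool (Suc s \<in> T \<and> s \<notin> T \<and> swap s T = S) * u S)
          = (\<Sum>S\<in>?A. if S = swap s T then weight p s * of_bool (Suc s \<in> T \<and> s \<notin> T) * u S else 0)"
        by (intro sum.cong) auto
      also have "\<dots> = weight p s * raise s v T"
        by (simp add: raise_def v_def)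
      finally show "(\<Sum>S\<in>?A. weight p s * of_bool (Suc s \<in> T \<and> s \<notin> T \<and> swap s T = S) * u S) = weight p s * raise s v T" .
    qed
    finally show ?thesis by (simp add: Raise_def)
  qed
  have "Raise p v T = 0" if T: "T \<in> Pow {..p}" for T
  proof (cases "T \<in> ?B")
    case True
    then show ?thesis using u(2) R by simp
  next
    case False
    have "raise s v T = 0" if "s < p" for s
    proof (rule ccontr)
      assume "raise s v T \<noteq> 0"
      then have s: "Suc s \<in> T" "s \<notin> T" "swap s T \<in> ?A"
        by (auto simp: raise_def v_def split: if_splits)
      have "finite T" using T finite_subset by auto
      then have "T \<in> ?B" using s T sum_swap[of T s] by (simp add: level_def)
      then show False using False by simp
    qed
    then show ?thesis by (simp add: Raise_def)
  qed
  then have "inner p (Raise p v) (Raise p v) = 0" by (simp add: inner_def)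
  moreover have "inner p (Lower p v) (Lower p v) \<ge> 0" by (simp add: inner_def sum_nonneg)
  moreover have "(\<Sum>T\<in>Pow {..p}. (real (card T) * real p - 2 * real (\<Sum>T)) * (v T)\<^sup>2) > 0"
  proof -
    have pos: "real l * real p - 2 * real i > 0"
      using assms by (simp flip: of_nat_mult)
    obtain S where S: "S \<in> ?A" "u S \<noteq> 0" using u(1) by blast
    show ?thesis
    proof (rule sum_pos2[of _ S])
      show "S \<in> Pow {..p}" using S by (simp add: level_def)
      have "card S = l" "\<Sum>S = i" using S by (simp_all add: level_def)
      then show "0 < (real (card S) * real p - 2 * real (\<Sum>S)) * (v S)\<^sup>2"
        using pos S by (simp add: v_def del: of_nat_sum)
      fix T
      show "0 \<le> (real (card T) * real p - 2 * real (\<Sum>T)) * (v T)\<^sup>2"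
        using pos by (cases "T \<in> ?A") (auto simp: v_def level_def simp del: of_nat_sum)
    qed simp
  qed
  ultimately show False using norm_Raise[of p v] by linarith
qed

section \<open>Gaussian binomial coefficients\<close>

definition subsets :: "nat \<Rightarrow> nat \<Rightarrow> nat set set" where
  "subsets n l = {S. S \<subseteq> {..<n} \<and> card S = l}"

definition subset_gf :: "nat \<Rightarrow> nat \<Rightarrow> qpoly" where
  "subset_gf n l = (\<Sum>S\<in>subsets n l. qpow (\<Sum>S))"

lemma finite_subsets [simp]: "finite (subsets n l)"
  by (rule finite_subset[of _ "Pow {..<n}"]) (auto simp: subsets_def)

text \<open>
  Pascal's rule, according to whether the largest element \<open>n\<close> belongs to the set.
\<close>

lemma subset_gf_Suc_Suc: "subset_gf (Suc n) (Suc l) = subset_gf n (Suc l) + qpow n * subset_gf n l"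
proof -
  have fin: "finite S" if "S \<subseteq> {..<n}" for S using that finite_subset by blast
  have eq: "subsets (Suc n) (Suc l) = subsets n (Suc l) \<union> insert n ` subsets n l"
  proof (intro equalityI subsetI)
    fix S assume S: "S \<in> subsets (Suc n) (Suc l)"
    show "S \<in> subsets n (Suc l) \<union> insert n ` subsets n l"
    proof (cases "n \<in> S")
      case True
      then have "S - {n} \<in> subsets n l" "S = insert n (S - {n})"
        using S by (auto simp: subsets_def less_Suc_eq)
      then show ?thesis by blast
    next
      case False
      then show ?thesis using S by (auto simp: subsets_def less_Suc_eq)
    qed
  next
    fix S assume "S \<in> subsets n (Suc l) \<union> insert n ` subsets n l"
    then show "S \<in> subsets (Suc n) (Suc l)"
    proof
      assume "S \<in> insert n ` subsets n l"
      then obtain R where R: "S = insert n R" "R \<subseteq> {..<n}" "card R = l" by (auto simp: subsets_def)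
      then have "n \<notin> R" by auto
      then show ?thesis using R fin[of R] by (auto simp: subsets_def)
    qed (auto simp: subsets_def)
  qed
  have disj: "subsets n (Suc l) \<inter> insert n ` subsets n l = {}" by (auto simp: subsets_def)
  have nn: "n \<notin> S" if "S \<in> subsets n l" for S using that by (auto simp: subsets_def)
  have inj: "inj_on (insert n) (subsets n l)"
    using nn by (meson inj_onI insert_ident)
  have "(\<Sum>S\<in>subsets n l. qpow (\<Sum>(insert n S))) = qpow n * subset_gf n l"
    unfolding subset_gf_def sum_distrib_left
  proof (rule sum.cong[OF refl])
    fix S assume "S \<in> subsets n l"
    then have "finite S" "n \<notin> S" using nn fin by (auto simp: subsets_def)
    then show "qpow (\<Sum>(insert n S)) = qpow n * qpow (\<Sum>S)" by (simp add: qpow_add)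
  qed
  then show ?thesis
    unfolding subset_gf_def[of "Suc n"] eq
    by (simp add: sum.union_disjoint[OF _ _ disj] sum.reindex[OF inj] subset_gf_def)
qed

lemma subset_gf_0: "subset_gf n 0 = 1"
proof -
  have "subsets n 0 = {{}}"
    by (auto simp: subsets_def dest: finite_subset[OF _ finite_lessThan])
  then show ?thesis by (simp add: subset_gf_def)
qed

lemma sum_lessThan_choose: "\<Sum>{..<n} = n choose 2"
  by (induction n) (simp_all add: numeral_2_eq_2)

lemma subset_gf_self: "subset_gf n n = qpow (n choose 2)"
proof -
  have "subsets n n = {{..<n}}"
    using card_subset_eq[of "{..<n}"] unfolding subsets_def by auto
  then show ?thesis by (simp add: subset_gf_def sum_lessThan_choose)
qed

text \<open>
  Both sides satisfy the same Pascal recurrence; the step is the additivity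
  \<open>(l + m)\<^sub>q = (m)\<^sub>q + q\<^sup>m (l)\<^sub>q\<close>.
\<close>

lemma q_fact_subset_gf: "q_fact l * q_fact m * subset_gf (l + m) l = qpow (l choose 2) * q_fact (l + m)"
proof (induction "l + m" arbitrary: l m)
  case 0
  then show ?case by (simp add: q_fact_0 subset_gf_0 numeral_2_eq_2)
next
  case (Suc n)
  consider "l = 0" | "m = 0" | l' m' where "l = Suc l'" "m = Suc m'"
    using not0_implies_Suc by blast
  then show ?case
  proof cases
    case 1
    then show ?thesis by (simp add: q_fact_0 subset_gf_0 numeral_2_eq_2)
  next
    case 2
    then show ?thesis by (simp add: q_fact_0 subset_gf_self mult.commute)
  next
    case 3
    have n: "n = l + m'" "n = l' + m" using Suc.hyps(2) 3 by auto
    have IH1: "q_fact l * q_fact m' * subset_gf n l = qpow (l choose 2) * q_fact n"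
      using Suc.hyps(1)[of l m'] n by simp
    have IH2: "q_fact l' * q_fact m * subset_gf n l' = qpow (l' choose 2) * q_fact n"
      using Suc.hyps(1)[of l' m] n(2) by simp
    have lc: "l choose 2 = l' + (l' choose 2)" using 3 by (simp add: numeral_2_eq_2)
    have gf: "subset_gf (l + m) l = subset_gf n l + qpow (l' + m) * subset_gf n l'"
      using subset_gf_Suc_Suc[of n l'] Suc.hyps(2) 3 n(2) by simp
    have fl: "q_fact l = q_fact l' * q_int l" and fm: "q_fact m = q_fact m' * q_int m"
      using 3 by (simp_all add: q_fact_Suc)
    have "q_fact l * q_fact m * subset_gf (l + m) l
        = q_int m * (q_fact l * q_fact m' * subset_gf n l)
        + qpow (l' + m) * q_int l * (q_fact l' * q_fact m * subset_gf n l')"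
      unfolding gf by (simp add: fl fm algebra_simps)
    also have "\<dots> = qpow (l choose 2) * q_fact n * (q_int m + qpow m * q_int l)"
      unfolding IH1 IH2 lc qpow_add by (simp add: algebra_simps)
    also have "q_int m + qpow m * q_int l = q_int (Suc n)"
      using q_int_add[of m l] Suc.hyps(2) by (simp add: add.commute)
    also have "qpow (l choose 2) * q_fact n * q_int (Suc n) = qpow (l choose 2) * q_fact (Suc n)"
      by (simp add: q_fact_Suc mult.assoc)
    finally show ?thesis using Suc.hyps(2) by simp
  qed
qed

text \<open>
  The Gaussian binomial coefficient \<open>l + m\<close> choose \<open>l\<close>. The shift normalizes the smallest
  exponent, attained at \<open>{0..<l}\<close>, to zero.
\<close>

definition qbinom :: "nat \<Rightarrow> nat \<Rightarrow> qpoly" where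
  "qbinom l m = (\<Sum>S\<in>subsets (l + m) l. qpow (\<Sum>S - (l choose 2)))"

lemma subsets_sum_ge: "S \<in> subsets n l \<Longrightarrow> (l choose 2) \<le> \<Sum>S"
proof (induction n arbitrary: S l)
  case 0
  then show ?case by (auto simp: subsets_def numeral_2_eq_2)
next
  case (Suc n)
  have fin: "finite S" using Suc.prems finite_subset by (auto simp: subsets_def)
  show ?case
  proof (cases "n \<in> S")
    case True
    have sub: "S - {n} \<subseteq> {..<n}" using Suc.prems by (auto simp: subsets_def less_Suc_eq)
    have l: "l = Suc (l - 1)" and cR: "card (S - {n}) = l - 1"
      using Suc.prems fin True card_Suc_Diff1[OF fin True] by (auto simp: subsets_def)
    have "l - 1 \<le> n" using card_mono[OF _ sub] cR by simp
    moreover have "S - {n} \<in> subsets n (l - 1)" using sub cR by (simp add: subsets_def)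
    moreover have "\<Sum>S = n + \<Sum>(S - {n})" using fin True by (simp add: sum.remove)
    moreover have "l choose 2 = (l - 1) + ((l - 1) choose 2)"
      by (subst l) (simp add: numeral_2_eq_2)
    ultimately show ?thesis using Suc.IH[of "S - {n}" "l - 1"] by linarith
  next
    case False
    then have "S \<in> subsets n l" using Suc.prems by (auto simp: subsets_def less_Suc_eq)
    then show ?thesis by (rule Suc.IH)
  qed
qed

lemma subset_gf_qbinom: "subset_gf (l + m) l = qpow (l choose 2) * qbinom l m"
  unfolding subset_gf_def qbinom_def sum_distrib_left
  using subsets_sum_ge by (intro sum.cong refl) (simp flip: qpow_add)

lemma q_fact_qbinom: "q_fact l * q_fact m * qbinom l m = q_fact (l + m)"
proof -
  have "qpow (l choose 2) * (q_fact l * q_fact m * qbinom l m) = qpow (l choose 2) * q_fact (l + m)"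
    using q_fact_subset_gf[of l m] unfolding subset_gf_qbinom by (simp add: ac_simps)
  then show ?thesis by simp
qed

text \<open>
  Reflect the sites by \<open>s \<mapsto> p - s\<close>.
\<close>

lemma card_level_reflect:
  assumes "i \<le> l * p" shows "card (level p l (l * p - i)) = card (level p l i)"
proof -
  let ?f = "\<lambda>T. (\<lambda>s. p - s) ` T"
  have inv: "?f (?f T) = T" if "T \<subseteq> {..p}" for T
  proof -
    have "?f (?f T) = (\<lambda>s. s) ` T"
      unfolding image_comp using that by (intro image_cong refl) auto
    then show ?thesis by simp
  qed
  have f: "?f T \<in> level p l (l * p - j)" if T: "T \<in> level p l j" for T j
  proof -
    have sub: "T \<subseteq> {..p}" and c: "card T = l" "\<Sum>T = j" using T by (auto simp: level_def)
    have inj: "inj_on (\<lambda>s. p - s) T"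
    proof (rule inj_onI)
      fix x y assume "x \<in> T" "y \<in> T" "p - x = p - y"
      moreover then have "x \<le> p" "y \<le> p" using sub by auto
      ultimately show "x = y" by linarith
    qed
    have "\<Sum>(?f T) = (\<Sum>s\<in>T. p - s)" using sum.reindex[OF inj, of id] by simp
    also have "\<dots> = (\<Sum>s\<in>T. p) - \<Sum>T"
      using sub by (intro sum_subtractf_nat) auto
    finally show ?thesis using sub c card_image[OF inj] by (auto simp: level_def)
  qed
  have "bij_betw ?f (level p l i) (level p l (l * p - i))"
  proof (rule bij_betw_byWitness[of _ ?f])
    show "?f ` level p l i \<subseteq> level p l (l * p - i)" using f by blast
    show "?f ` level p l (l * p - i) \<subseteq> level p l i"
      using f[of _ "l * p - i"] assms by fastforce
  qed (use inv in \<open>auto simp: level_def\<close>)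
  then show ?thesis using bij_betw_same_card by metis
qed

lemma level_empty:
  assumes "i > l * p" shows "level p l i = {}"
proof (rule ccontr)
  assume "level p l i \<noteq> {}"
  then obtain T where T: "T \<subseteq> {..p}" "card T = l" "\<Sum>T = i" by (auto simp: level_def)
  have "\<Sum>T \<le> (\<Sum>s\<in>T. p)" using T by (intro sum_mono) auto
  then show False using T assms by simp
qed

text \<open>
  With \<open>p + 1 = l + m\<close>, the coefficient of \<open>q\<^sup>k\<close> counts the \<open>l\<close>-element subsets of \<open>{..p}\<close>
  whose sum exceeds the smallest possible one by \<open>k\<close>. These level sizes are symmetric by
  reflection and increase up to the middle.
\<close>

lemma psu_cone_qbinom: "psu_cone (l * m) (qbinom l m)"
proof (cases "l + m")
  case 0
  then have "qbinom l m = 1" using subset_gf_qbinom[of 0 0] subset_gf_0[of 0] by (simp add: numeral_2_eq_2)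
  then show ?thesis using 0 psu_cone_q_int[of 0] by (simp add: q_int_1)
next
  case (Suc p)
  let ?c = "l choose 2"
  let ?a = "\<lambda>k. real (card (level p l (k + ?c)))"
  have c2: "2 * ?c + l = l * l"
    by (induction l) (simp_all add: numeral_2_eq_2)
  have lp: "l * p = l * m + 2 * ?c"
  proof -
    have "l * Suc p = l * l + l * m" using Suc[symmetric] by (simp add: distrib_left)
    then show ?thesis using c2 by simp
  qed
  have lev: "{S \<in> subsets (l + m) l. \<Sum>S - ?c = k} = level p l (k + ?c)" for k
    using subsets_sum_ge[of _ "l + m" l] unfolding subsets_def level_def Suc lessThan_Suc_atMost
    by fastforce
  show ?thesis
  proof (rule psu_coneI[of _ ?a])
    fix k
    have "coeff (qbinom l m) k = (\<Sum>S\<in>subsets (l + m) l. if \<Sum>S - ?c = k then 1 else 0)"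
      unfolding qbinom_def coeff_sum by (intro sum.cong) auto
    also have "\<dots> = complex_of_real (?a k)"
      by (simp add: lev sum.inter_filter[symmetric])
    finally show "coeff (qbinom l m) k = complex_of_real (?a k)" .
  next
    fix k assume "l * m < k"
    show "?a k = 0"
    proof (cases "k + ?c \<le> l * p")
      case True
      have "level p l (l * p - (k + ?c)) = {}"
      proof (rule ccontr)
        assume "level p l (l * p - (k + ?c)) \<noteq> {}"
        then obtain T where "T \<in> subsets (Suc p) l" "\<Sum>T = l * p - (k + ?c)"
          unfolding level_def subsets_def lessThan_Suc_atMost by blast
        then show False using subsets_sum_ge[of T "Suc p" l] \<open>l * m < k\<close> lp True by linarith
      qed
      then show ?thesis using card_level_reflect[OF True] by simp
    next
      case False
      then show ?thesis using level_empty[of l p "k + ?c"] by simp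
    qed
  next
    fix k assume "k \<le> l * m"
    moreover then have "l * p - (k + ?c) = l * m - k + ?c" using lp by linarith
    ultimately show "?a (l * m - k) = ?a k"
      using card_level_reflect[of "k + ?c" l p] lp by simp
  next
    fix k assume "2 * Suc k \<le> l * m"
    then show "?a k \<le> ?a (Suc k)" using card_level_mono[of "k + ?c" l p] lp by simp
  qed simp
qed

section \<open>Permuting the variables\<close>

lemma sum_monomials:
  fixes f :: "'a \<Rightarrow>\<^sub>0 'b::comm_monoid_add"
  shows "(\<Sum>m\<in>Poly_Mapping.keys f. Poly_Mapping.single m (Poly_Mapping.lookup f m)) = f"
proof (rule poly_mapping_eqI)
  fix k
  show "Poly_Mapping.lookup (\<Sum>m\<in>Poly_Mapping.keys f. Poly_Mapping.single m (Poly_Mapping.lookup f m)) k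
        = Poly_Mapping.lookup f k"
    by (cases "k \<in> Poly_Mapping.keys f")
       (auto simp: lookup_sum lookup_single when_def not_in_keys_iff_lookup_eq_zero)
qed

lemma additive_sum:
  fixes \<phi> :: "'a::comm_monoid_add \<Rightarrow> 'b::comm_monoid_add"
  assumes "\<phi> 0 = 0" and "\<And>f g. \<phi> (f + g) = \<phi> f + \<phi> g"
  shows "\<phi> (\<Sum>i\<in>I. F i) = (\<Sum>i\<in>I. \<phi> (F i))"
  by (induction I rule: infinite_finite_induct) (auto simp: assms)

lemma multiplicative_if_on_monomials:
  fixes \<phi> :: "('a::comm_monoid_add \<Rightarrow>\<^sub>0 'b::comm_semiring_1) \<Rightarrow> 'c::comm_semiring_1"
  assumes zero: "\<phi> 0 = 0" and add: "\<And>f g. \<phi> (f + g) = \<phi> f + \<phi> g"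
    and mono: "\<And>m a n b. \<phi> (Poly_Mapping.single m a * Poly_Mapping.single n b)
                 = \<phi> (Poly_Mapping.single m a) * \<phi> (Poly_Mapping.single n b)"
  shows "\<phi> (f * g) = \<phi> f * \<phi> g"
proof -
  let ?s = "\<lambda>f m. Poly_Mapping.single m (Poly_Mapping.lookup f m)"
  have "\<phi> (f * g) = \<phi> ((\<Sum>m\<in>Poly_Mapping.keys f. ?s f m) * (\<Sum>n\<in>Poly_Mapping.keys g. ?s g n))"
    by (simp only: sum_monomials)
  also have "\<dots> = (\<Sum>m\<in>Poly_Mapping.keys f. \<Sum>n\<in>Poly_Mapping.keys g. \<phi> (?s f m) * \<phi> (?s g n))"
    by (simp only: sum_product additive_sum[of \<phi>, OF zero add] mono)
  also have "\<dots> = \<phi> (\<Sum>m\<in>Poly_Mapping.keys f. ?s f m) * \<phi> (\<Sum>n\<in>Poly_Mapping.keys g. ?s g n)"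
    by (simp only: sum_product additive_sum[of \<phi>, OF zero add])
  finally show ?thesis by (simp only: sum_monomials)
qed

lemma multiplicative_prod:
  fixes \<phi> :: "'a::comm_monoid_mult \<Rightarrow> 'b::comm_monoid_mult"
  assumes "\<phi> 1 = 1" and "\<And>f g. \<phi> (f * g) = \<phi> f * \<phi> g"
  shows "\<phi> (\<Prod>i\<in>I. F i) = (\<Prod>i\<in>I. \<phi> (F i))"
  by (induction I rule: infinite_finite_induct) (auto simp: assms)

lemma lookup_perm_act:
  assumes "bij \<sigma>"
  shows "Poly_Mapping.lookup (perm_act \<sigma> f) m = Poly_Mapping.lookup f (Poly_Mapping.map_key \<sigma> m)"
  using map_key_inj[OF assms] by (simp add: perm_act_def map_key.rep_eq)

lemma perm_act_single:
  assumes "bij \<sigma>"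
  shows "perm_act \<sigma> (Poly_Mapping.single m a) = Poly_Mapping.single (Poly_Mapping.map_key (inv \<sigma>) m) a"
proof -
  have "Poly_Mapping.map_key \<sigma> (Poly_Mapping.map_key (inv \<sigma>) m) = m"
    using assms bij_is_surj[OF assms]
    by (intro poly_mapping_eqI)
       (simp add: map_key.rep_eq bij_is_inj bij_imp_bij_inv)
  then show ?thesis
    unfolding perm_act_def by (metis map_key_single map_key_inj[OF assms])
qed

lemma perm_act_zero: "bij \<sigma> \<Longrightarrow> perm_act \<sigma> 0 = 0"
  by (rule poly_mapping_eqI) (simp add: lookup_perm_act)

lemma perm_act_add: "bij \<sigma> \<Longrightarrow> perm_act \<sigma> (f + g) = perm_act \<sigma> f + perm_act \<sigma> g"
  by (rule poly_mapping_eqI) (simp add: lookup_perm_act lookup_add)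

lemma perm_act_diff: "bij \<sigma> \<Longrightarrow> perm_act \<sigma> (f - g) = perm_act \<sigma> f - perm_act \<sigma> g"
  by (rule poly_mapping_eqI) (simp add: lookup_perm_act lookup_minus)

lemma perm_act_Const: "bij \<sigma> \<Longrightarrow> perm_act \<sigma> (Const P) = Const P"
  by (simp add: Const_def perm_act_single bij_is_inj bij_imp_bij_inv)

lemma perm_act_Q: "bij \<sigma> \<Longrightarrow> perm_act \<sigma> Q = Q"
  by (simp add: Q_def perm_act_Const)

lemma Const_1: "Const 1 = 1"
  by (simp add: Const_def)

lemma perm_act_one: "bij \<sigma> \<Longrightarrow> perm_act \<sigma> 1 = 1"
  using perm_act_Const[of \<sigma> 1] by (simp add: Const_1)

lemma perm_act_mult:
  assumes "bij \<sigma>"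
  shows "perm_act \<sigma> (f * g) = perm_act \<sigma> f * perm_act \<sigma> g"
proof (rule multiplicative_if_on_monomials[of "perm_act \<sigma>"])
  fix m n :: "nat \<Rightarrow>\<^sub>0 nat" and a b :: qpoly
  show "perm_act \<sigma> (Poly_Mapping.single m a * Poly_Mapping.single n b)
      = perm_act \<sigma> (Poly_Mapping.single m a) * perm_act \<sigma> (Poly_Mapping.single n b)"
    using assms by (simp add: mult_single perm_act_single map_key_plus bij_imp_bij_inv bij_is_inj)
qed (use assms in \<open>simp_all add: perm_act_zero perm_act_add\<close>)

lemma perm_act_sum: "bij \<sigma> \<Longrightarrow> perm_act \<sigma> (\<Sum>i\<in>I. F i) = (\<Sum>i\<in>I. perm_act \<sigma> (F i))"
  by (rule additive_sum) (simp_all add: perm_act_zero perm_act_add)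

lemma perm_act_prod: "bij \<sigma> \<Longrightarrow> perm_act \<sigma> (\<Prod>i\<in>I. F i) = (\<Prod>i\<in>I. perm_act \<sigma> (F i))"
  by (rule multiplicative_prod) (simp_all add: perm_act_one perm_act_mult)

lemma perm_act_comp:
  assumes "bij \<sigma>" "bij \<tau>"
  shows "perm_act (\<sigma> \<circ> \<tau>) f = perm_act \<sigma> (perm_act \<tau> f)"
proof (rule poly_mapping_eqI)
  fix m :: "nat \<Rightarrow>\<^sub>0 nat"
  have "Poly_Mapping.map_key (\<sigma> \<circ> \<tau>) m = Poly_Mapping.map_key \<tau> (Poly_Mapping.map_key \<sigma> m)"
    using assms by (intro poly_mapping_eqI) (simp add: map_key.rep_eq bij_is_inj inj_compose)
  then show "Poly_Mapping.lookup (perm_act (\<sigma> \<circ> \<tau>) f) m = Poly_Mapping.lookup (perm_act \<sigma> (perm_act \<tau> f)) m"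
    using assms by (simp add: lookup_perm_act bij_comp)
qed

section \<open>Evaluation\<close>

text \<open>
  Substitution of values in \<open>\<complex>[q]\<close> for the variables, used to extract the scalar \<open>P\<close>
  from an identity of the form \<open>f = Const P * g\<close>.
\<close>

definition evaluate :: "(nat \<Rightarrow> qpoly) \<Rightarrow> mpoly_q \<Rightarrow> qpoly" where
  "evaluate x f = (\<Sum>m\<in>Poly_Mapping.keys f. Poly_Mapping.lookup f m *
       (\<Prod>v\<in>Poly_Mapping.keys m. x v ^ Poly_Mapping.lookup m v))"

lemma evaluate_superset:
  assumes "finite K" "Poly_Mapping.keys f \<subseteq> K"
  shows "evaluate x f = (\<Sum>m\<in>K. Poly_Mapping.lookup f m *
       (\<Prod>v\<in>Poly_Mapping.keys m. x v ^ Poly_Mapping.lookup m v))"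
  unfolding evaluate_def using assms
  by (intro sum.mono_neutral_left) (auto simp: not_in_keys_iff_lookup_eq_zero)

lemma evaluate_zero: "evaluate x 0 = 0"
  by (simp add: evaluate_def)

lemma evaluate_add: "evaluate x (f + g) = evaluate x f + evaluate x g"
proof -
  let ?K = "Poly_Mapping.keys f \<union> Poly_Mapping.keys g"
  have "Poly_Mapping.keys (f + g) \<subseteq> ?K" by (rule keys_add)
  then show ?thesis
    using evaluate_superset[of ?K "f + g"] evaluate_superset[of ?K f] evaluate_superset[of ?K g]
    by (simp add: lookup_add distrib_right sum.distrib)
qed

lemma monomial_value_superset:
  assumes "finite V" "Poly_Mapping.keys m \<subseteq> V"
  shows "(\<Prod>v\<in>Poly_Mapping.keys m. x v ^ Poly_Mapping.lookup m v)
       = (\<Prod>v\<in>V. (x v :: qpoly) ^ Poly_Mapping.lookup m v)"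
  using assms
  by (intro prod.mono_neutral_left) (auto simp: not_in_keys_iff_lookup_eq_zero)

lemma evaluate_single: "evaluate x (Poly_Mapping.single m a) = a * (\<Prod>v\<in>Poly_Mapping.keys m. x v ^ Poly_Mapping.lookup m v)"
  by (simp add: evaluate_def lookup_single)

lemma evaluate_mult: "evaluate x (f * g) = evaluate x f * evaluate x g"
proof (rule multiplicative_if_on_monomials[of "evaluate x"])
  fix m n :: "nat \<Rightarrow>\<^sub>0 nat" and a b :: qpoly
  let ?V = "Poly_Mapping.keys m \<union> Poly_Mapping.keys n"
  have "Poly_Mapping.keys (m + n) \<subseteq> ?V" by (rule keys_add)
  then show "evaluate x (Poly_Mapping.single m a * Poly_Mapping.single n b)
      = evaluate x (Poly_Mapping.single m a) * evaluate x (Poly_Mapping.single n b)"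
    using monomial_value_superset[of ?V m x] monomial_value_superset[of ?V n x] monomial_value_superset[of ?V "m + n" x]
    by (simp add: mult_single evaluate_single lookup_add power_add prod.distrib)
qed (simp_all add: evaluate_zero evaluate_add)

lemma evaluate_Const: "evaluate x (Const P) = P"
  by (simp add: Const_def evaluate_single)

lemma evaluate_Q: "evaluate x Q = monom 1 1"
  by (simp add: Q_def evaluate_Const)

lemma evaluate_X: "evaluate x (X i) = x i"
  by (simp add: X_def evaluate_single)

lemma evaluate_one: "evaluate x 1 = 1"
  using evaluate_Const[of x 1] by (simp add: Const_1)

lemma evaluate_uminus: "evaluate x (- f) = - evaluate x f"
  using evaluate_add[of x f "- f"] by (simp add: evaluate_zero eq_neg_iff_add_eq_0 add.commute)

lemma evaluate_diff: "evaluate x (f - g) = evaluate x f - evaluate x g"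
  using evaluate_add[of x f "- g"] by (simp add: evaluate_uminus)

lemma evaluate_sum: "evaluate x (\<Sum>i\<in>I. F i) = (\<Sum>i\<in>I. evaluate x (F i))"
  by (rule additive_sum) (simp_all add: evaluate_zero evaluate_add)

lemma evaluate_prod: "evaluate x (\<Prod>i\<in>I. F i) = (\<Prod>i\<in>I. evaluate x (F i))"
  by (rule multiplicative_prod) (simp_all add: evaluate_one evaluate_mult)

lemma evaluate_of_int: "evaluate x (of_int k) = of_int k"
proof -
  have "evaluate x (of_nat n) = of_nat n" for n
    by (induction n) (simp_all add: evaluate_zero evaluate_add evaluate_one)
  then show ?thesis
    by (cases k) (simp_all add: evaluate_uminus evaluate_diff evaluate_one)
qed

section \<open>Sums of distinct natural numbers\<close>

lemma choose_two_Suc: "Suc n choose 2 = n + (n choose 2)"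
  by (simp add: numeral_2_eq_2)

text \<open>
  Counting from zero, the \<open>i\<close>-th smallest element of a set of natural numbers is at least
  \<open>i\<close>. This is what forces a monomial of low degree to repeat an exponent.
\<close>

lemma sum_distinct_nats:
  fixes A :: "nat set"
  assumes "finite A"
  shows "(card A choose 2) \<le> \<Sum>A \<and> ((card A choose 2) = \<Sum>A \<longrightarrow> A = {..<card A})"
  using assms
proof (induction "card A" arbitrary: A)
  case 0
  then show ?case by simp
next
  case (Suc n)
  let ?B = "A - {Max A}"
  have ne: "A \<noteq> {}" using Suc.hyps(2) by auto
  have M: "Max A \<in> A" using ne Suc.prems by simp
  have cB: "card ?B = n" using Suc.hyps(2) M Suc.prems by simp
  have "A \<subseteq> {..Max A}" using Suc.prems by auto
  then have "card A \<le> Suc (Max A)" using card_mono[of "{..Max A}" A] by simp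
  then have Mn: "n \<le> Max A" using Suc.hyps(2) by simp
  have S: "\<Sum>A = Max A + \<Sum>?B" using M Suc.prems by (simp add: sum.remove)
  have ch: "card A choose 2 = n + (n choose 2)"
    using Suc.hyps(2) choose_two_Suc[of n] by simp
  have IH: "(n choose 2) \<le> \<Sum>?B" "(n choose 2) = \<Sum>?B \<Longrightarrow> ?B = {..<n}"
    using Suc.hyps(1)[of ?B] cB Suc.prems by auto
  show ?case
  proof (intro conjI impI)
    show "(card A choose 2) \<le> \<Sum>A" using IH(1) Mn S ch by linarith
    assume eq: "(card A choose 2) = \<Sum>A"
    have "(n choose 2) = \<Sum>?B" and m: "Max A = n" using eq IH(1) Mn S ch by linarith+
    then have "?B = {..<n}" using IH(2) by simp
    then have "A = insert n {..<n}" using M m by auto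
    then show "A = {..<card A}" using Suc.hyps(2) by (auto simp: lessThan_Suc)
  qed
qed

section \<open>Homogeneous polynomials\<close>

definition homog :: "nat set \<Rightarrow> nat \<Rightarrow> mpoly_q set" where
  "homog V d = {p. \<forall>m\<in>Poly_Mapping.keys p. Poly_Mapping.keys m \<subseteq> V \<and> sum (Poly_Mapping.lookup m) V = d}"

lemma homog_0: "0 \<in> homog V d"
  by (simp add: homog_def)

lemma homog_add: "p \<in> homog V d \<Longrightarrow> q \<in> homog V d \<Longrightarrow> p + q \<in> homog V d"
  using keys_add[of p q] by (auto simp: homog_def)

lemma homog_diff: "p \<in> homog V d \<Longrightarrow> q \<in> homog V d \<Longrightarrow> p - q \<in> homog V d"
  using keys_diff[of p q] by (auto simp: homog_def)

lemma homog_mult: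
  assumes "p \<in> homog V d" "q \<in> homog V e" shows "p * q \<in> homog V (d + e)"
  unfolding homog_def
proof (intro CollectI ballI)
  fix m assume "m \<in> Poly_Mapping.keys (p * q)"
  then obtain a b where m: "m = a + b" "a \<in> Poly_Mapping.keys p" "b \<in> Poly_Mapping.keys q"
    using keys_mult by blast
  then show "Poly_Mapping.keys m \<subseteq> V \<and> sum (Poly_Mapping.lookup m) V = d + e"
    using assms keys_add[of a b] by (fastforce simp: homog_def lookup_add sum.distrib)
qed

lemma homog_sum: "(\<And>i. i \<in> I \<Longrightarrow> F i \<in> homog V d) \<Longrightarrow> (\<Sum>i\<in>I. F i) \<in> homog V d"
  by (induction I rule: infinite_finite_induct) (auto simp: homog_0 homog_add)

lemma homog_Const: "Const P \<in> homog V 0"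
  by (auto simp: homog_def Const_def split: if_splits)

lemma homog_1: "1 \<in> homog V 0"
  using homog_Const[of 1] by (simp add: Const_1)

lemma homog_prod:
  "finite I \<Longrightarrow> (\<And>i. i \<in> I \<Longrightarrow> F i \<in> homog V (d i)) \<Longrightarrow> (\<Prod>i\<in>I. F i) \<in> homog V (sum d I)"
  by (induction I rule: finite_induct) (auto simp: homog_1 homog_mult)

lemma homog_power: "p \<in> homog V d \<Longrightarrow> p ^ k \<in> homog V (k * d)"
  by (induction k) (auto simp: homog_1 homog_mult)

lemma homog_single:
  assumes "Poly_Mapping.keys m \<subseteq> V"
  shows "Poly_Mapping.single m a \<in> homog V (sum (Poly_Mapping.lookup m) V)"
  using assms by (auto simp: homog_def split: if_splits)

lemma homog_X:
  assumes "finite V" "i \<in> V" shows "X i \<in> homog V 1"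
proof -
  have "sum (Poly_Mapping.lookup (Poly_Mapping.single i (1::nat))) V = 1"
    using assms by (simp add: lookup_single when_def)
  then show ?thesis
    using homog_single[of "Poly_Mapping.single i 1" V 1] assms by (simp add: X_def)
qed

lemma homog_QX_diff:
  assumes "finite V" "i \<in> V" "j \<in> V" shows "Q * X i - X j \<in> homog V 1"
  using homog_mult[OF homog_Const homog_X[OF assms(1,2)], of "monom 1 1"] homog_X[OF assms(1,3)]
  by (intro homog_diff) (simp_all add: Q_def)

lemma homog_perm_act:
  assumes "\<sigma> permutes V" "p \<in> homog V d" shows "perm_act \<sigma> p \<in> homog V d"
  unfolding homog_def
proof (intro CollectI ballI)
  have b: "bij \<sigma>" using assms permutes_bij by blast
  fix m assume m: "m \<in> Poly_Mapping.keys (perm_act \<sigma> p)"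
  let ?m' = "Poly_Mapping.map_key \<sigma> m"
  have "?m' \<in> Poly_Mapping.keys p"
    using m b by (simp add: in_keys_iff lookup_perm_act)
  then have *: "Poly_Mapping.keys ?m' \<subseteq> V" "sum (Poly_Mapping.lookup ?m') V = d"
    using assms(2) by (auto simp: homog_def)
  have l: "Poly_Mapping.lookup ?m' = Poly_Mapping.lookup m \<circ> \<sigma>"
    using b by (simp add: map_key.rep_eq bij_is_inj)
  have "Poly_Mapping.keys m \<subseteq> V"
  proof
    fix v assume "v \<in> Poly_Mapping.keys m"
    then have "inv \<sigma> v \<in> Poly_Mapping.keys ?m'"
      using b by (simp add: in_keys_iff l bij_is_surj surj_f_inv_f)
    then have "inv \<sigma> v \<in> V" using *(1) by auto
    then show "v \<in> V"
      using permutes_in_image[OF assms(1), of "inv \<sigma> v"] permutes_inverses(1)[OF assms(1), of v] by simp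
  qed
  moreover have "sum (Poly_Mapping.lookup m) V = sum (Poly_Mapping.lookup m \<circ> \<sigma>) V"
    by (rule sum.permute[OF assms(1)])
  ultimately show "Poly_Mapping.keys m \<subseteq> V \<and> sum (Poly_Mapping.lookup m) V = d"
    using *(2) l by simp
qed

section \<open>Antisymmetrization\<close>

lemma of_int_eq_Const: "of_int k = Const (of_int k)"
proof -
  have n: "of_nat n = Const (of_nat n)" for n
    by (simp add: Const_def of_nat_single[symmetric])
  have d: "Const (a - b) = Const a - Const b" for a b
    by (simp add: Const_def single_diff)
  show ?thesis
    by (cases k rule: int_diff_cases) (simp add: n d)
qed

lemma permutes_permutation: "\<sigma> permutes {1..n::nat} \<Longrightarrow> permutation \<sigma>"
  using permutation_permutes by blast

lemma antisymmetrize_add: "antisymmetrize n (f + g) = antisymmetrize n f + antisymmetrize n g"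
  by (simp add: antisymmetrize_def perm_act_add permutes_bij distrib_left sum.distrib)

lemma antisymmetrize_0: "antisymmetrize n 0 = 0"
  by (simp add: antisymmetrize_def perm_act_zero permutes_bij)

lemma antisymmetrize_sum: "antisymmetrize n (\<Sum>i\<in>I. F i) = (\<Sum>i\<in>I. antisymmetrize n (F i))"
  by (rule additive_sum) (simp_all add: antisymmetrize_0 antisymmetrize_add)

lemma antisymmetrize_Const: "antisymmetrize n (Const P * f) = Const P * antisymmetrize n f"
  by (simp add: antisymmetrize_def perm_act_mult perm_act_Const permutes_bij sum_distrib_left
      mult.assoc mult.left_commute)

text \<open>
  Pairing \<open>\<sigma>\<close> with \<open>\<sigma> \<circ> (a b)\<close> cancels the summands.
\<close>

lemma antisymmetrize_eq_0:
  assumes ab: "a \<in> {1..n}" "b \<in> {1..n}" "a \<noteq> b" and inv: "perm_act (transpose a b) f = f"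
  shows "antisymmetrize n f = 0"
proof -
  let ?t = "transpose a b"
  have t: "?t permutes {1..n}" using ab by (simp add: permutes_swap_id)
  have "antisymmetrize n f = (\<Sum>\<sigma> | \<sigma> permutes {1..n}. of_int (sign (\<sigma> \<circ> ?t)) * perm_act (\<sigma> \<circ> ?t) f)"
    unfolding antisymmetrize_def using sum_permutations_compose_right[OF t] by blast
  also have "\<dots> = (\<Sum>\<sigma> | \<sigma> permutes {1..n}. - (of_int (sign \<sigma>) * perm_act \<sigma> f))"
  proof (rule sum.cong[OF refl])
    fix \<sigma> assume "\<sigma> \<in> {\<sigma>. \<sigma> permutes {1..n}}"
    then have s: "\<sigma> permutes {1..n}" by simp
    have "sign (\<sigma> \<circ> ?t) = - sign \<sigma>"
      using s t ab by (simp add: sign_compose permutes_permutation sign_swap_id)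
    moreover have "perm_act (\<sigma> \<circ> ?t) f = perm_act \<sigma> f"
      using perm_act_comp[of \<sigma> ?t f] s t inv by (simp add: permutes_bij)
    ultimately show "of_int (sign (\<sigma> \<circ> ?t)) * perm_act (\<sigma> \<circ> ?t) f = - (of_int (sign \<sigma>) * perm_act \<sigma> f)"
      by simp
  qed
  finally have "antisymmetrize n f = - antisymmetrize n f"
    by (simp add: antisymmetrize_def sum_negf)
  then have "2 * antisymmetrize n f = 0" by simp
  then show ?thesis by (metis mult_eq_0_iff zero_neq_numeral)
qed

definition alternating :: "nat \<Rightarrow> mpoly_q \<Rightarrow> bool" where
  "alternating n g \<longleftrightarrow> (\<forall>\<sigma>. \<sigma> permutes {1..n} \<longrightarrow> perm_act \<sigma> g = of_int (sign \<sigma>) * g)"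

lemma alternating_antisymmetrize: "alternating n (antisymmetrize n f)"
  unfolding alternating_def
proof (intro allI impI)
  fix \<tau> assume t: "\<tau> permutes {1..n}"
  have "perm_act \<tau> (antisymmetrize n f)
      = (\<Sum>\<sigma> | \<sigma> permutes {1..n}. of_int (sign \<sigma>) * perm_act (\<tau> \<circ> \<sigma>) f)"
    using t
    by (simp add: antisymmetrize_def perm_act_sum permutes_bij perm_act_mult of_int_eq_Const
        perm_act_Const perm_act_comp)
  also have "\<dots> = (\<Sum>\<sigma> | \<sigma> permutes {1..n}. of_int (sign \<tau>) * (of_int (sign (\<tau> \<circ> \<sigma>)) * perm_act (\<tau> \<circ> \<sigma>) f))"
  proof (rule sum.cong[OF refl])
    fix \<sigma> assume "\<sigma> \<in> {\<sigma>. \<sigma> permutes {1..n}}"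
    then have "sign \<sigma> = sign \<tau> * sign (\<tau> \<circ> \<sigma>)"
      using t sign_idempotent[of \<tau>] by (simp add: sign_compose permutes_permutation flip: mult.assoc)
    then have "(of_int (sign \<sigma>) :: mpoly_q) = of_int (sign \<tau>) * of_int (sign (\<tau> \<circ> \<sigma>))" by (simp flip: of_int_mult)
    then show "of_int (sign \<sigma>) * perm_act (\<tau> \<circ> \<sigma>) f
        = of_int (sign \<tau>) * (of_int (sign (\<tau> \<circ> \<sigma>)) * perm_act (\<tau> \<circ> \<sigma>) f)"
      by (simp add: mult.assoc)
  qed
  also have "\<dots> = of_int (sign \<tau>) * antisymmetrize n f"
    unfolding antisymmetrize_def sum_distrib_left[symmetric]
    using setum_permutations_compose_left[OF t, of "\<lambda>\<sigma>. of_int (sign \<sigma>) * perm_act \<sigma> f"] by simp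
  finally show "perm_act \<tau> (antisymmetrize n f) = of_int (sign \<tau>) * antisymmetrize n f" .
qed

lemma homog_antisymmetrize:
  assumes "f \<in> homog {1..n} d" shows "antisymmetrize n f \<in> homog {1..n} d"
  unfolding antisymmetrize_def of_int_eq_Const
  by (intro homog_sum) (use homog_mult[OF homog_Const homog_perm_act, of _ _ _ d] assms in auto)

section \<open>The Vandermonde product\<close>

definition pairs :: "nat \<Rightarrow> (nat \<times> nat) set" where
  "pairs n = {(i, j). 1 \<le> i \<and> i < j \<and> j \<le> n}"

lemma pairs_Sigma: "pairs n = Sigma {1..n} (\<lambda>i. {i<..n})"
  by (auto simp: pairs_def)

lemma finite_pairs [simp]: "finite (pairs n)"
  by (simp add: pairs_Sigma)

lemma card_pairs: "card (pairs n) = n choose 2"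
proof (induction n)
  case 0
  then show ?case by (simp add: pairs_Sigma)
next
  case (Suc n)
  have "pairs (Suc n) = pairs n \<union> (\<lambda>i. (i, Suc n)) ` {1..n}"
    by (auto simp: pairs_def)
  moreover have "card ((\<lambda>i. (i, Suc n)) ` {1..n}) = n"
    by (subst card_image) (auto simp: inj_on_def)
  moreover have "pairs n \<inter> (\<lambda>i. (i, Suc n)) ` {1..n} = {}"
    by (auto simp: pairs_def)
  ultimately show ?case
    using Suc choose_two_Suc[of n] by (simp add: card_Un_disjoint)
qed

lemma vandermonde_pairs: "vandermonde n = (\<Prod>p\<in>pairs n. X (fst p) - X (snd p))"
  by (simp add: vandermonde_def pairs_def case_prod_beta)

lemma homog_vandermonde: "vandermonde n \<in> homog {1..n} (n choose 2)"
proof -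
  have "vandermonde n \<in> homog {1..n} (\<Sum>p\<in>pairs n. 1)"
    unfolding vandermonde_pairs
    by (rule homog_prod[OF finite_pairs], intro homog_diff homog_X) (auto simp: pairs_def)
  then show ?thesis by (simp add: card_pairs)
qed

text \<open>
  An adjacent transposition permutes the pairs \<open>i < j\<close> other than \<open>(a, a + 1)\<close> among themselves,
  so only the sign of one factor changes.
\<close>

lemma perm_act_vandermonde_adjacent:
  assumes "1 \<le> a" "Suc a \<le> n"
  shows "perm_act (transpose a (Suc a)) (vandermonde n) = - vandermonde n"
proof -
  let ?t = "transpose a (Suc a)"
  let ?P = "pairs n - {(a, Suc a)}"
  have b: "bij ?t" by simp
  have split: "pairs n = insert (a, Suc a) ?P"
    using assms by (auto simp: pairs_def)
  have closed: "map_prod ?t ?t p \<in> ?P" if "p \<in> ?P" for p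
    using that assms by (auto simp: pairs_def transpose_def split: if_splits)
  have "map_prod ?t ?t (map_prod ?t ?t p) = p" for p by (cases p) simp
  then have "bij_betw (map_prod ?t ?t) ?P ?P"
    by (intro bij_betw_byWitness[of _ "map_prod ?t ?t"] ballI image_subsetI closed)
  then have re: "(\<Prod>p\<in>?P. X (?t (fst p)) - X (?t (snd p))) = (\<Prod>p\<in>?P. X (fst p) - X (snd p))"
    using prod.reindex_bij_betw[of "map_prod ?t ?t" ?P ?P "\<lambda>p. X (fst p) - X (snd p)"]
    by simp
  have V: "vandermonde n = (X a - X (Suc a)) * (\<Prod>p\<in>?P. X (fst p) - X (snd p))"
    unfolding vandermonde_pairs by (subst split, subst prod.insert) simp_all
  have "perm_act ?t (vandermonde n) = (X (?t a) - X (?t (Suc a))) * (\<Prod>p\<in>?P. X (?t (fst p)) - X (?t (snd p)))"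
    unfolding V by (simp only: perm_act_mult[OF b] perm_act_prod[OF b] perm_act_diff[OF b] perm_act_X[OF b])
  then show ?thesis unfolding re V by (simp add: algebra_simps)
qed

lemma perm_act_uminus: "bij \<sigma> \<Longrightarrow> perm_act \<sigma> (- f) = - perm_act \<sigma> f"
  using perm_act_diff[of \<sigma> 0 f] by (simp add: perm_act_zero)

text \<open>
  Every transposition is obtained from an adjacent one by successive conjugation with
  adjacent ones.
\<close>

lemma perm_act_vandermonde_transpose:
  assumes "1 \<le> a" "a < b" "b \<le> n"
  shows "perm_act (transpose a b) (vandermonde n) = - vandermonde n"
  using assms(2,3)
proof (induction b)
  case 0
  then show ?case by simp
next
  case (Suc b)
  show ?case
  proof (cases "a = b")
    case True
    then show ?thesis using perm_act_vandermonde_adjacent assms(1) Suc.prems by simp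
  next
    case False
    let ?s = "transpose b (Suc b)"
    have eq: "transpose a (Suc b) = ?s \<circ> (transpose a b \<circ> ?s)"
      using False Suc.prems by (auto simp: fun_eq_iff transpose_def)
    have "perm_act (transpose a b) (vandermonde n) = - vandermonde n"
      using False Suc by simp
    moreover have "perm_act ?s (vandermonde n) = - vandermonde n"
      using perm_act_vandermonde_adjacent[of b n] assms(1) Suc.prems by simp
    ultimately show ?thesis
      unfolding eq
      by (simp only: perm_act_comp bij_comp bij_transpose perm_act_uminus minus_minus)
  qed
qed

lemma alternating_vandermonde: "alternating n (vandermonde n)"
  unfolding alternating_def
proof (intro allI impI)
  fix \<sigma> :: "nat \<Rightarrow> nat" assume "\<sigma> permutes {1..n}"
  from this finite_atLeastAtMost show "perm_act \<sigma> (vandermonde n) = of_int (sign \<sigma>) * vandermonde n"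
  proof (induction \<sigma> rule: permutes_induct)
    case id
    have "Poly_Mapping.map_key id m = m" for m :: "nat \<Rightarrow>\<^sub>0 nat"
      unfolding id_def by (rule map_key_id)
    then have "perm_act id (vandermonde n) = vandermonde n"
      by (intro poly_mapping_eqI) (simp only: lookup_perm_act[OF bij_id])
    then show ?case by (simp only: sign_id of_int_1 mult_1)
  next
    case (swap a b p)
    show ?case
    proof (cases "a = b")
      case True
      then show ?thesis using swap by simp
    next
      case False
      have "perm_act (transpose a b) (vandermonde n) = - vandermonde n"
        using False swap perm_act_vandermonde_transpose[of a b n] perm_act_vandermonde_transpose[of b a n]
        by (cases "a < b") (auto simp: transpose_commute)
      moreover have "sign (transpose a b \<circ> p) = - sign p"
        using False sign_compose[OF permutation_swap_id permutes_permutation[OF \<open>p permutes {1..n}\<close>], of a b]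
        by (simp add: sign_swap_id)
      ultimately show ?thesis
        using swap.IH perm_act_comp[OF bij_transpose permutes_bij[OF \<open>p permutes {1..n}\<close>], of a b "vandermonde n"]
        by (simp only: perm_act_mult[OF bij_transpose] of_int_eq_Const[of "sign p"] perm_act_Const[OF bij_transpose])
           (simp only: of_int_eq_Const[symmetric] of_int_minus mult_minus_left mult_minus_right)
    qed
  qed
qed

text \<open>
  The exponent vector \<open>(n - 1, \<dots>, 1, 0)\<close>, as the sum of the leading exponents of the factors of
  the Vandermonde product.
\<close>

definition stair :: "nat \<Rightarrow> (nat \<Rightarrow>\<^sub>0 nat)" where
  "stair n = (\<Sum>p\<in>pairs n. Poly_Mapping.single (fst p) 1)"

lemma lookup_stair: "Poly_Mapping.lookup (stair n) k = (if 1 \<le> k then n - k else 0)"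
proof -
  have "Poly_Mapping.lookup (stair n) k = (\<Sum>i\<in>{1..n}. \<Sum>j\<in>{i<..n}. if i = k then 1 else 0)"
    unfolding stair_def pairs_Sigma
    by (subst sum.Sigma) (auto simp: lookup_sum lookup_single when_def case_prod_beta intro!: sum.cong)
  also have "\<dots> = (\<Sum>i\<in>{1..n}. if i = k then n - i else 0)"
    by (intro sum.cong) auto
  finally show ?thesis by auto
qed

text \<open>
  The monomial \<open>m\<close> occurs with coefficient 1 and all other monomials have smaller weight. For an
  additive weight this is stable under products.
\<close>

definition leading :: "((nat \<Rightarrow>\<^sub>0 nat) \<Rightarrow> nat) \<Rightarrow> mpoly_q \<Rightarrow> (nat \<Rightarrow>\<^sub>0 nat) \<Rightarrow> bool" where
  "leading w p m \<longleftrightarrow> (\<forall>k\<in>Poly_Mapping.keys (p - Poly_Mapping.single m 1). w k < w m)"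

lemma leading_lookup: "leading w p m \<Longrightarrow> Poly_Mapping.lookup p m = 1"
proof -
  assume "leading w p m"
  then have "m \<notin> Poly_Mapping.keys (p - Poly_Mapping.single m 1)" by (auto simp: leading_def)
  then show ?thesis by (simp add: in_keys_iff lookup_minus)
qed

lemma leading_mult:
  assumes w: "\<And>a b. w (a + b) = w a + w b" and p: "leading w p m" and q: "leading w q n"
  shows "leading w (p * q) (m + n)"
proof -
  let ?m = "Poly_Mapping.single m (1::qpoly)" and ?n = "Poly_Mapping.single n (1::qpoly)"
  define p' q' where "p' = p - ?m" and "q' = q - ?n"
  have k: "\<And>k. k \<in> Poly_Mapping.keys p' \<Longrightarrow> w k < w m" "\<And>k. k \<in> Poly_Mapping.keys q' \<Longrightarrow> w k < w n"
    using p q by (auto simp: leading_def p'_def q'_def)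
  have "p * q - Poly_Mapping.single (m + n) 1 = p' * ?n + (?m * q' + p' * q')"
    by (simp add: p'_def q'_def algebra_simps mult_single)
  then have "Poly_Mapping.keys (p * q - Poly_Mapping.single (m + n) 1)
      \<subseteq> Poly_Mapping.keys (p' * ?n) \<union> (Poly_Mapping.keys (?m * q') \<union> Poly_Mapping.keys (p' * q'))"
    using keys_add[of "p' * ?n" "?m * q' + p' * q'"] keys_add[of "?m * q'" "p' * q'"] by auto
  moreover have "w k < w (m + n)" if "k \<in> Poly_Mapping.keys (p' * ?n)" for k
    using that keys_mult[of p' ?n] k by (fastforce simp: w split: if_splits)
  moreover have "w k < w (m + n)" if "k \<in> Poly_Mapping.keys (?m * q')" for k
    using that keys_mult[of ?m q'] k by (fastforce simp: w split: if_splits)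
  moreover have "w k < w (m + n)" if "k \<in> Poly_Mapping.keys (p' * q')" for k
    using that keys_mult[of p' q'] k by (fastforce simp: w intro: add_strict_mono)
  ultimately show ?thesis unfolding leading_def by blast
qed

lemma leading_prod:
  assumes w: "\<And>a b. w (a + b) = w a + w b" and fin: "finite I"
    and l: "\<And>i. i \<in> I \<Longrightarrow> leading w (F i) (m i)"
  shows "leading w (\<Prod>i\<in>I. F i) (\<Sum>i\<in>I. m i)"
  using fin l
proof (induction I rule: finite_induct)
  case empty
  then show ?case by (simp add: leading_def)
next
  case (insert i I)
  then show ?case by (simp add: leading_mult[OF w])
qed

text \<open>
  Give \<open>x\<^sub>i\<close> the weight \<open>n - i\<close>: then \<open>x\<^sub>i\<close> is the leading term of \<open>x\<^sub>i - x\<^sub>j\<close> for \<open>i < j\<close>.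
\<close>

lemma lookup_vandermonde: "Poly_Mapping.lookup (vandermonde n) (stair n) = 1"
proof -
  define w where "w m = (\<Sum>i\<in>{1..n}. (n - i) * Poly_Mapping.lookup m i)" for m :: "nat \<Rightarrow>\<^sub>0 nat"
  have w: "w (a + b) = w a + w b" for a b
    by (simp add: w_def lookup_add distrib_left sum.distrib)
  have wi: "w (Poly_Mapping.single i 1) = n - i" if "i \<in> {1..n}" for i
  proof -
    have "w (Poly_Mapping.single i 1) = (\<Sum>k\<in>{1..n}. if k = i then n - k else 0)"
      unfolding w_def by (intro sum.cong) (auto simp: lookup_single when_def)
    then show ?thesis using that by simp
  qed
  have "leading w (vandermonde n) (stair n)"
    unfolding vandermonde_pairs stair_def
  proof (rule leading_prod)
    fix p assume "p \<in> pairs n"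
    then show "leading w (X (fst p) - X (snd p)) (Poly_Mapping.single (fst p) 1)"
      using wi[of "fst p"] wi[of "snd p"] by (auto simp: leading_def X_def pairs_def)
  qed (simp_all add: w)
  then show ?thesis by (rule leading_lookup)
qed

lemma lookup_of_int_mult: "Poly_Mapping.lookup (of_int (sign \<sigma>) * g) m = of_int (sign \<sigma>) * Poly_Mapping.lookup (g::mpoly_q) m"
  by (cases \<sigma> rule: sign_cases) auto

text \<open>
  In an alternating polynomial a monomial with two equal exponents has coefficient zero. In
  this degree the remaining monomials have the exponents \<open>0, \<dots>, n - 1\<close> in some order, and their
  coefficients agree up to sign.
\<close>

lemma alternating_eq_0:
  assumes alt: "alternating n g" and hom: "g \<in> homog {1..n} (n choose 2)"
    and l0: "Poly_Mapping.lookup g (stair n) = 0"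
  shows "g = 0"
proof (rule ccontr)
  assume "g \<noteq> 0"
  then obtain m where m: "m \<in> Poly_Mapping.keys g" by (metis keys_eq_empty equals0I)
  then have gm: "Poly_Mapping.lookup g m \<noteq> 0" by (simp add: in_keys_iff)
  have km: "Poly_Mapping.keys m \<subseteq> {1..n}" and sm: "sum (Poly_Mapping.lookup m) {1..n} = n choose 2"
    using hom m by (auto simp: homog_def)
  have act: "Poly_Mapping.lookup g (Poly_Mapping.map_key \<sigma> m) = of_int (sign \<sigma>) * Poly_Mapping.lookup g m"
    if "\<sigma> permutes {1..n}" for \<sigma>
    using alt that lookup_perm_act[of \<sigma> g m] unfolding alternating_def
    by (simp add: permutes_bij lookup_of_int_mult)
  show False
  proof (cases "inj_on (Poly_Mapping.lookup m) {1..n}")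
    case False
    then obtain a b where ab: "a \<in> {1..n}" "b \<in> {1..n}" "a \<noteq> b" "Poly_Mapping.lookup m a = Poly_Mapping.lookup m b"
      by (auto simp: inj_on_def)
    have "Poly_Mapping.map_key (transpose a b) m = m"
      using ab(4) by (intro poly_mapping_eqI) (auto simp: map_key.rep_eq transpose_def)
    then have "Poly_Mapping.lookup g m = - Poly_Mapping.lookup g m"
      using act[of "transpose a b"] ab by (simp add: permutes_swap_id sign_swap_id)
    then have "2 * Poly_Mapping.lookup g m = 0" by simp
    then show False using gm by simp
  next
    case True
    let ?A = "Poly_Mapping.lookup m ` {1..n}"
    have cA: "card ?A = n" using True by (simp add: card_image)
    have "\<Sum>?A = n choose 2" using sum.reindex[OF True, of id] sm by simp
    then have A: "?A = {..<n}" using sum_distinct_nats[of ?A] cA by simp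
    \<comment> \<open>The permutation sorting the exponents of \<open>m\<close> into decreasing order, so that \<open>m\<close> becomes \<open>stair n\<close>.\<close>
    define \<tau> where "\<tau> i = (if i \<in> {1..n} then n - Poly_Mapping.lookup m i else i)" for i
    have "inj_on \<tau> {1..n}"
    proof (rule inj_onI)
      fix a b assume ab: "a \<in> {1..n}" "b \<in> {1..n}" "\<tau> a = \<tau> b"
      then have "Poly_Mapping.lookup m a < n" "Poly_Mapping.lookup m b < n" using A by auto
      then have "Poly_Mapping.lookup m a = Poly_Mapping.lookup m b" using ab by (simp add: \<tau>_def)
      then show "a = b" using inj_onD[OF True] ab by blast
    qed
    moreover have "\<tau> i \<in> {1..n}" if "i \<in> {1..n}" for i
    proof -
      have "Poly_Mapping.lookup m i < n" using that A by blast
      then show ?thesis using that by (auto simp: \<tau>_def)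
    qed
    then have "\<tau> ` {1..n} \<subseteq> {1..n}" by blast
    ultimately have "bij_betw \<tau> {1..n} {1..n}"
      unfolding bij_betw_def using endo_inj_surj[of "{1..n}" \<tau>] by blast
    then have t: "\<tau> permutes {1..n}"
      by (rule bij_imp_permutes) (auto simp: \<tau>_def)
    have it: "inv \<tau> permutes {1..n}" using t by (rule permutes_inv)
    have "Poly_Mapping.map_key (inv \<tau>) m = stair n"
    proof (rule poly_mapping_eqI)
      fix k
      have l: "Poly_Mapping.lookup (Poly_Mapping.map_key (inv \<tau>) m) k = Poly_Mapping.lookup m (inv \<tau> k)"
        using it by (simp add: map_key.rep_eq permutes_inj)
      show "Poly_Mapping.lookup (Poly_Mapping.map_key (inv \<tau>) m) k = Poly_Mapping.lookup (stair n) k"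
      proof (cases "k \<in> {1..n}")
        case True
        then have i: "inv \<tau> k \<in> {1..n}" using permutes_in_image[OF it, of k] by simp
        then have "Poly_Mapping.lookup m (inv \<tau> k) < n" using A by auto
        moreover have "k = n - Poly_Mapping.lookup m (inv \<tau> k)"
          using permutes_inverses(1)[OF t, of k] i by (simp add: \<tau>_def)
        ultimately show ?thesis using True unfolding l lookup_stair by auto
      next
        case False
        then have "inv \<tau> k = k" using it by (simp add: permutes_def)
        moreover have "Poly_Mapping.lookup m k = 0" using km False by (auto simp: in_keys_iff)
        ultimately show ?thesis using False unfolding l lookup_stair by auto
      qed
    qed
    then have "of_int (sign (inv \<tau>)) * Poly_Mapping.lookup g m = 0"
      using act[OF it] l0 by simp
    then show False using gm by (cases "inv \<tau>" rule: sign_cases) auto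
  qed
qed

text \<open>
  For \<open>f\<close> homogeneous of degree \<open>n\<close> choose 2 this coefficient is the value of \<open>\<partial>\<^bsub>w\<^esub> f\<close>, because the
  Vandermonde product has coefficient 1 at the same exponent vector.
\<close>

definition alt_coeff :: "nat \<Rightarrow> mpoly_q \<Rightarrow> qpoly" where
  "alt_coeff n f = Poly_Mapping.lookup (antisymmetrize n f) (stair n)"

lemma lookup_Const_mult: "Poly_Mapping.lookup (Const P * g) m = P * Poly_Mapping.lookup g m"
proof -
  have "Poly_Mapping.lookup (Const P * g) m = Poly_Mapping.lookup (\<Sum>k\<in>Poly_Mapping.keys g. Poly_Mapping.single k (P * Poly_Mapping.lookup g k)) m"
    by (subst sum_monomials[of g, symmetric], subst sum_distrib_left) (simp add: Const_def mult_single)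
  also have "\<dots> = P * Poly_Mapping.lookup (\<Sum>k\<in>Poly_Mapping.keys g. Poly_Mapping.single k (Poly_Mapping.lookup g k)) m"
    by (simp add: lookup_sum lookup_single when_def sum_distrib_left if_distrib cong: if_cong)
  finally show ?thesis by (simp only: sum_monomials)
qed

text \<open>
  The difference of the two sides is alternating and its coefficient at \<open>stair n\<close> vanishes.
  This produces the exact quotient without a general divisibility theorem.
\<close>

lemma antisymmetrize_eq_vandermonde:
  assumes "f \<in> homog {1..n} (n choose 2)"
  shows "antisymmetrize n f = vandermonde n * Const (alt_coeff n f)"
proof -
  let ?g = "antisymmetrize n f - Const (alt_coeff n f) * vandermonde n"
  have "?g = 0"
  proof (rule alternating_eq_0)
    show "alternating n ?g"
      using alternating_antisymmetrize[of n f] alternating_vandermonde[of n] unfolding alternating_def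
      by (simp add: perm_act_diff permutes_bij perm_act_mult perm_act_Const algebra_simps)
    show "?g \<in> homog {1..n} (n choose 2)"
      using homog_mult[OF homog_Const homog_vandermonde] homog_antisymmetrize[OF assms]
      by (intro homog_diff) simp_all
    show "Poly_Mapping.lookup ?g (stair n) = 0"
      by (simp add: lookup_minus lookup_Const_mult lookup_vandermonde alt_coeff_def)
  qed
  then show ?thesis by (simp add: mult.commute)
qed

lemma vandermonde_nonzero: "vandermonde n \<noteq> 0"
  using lookup_vandermonde[of n] by auto

lemma divided_sym_eq_Const:
  assumes "f \<in> homog {1..n} (n choose 2)"
  shows "divided_sym n f = Const (alt_coeff n f)"
  unfolding divided_sym_def
  using antisymmetrize_eq_vandermonde[OF assms] vandermonde_nonzero[of n]
  by (intro the_equality) auto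

lemma alt_coeff_add: "alt_coeff n (f + g) = alt_coeff n f + alt_coeff n g"
  by (simp add: alt_coeff_def antisymmetrize_add lookup_add)

lemma alt_coeff_Const: "alt_coeff n (Const P * f) = P * alt_coeff n f"
  by (simp add: alt_coeff_def antisymmetrize_Const lookup_Const_mult)

text \<open>
  Every monomial of \<open>p\<close> has two equal exponents within \<open>V\<close>. The corresponding transposition
  fixes the monomial and \<open>s\<close>, so the antisymmetrization vanishes term by term.
\<close>

lemma antisymmetrize_small_degree:
  assumes V: "V \<subseteq> {1..n}" and p: "p \<in> homog V d" and d: "d < (card V choose 2)"
    and s: "\<And>a b. a \<in> V \<Longrightarrow> b \<in> V \<Longrightarrow> perm_act (transpose a b) s = s"
  shows "antisymmetrize n (p * s) = 0"
proof -
  have fin: "finite V" using V finite_subset by blast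
  have "antisymmetrize n (p * s)
      = antisymmetrize n (\<Sum>m\<in>Poly_Mapping.keys p. Poly_Mapping.single m (Poly_Mapping.lookup p m) * s)"
    by (simp only: sum_distrib_right[symmetric] sum_monomials)
  also have "\<dots> = (\<Sum>m\<in>Poly_Mapping.keys p. antisymmetrize n (Poly_Mapping.single m (Poly_Mapping.lookup p m) * s))"
    by (rule antisymmetrize_sum)
  also have "\<dots> = 0"
  proof (rule sum.neutral, rule ballI)
    fix m assume "m \<in> Poly_Mapping.keys p"
    then have sm: "sum (Poly_Mapping.lookup m) V = d" using p by (auto simp: homog_def)
    have "\<not> inj_on (Poly_Mapping.lookup m) V"
    proof
      assume inj: "inj_on (Poly_Mapping.lookup m) V"
      have "\<Sum>(Poly_Mapping.lookup m ` V) = d" using sum.reindex[OF inj, of id] sm by simp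
      then show False
        using sum_distinct_nats[of "Poly_Mapping.lookup m ` V"] fin card_image[OF inj] d by simp
    qed
    then obtain a b where ab: "a \<in> V" "b \<in> V" "a \<noteq> b" "Poly_Mapping.lookup m a = Poly_Mapping.lookup m b"
      by (auto simp: inj_on_def)
    have "Poly_Mapping.map_key (transpose a b) m = m"
      using ab(4) by (intro poly_mapping_eqI) (auto simp: map_key.rep_eq transpose_def)
    then have "perm_act (transpose a b) (Poly_Mapping.single m (Poly_Mapping.lookup p m) * s)
        = Poly_Mapping.single m (Poly_Mapping.lookup p m) * s"
      using s[OF ab(1,2)] by (simp add: perm_act_mult perm_act_single inv_swap_id)
    then show "antisymmetrize n (Poly_Mapping.single m (Poly_Mapping.lookup p m) * s) = 0"
      using antisymmetrize_eq_0[of a n b] ab V by blast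
  qed
  finally show ?thesis .
qed

section \<open>The bracket of a product of partial sums\<close>

text \<open>
  The non-adjacent pairs among the indices \<open>l + 1, \<dots>, l + k\<close>. The offset serves to treat the two
  blocks of variables on either side of a cut alike.
\<close>

definition nonadj :: "nat \<Rightarrow> nat \<Rightarrow> (nat \<times> nat) set" where
  "nonadj l k = {(a, b). l < a \<and> Suc a < b \<and> b \<le> l + k}"

lemma finite_nonadj [simp]: "finite (nonadj l k)"
  by (rule finite_subset[of _ "{..l + k} \<times> {..l + k}"]) (auto simp: nonadj_def)

text \<open>
  There are \<open>k - 1\<close> adjacent pairs among the \<open>k\<close> choose 2 pairs.
\<close>

lemma card_nonadj: "k \<ge> 1 \<Longrightarrow> card (nonadj l k) + (k - 1) = k choose 2"
proof (induction k rule: dec_induct)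
  case base
  have "nonadj l 1 = {}" by (auto simp: nonadj_def)
  then show ?case by (simp add: numeral_2_eq_2)
next
  case (step k)
  let ?I = "(\<lambda>a. (a, Suc (l + k))) ` {l<..<l + k}"
  have "nonadj l (Suc k) = nonadj l k \<union> ?I"
    by (auto simp: nonadj_def)
  moreover have "card ?I = k - 1"
    by (subst card_image) (auto simp: inj_on_def)
  moreover have "nonadj l k \<inter> ?I = {}" by (auto simp: nonadj_def)
  ultimately show ?case
    using step choose_two_Suc[of k] by (simp add: card_Un_disjoint)
qed

abbreviation q_factors :: "(nat \<times> nat) set \<Rightarrow> mpoly_q" where
  "q_factors A \<equiv> (\<Prod>p\<in>A. Q * X (fst p) - X (snd p))"

definition psum :: "nat \<Rightarrow> mpoly_q" where "psum i = (\<Sum>j=1..i. X j)"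
definition adj :: "nat \<Rightarrow> mpoly_q" where "adj i = Q * X i - X (Suc i)"
definition bracket :: "nat \<Rightarrow> mpoly_q \<Rightarrow> qpoly" where
  "bracket r f = alt_coeff (Suc r) (f * q_factors (nonadj 0 (Suc r)))"

lemma bracket_add: "bracket r (f + g) = bracket r f + bracket r g"
  by (simp add: bracket_def distrib_right alt_coeff_add)

lemma bracket_Const: "bracket r (Const P * f) = P * bracket r f"
  by (simp add: bracket_def mult.assoc alt_coeff_Const)

lemma bracket_0: "bracket r 0 = 0"
  using bracket_Const[of r 0 0] by simp

lemma bracket_diff: "bracket r (f - g) = bracket r f - bracket r g"
  using bracket_add[of r "f - g" g] by simp

lemma bracket_sum: "bracket r (\<Sum>i\<in>I. F i) = (\<Sum>i\<in>I. bracket r (F i))"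
  by (rule additive_sum) (simp_all add: bracket_0 bracket_add)

lemma homog_q_factors: "finite A \<Longrightarrow> finite V \<Longrightarrow> A \<subseteq> V \<times> V \<Longrightarrow> q_factors A \<in> homog V (card A)"
  using homog_prod[of A "\<lambda>p. Q * X (fst p) - X (snd p)" V "\<lambda>_. 1"] homog_QX_diff[of V] by fastforce

lemma homog_psum: "i \<le> n \<Longrightarrow> psum i \<in> homog {1..n} 1"
  unfolding psum_def by (intro homog_sum homog_X) auto

lemma homog_adj: "1 \<le> i \<Longrightarrow> i < n \<Longrightarrow> adj i \<in> homog {1..n} 1"
  unfolding adj_def by (intro homog_QX_diff) auto

lemma q_bracket_eq:
  assumes "f \<in> homog {1..Suc r} r"
  shows "q_bracket (Suc r) f = Const (bracket r f)"
proof -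
  have N: "(\<Prod>(i, j)\<in>{(i, j). 1 \<le> i \<and> i + 1 < j \<and> j \<le> Suc r}. Q * X i - X j) = q_factors (nonadj 0 (Suc r))"
    by (intro prod.cong) (auto simp: nonadj_def)
  have "q_factors (nonadj 0 (Suc r)) \<in> homog {1..Suc r} (card (nonadj 0 (Suc r)))"
    by (rule homog_q_factors[OF finite_nonadj]) (auto simp: nonadj_def)
  then have "f * q_factors (nonadj 0 (Suc r)) \<in> homog {1..Suc r} (r + card (nonadj 0 (Suc r)))"
    by (rule homog_mult[OF assms])
  moreover have "r + card (nonadj 0 (Suc r)) = Suc r choose 2"
    using card_nonadj[of "Suc r" 0] by simp
  ultimately show ?thesis
    unfolding q_bracket_def N bracket_def by (simp add: divided_sym_eq_Const)
qed

definition psum_monomial :: "nat \<Rightarrow> (nat \<Rightarrow> nat) \<Rightarrow> mpoly_q" where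
  "psum_monomial r c = (\<Prod>i=1..r. psum i ^ c i)"

lemma homog_psum_monomial: "psum_monomial r c \<in> homog {1..Suc r} (\<Sum>i=1..r. c i)"
proof -
  have "psum i ^ c i \<in> homog {1..Suc r} (c i)" if "i \<in> {1..r}" for i
    using homog_power[OF homog_psum, of i "Suc r" "c i"] that by simp
  then show ?thesis unfolding psum_monomial_def by (intro homog_prod) auto
qed

lemma Const_inject: "Const P = Const R \<longleftrightarrow> P = R"
  unfolding Const_def by (metis lookup_single_eq)

lemma remixed_eulerian_eq_bracket:
  assumes "(\<Sum>i=1..r. c i) = r" shows "remixed_eulerian r c = bracket r (psum_monomial r c)"
proof -
  have "q_bracket (r + 1) (\<Prod>i=1..r. (\<Sum>j=1..i. X j) ^ c i) = Const (bracket r (psum_monomial r c))"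
    using q_bracket_eq[of "psum_monomial r c" r] homog_psum_monomial[of r c] assms
    by (simp add: psum_monomial_def psum_def)
  then show ?thesis
    unfolding remixed_eulerian_def by (simp add: Const_inject)
qed

section \<open>Quadratic relations between partial sums\<close>

lemma perm_act_transpose_psum:
  assumes "(a \<le> i \<and> b \<le> i \<and> 1 \<le> a \<and> 1 \<le> b) \<or> (i < a \<and> i < b)"
  shows "perm_act (transpose a b) (psum i) = psum i"
proof -
  have "perm_act (transpose a b) (psum i) = (\<Sum>j=1..i. X (transpose a b j))"
    by (simp add: psum_def perm_act_sum perm_act_X)
  also have "\<dots> = psum i"
  proof (cases "i < a \<and> i < b")
    case True
    then show ?thesis unfolding psum_def by (intro sum.cong) (auto simp: transpose_def)
  next
    case False
    then have "transpose a b permutes {1..i}" using assms by (intro permutes_swap_id) auto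
    from sum.permute[OF this, of X] show ?thesis by (simp add: psum_def comp_def)
  qed
  finally show ?thesis .
qed

lemma perm_act_q_factors: "bij \<sigma> \<Longrightarrow> perm_act \<sigma> (q_factors A) = (\<Prod>p\<in>A. Q * X (\<sigma> (fst p)) - X (\<sigma> (snd p)))"
  by (simp add: perm_act_prod perm_act_diff perm_act_mult perm_act_Q perm_act_X)

lemma perm_act_transpose_q_factors_disjoint:
  assumes "\<And>x y. (x, y) \<in> A \<Longrightarrow> x \<noteq> a \<and> x \<noteq> b \<and> y \<noteq> a \<and> y \<noteq> b"
  shows "perm_act (transpose a b) (q_factors A) = q_factors A"
  using assms by (subst perm_act_q_factors) (auto simp: transpose_def intro!: prod.cong)

lemma perm_act_transpose_q_factors_Times:
  assumes "(a \<in> V \<and> b \<in> V \<and> a \<notin> U \<and> b \<notin> U) \<or> (a \<in> U \<and> b \<in> U \<and> a \<notin> V \<and> b \<notin> V)"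
  shows "perm_act (transpose a b) (q_factors (V \<times> U)) = q_factors (V \<times> U)"
proof -
  let ?t = "map_prod (transpose a b) (transpose a b)"
  have closed: "?t p \<in> V \<times> U" if "p \<in> V \<times> U" for p
    using that assms by (auto simp: transpose_def)
  have "?t (?t p) = p" for p by (cases p) simp
  then have "bij_betw ?t (V \<times> U) (V \<times> U)"
    by (intro bij_betw_byWitness[of _ ?t] ballI image_subsetI closed)
  from prod.reindex_bij_betw[OF this, of "\<lambda>p. Q * X (fst p) - X (snd p)"]
  show ?thesis by (simp add: perm_act_q_factors)
qed

lemma perm_act_transpose_single:
  assumes "a \<notin> Poly_Mapping.keys m" "b \<notin> Poly_Mapping.keys m"
  shows "perm_act (transpose a b) (Poly_Mapping.single m c) = Poly_Mapping.single m c"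
proof -
  have "Poly_Mapping.map_key (transpose a b) m = m"
    using assms by (intro poly_mapping_eqI) (auto simp: map_key.rep_eq transpose_def in_keys_iff)
  then show ?thesis by (simp add: perm_act_single inv_swap_id)
qed

definition restrict_exps :: "nat set \<Rightarrow> (nat \<Rightarrow>\<^sub>0 nat) \<Rightarrow> (nat \<Rightarrow>\<^sub>0 nat)" where
  "restrict_exps V m = (\<Sum>v\<in>V. Poly_Mapping.single v (Poly_Mapping.lookup m v))"

lemma lookup_restrict_exps: "finite V \<Longrightarrow> Poly_Mapping.lookup (restrict_exps V m) v = (if v \<in> V then Poly_Mapping.lookup m v else 0)"
  by (simp add: restrict_exps_def lookup_sum lookup_single when_def)

lemma keys_restrict_exps: "finite V \<Longrightarrow> Poly_Mapping.keys (restrict_exps V m) \<subseteq> V"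
  by (auto simp: in_keys_iff lookup_restrict_exps split: if_splits)

text \<open>
  The factor \<open>q x\<^sub>i - x\<^bsub>i+1\<^esub>\<close> supplies the adjacent pair that crosses the cut between \<open>i\<close> and
  \<open>i + 1\<close>. All crossing pairs are then present, and their product is invariant under permutations
  preserving the two blocks \<open>{1..i}\<close> and \<open>{i + 1..r + 1}\<close>, as is the partial sum \<open>psum i\<close>.
  What remains splits into a polynomial in each block. A block of size \<open>k\<close> survives only if the
  given monomial has degree at least \<open>k - 1\<close> in its variables, so the two blocks together require
  degree at least \<open>r - 1\<close>, one more than available.
\<close>

lemma bracket_psum_adj_monomial:
  assumes i: "1 \<le> i" "i \<le> r" and m: "Poly_Mapping.keys m \<subseteq> {1..Suc r}"
    and deg: "sum (Poly_Mapping.lookup m) {1..Suc r} + 2 = r"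
  shows "bracket r (Poly_Mapping.single m c * (psum i * adj i)) = 0"
proof -
  let ?V = "{1..i}" and ?U = "{Suc i..Suc r}"
  let ?m1 = "restrict_exps ?V m" and ?m2 = "restrict_exps ?U m"
  let ?A = "nonadj 0 i" and ?B = "nonadj i (Suc r - i)"
  let ?s1 = "Poly_Mapping.single ?m1 (1::qpoly)" and ?s2 = "Poly_Mapping.single ?m2 c"
  have VU: "{1..Suc r} = ?V \<union> ?U" "?V \<inter> ?U = {}" using i by auto
  have mm: "m = ?m1 + ?m2"
  proof (rule poly_mapping_eqI)
    fix k show "Poly_Mapping.lookup m k = Poly_Mapping.lookup (?m1 + ?m2) k"
      using m VU by (cases "k \<in> {1..Suc r}") (auto simp: lookup_add lookup_restrict_exps in_keys_iff)
  qed
  have sm: "Poly_Mapping.single m c = ?s1 * ?s2"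
    by (subst (1) mm) (simp add: mult_single)
  have split: "insert (i, Suc i) (nonadj 0 (Suc r)) = ?A \<union> (?B \<union> ?V \<times> ?U)"
    using i by (auto simp: nonadj_def)
  have "q_factors (nonadj 0 (Suc r)) * adj i = q_factors (insert (i, Suc i) (nonadj 0 (Suc r)))"
    by (subst prod.insert[OF finite_nonadj]) (auto simp: nonadj_def adj_def mult.commute)
  also have "\<dots> = q_factors ?A * (q_factors ?B * q_factors (?V \<times> ?U))"
    unfolding split
    by (subst prod.union_disjoint, simp, simp, force simp: nonadj_def)
       (subst prod.union_disjoint, simp, simp, force simp: nonadj_def, simp)
  finally have N: "q_factors (nonadj 0 (Suc r)) * adj i = q_factors ?A * (q_factors ?B * q_factors (?V \<times> ?U))" .
  let ?d1 = "sum (Poly_Mapping.lookup m) ?V" and ?d2 = "sum (Poly_Mapping.lookup m) ?U"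
  have d: "?d1 + ?d2 + 2 = r"
  proof -
    have "sum (Poly_Mapping.lookup m) {1..Suc r} = ?d1 + ?d2"
      unfolding VU(1) by (rule sum.union_disjoint[OF _ _ VU(2)]) simp_all
    then show ?thesis using deg by simp
  qed
  have h1: "?s1 * q_factors ?A \<in> homog ?V (?d1 + card ?A)"
  proof (rule homog_mult)
    show "?s1 \<in> homog ?V ?d1"
      using homog_single[OF keys_restrict_exps, of ?V m 1] by (simp add: lookup_restrict_exps)
    show "q_factors ?A \<in> homog ?V (card ?A)" by (rule homog_q_factors[OF finite_nonadj]) (auto simp: nonadj_def)
  qed
  have h2: "?s2 * q_factors ?B \<in> homog ?U (?d2 + card ?B)"
  proof (rule homog_mult)
    show "?s2 \<in> homog ?U ?d2"
      using homog_single[OF keys_restrict_exps, of ?U m c] by (simp add: lookup_restrict_exps)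
    show "q_factors ?B \<in> homog ?U (card ?B)" by (rule homog_q_factors[OF finite_nonadj]) (auto simp: nonadj_def)
  qed
  have cU: "card ?U = Suc r - i" using i by simp
  have total: "Poly_Mapping.single m c * (psum i * adj i) * q_factors (nonadj 0 (Suc r))
      = (?s1 * q_factors ?A) * (?s2 * q_factors ?B) * (psum i * q_factors (?V \<times> ?U))"
    unfolding sm using N by (simp add: ac_simps)
  have "antisymmetrize (Suc r) (Poly_Mapping.single m c * (psum i * adj i) * q_factors (nonadj 0 (Suc r))) = 0"
  proof (cases "?d1 + 1 < i")
    case True
    have "antisymmetrize (Suc r) ((?s1 * q_factors ?A) * ((?s2 * q_factors ?B) * (psum i * q_factors (?V \<times> ?U)))) = 0"
    proof (rule antisymmetrize_small_degree[OF _ h1])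
      show "?d1 + card ?A < card ?V choose 2" using card_nonadj[of i 0] True by simp
      fix a b assume ab: "a \<in> ?V" "b \<in> ?V"
      have "perm_act (transpose a b) ?s2 = ?s2"
        using keys_restrict_exps[of ?U m] ab by (intro perm_act_transpose_single) auto
      moreover have "perm_act (transpose a b) (q_factors ?B) = q_factors ?B"
        using ab by (intro perm_act_transpose_q_factors_disjoint) (auto simp: nonadj_def)
      moreover have "perm_act (transpose a b) (q_factors (?V \<times> ?U)) = q_factors (?V \<times> ?U)"
        using ab by (intro perm_act_transpose_q_factors_Times) auto
      ultimately show "perm_act (transpose a b) ((?s2 * q_factors ?B) * (psum i * q_factors (?V \<times> ?U)))
          = (?s2 * q_factors ?B) * (psum i * q_factors (?V \<times> ?U))"
        using ab perm_act_transpose_psum[of a i b] by (simp only: perm_act_mult bij_transpose) simp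
    qed (use i in auto)
    then show ?thesis unfolding total by (simp only: mult.assoc)
  next
    case False
    have "antisymmetrize (Suc r) ((?s2 * q_factors ?B) * ((?s1 * q_factors ?A) * (psum i * q_factors (?V \<times> ?U)))) = 0"
    proof (rule antisymmetrize_small_degree[OF _ h2])
      show "?d2 + card ?B < card ?U choose 2"
        unfolding cU using card_nonadj[of "Suc r - i" i] False d i by linarith
      fix a b assume ab: "a \<in> ?U" "b \<in> ?U"
      have "perm_act (transpose a b) ?s1 = ?s1"
        using keys_restrict_exps[of ?V m] ab by (intro perm_act_transpose_single) auto
      moreover have "perm_act (transpose a b) (q_factors ?A) = q_factors ?A"
        using ab by (intro perm_act_transpose_q_factors_disjoint) (auto simp: nonadj_def)
      moreover have "perm_act (transpose a b) (q_factors (?V \<times> ?U)) = q_factors (?V \<times> ?U)"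
        using ab by (intro perm_act_transpose_q_factors_Times) auto
      ultimately show "perm_act (transpose a b) ((?s1 * q_factors ?A) * (psum i * q_factors (?V \<times> ?U)))
          = (?s1 * q_factors ?A) * (psum i * q_factors (?V \<times> ?U))"
        using ab perm_act_transpose_psum[of a i b] by (simp only: perm_act_mult bij_transpose) simp
    qed (use i in auto)
    then show ?thesis unfolding total by (simp only: mult.left_commute mult.commute mult.assoc)
  qed
  then show ?thesis by (simp add: bracket_def alt_coeff_def)
qed

lemma bracket_psum_adj:
  assumes i: "1 \<le> i" "i \<le> r" and f: "f \<in> homog {1..Suc r} d" "d + 2 = r"
  shows "bracket r (f * (psum i * adj i)) = 0"
proof -
  have "bracket r (f * (psum i * adj i))
      = (\<Sum>m\<in>Poly_Mapping.keys f. bracket r (Poly_Mapping.single m (Poly_Mapping.lookup f m) * (psum i * adj i)))"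
    unfolding bracket_sum[symmetric] sum_distrib_right[symmetric] sum_monomials ..
  also have "\<dots> = 0"
    using f by (intro sum.neutral ballI bracket_psum_adj_monomial[OF i]) (auto simp: homog_def)
  finally show ?thesis .
qed

text \<open>
  The sum of all variables is symmetric, and the other factors have too small a degree.
\<close>

lemma bracket_psum_last:
  assumes f: "f \<in> homog {1..Suc r} d" "d < r"
  shows "bracket r (f * psum (Suc r)) = 0"
proof -
  have "q_factors (nonadj 0 (Suc r)) \<in> homog {1..Suc r} (card (nonadj 0 (Suc r)))"
    by (rule homog_q_factors[OF finite_nonadj]) (auto simp: nonadj_def)
  from homog_mult[OF f(1) this]
  have "antisymmetrize (Suc r) (f * q_factors (nonadj 0 (Suc r)) * psum (Suc r)) = 0"
    by (rule antisymmetrize_small_degree[OF order_refl])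
       (use card_nonadj[of "Suc r" 0] f(2) in \<open>auto intro!: perm_act_transpose_psum\<close>)
  then show ?thesis by (simp add: bracket_def alt_coeff_def ac_simps)
qed

lemma psum_0: "psum 0 = 0"
  by (simp add: psum_def)

text \<open>
  The adjacent factor is a second difference of partial sums. Hence the quadratic relations say
  that the bracket is \<open>q\<close>-harmonic as a function of the index of one partial sum, wherever
  that index already occurs in the product.
\<close>

lemma adj_psum: "1 \<le> i \<Longrightarrow> adj i = (1 + Q) * psum i - Q * psum (i - 1) - psum (Suc i)"
  by (cases i) (simp_all add: adj_def psum_def algebra_simps)

lemma bracket_adj:
  assumes "1 \<le> i"
  shows "bracket r (G * adj i) = (1 + qpow 1) * bracket r (G * psum i) - qpow 1 * bracket r (G * psum (i - 1)) - bracket r (G * psum (Suc i))"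
proof -
  have "G * adj i = Const 1 * (G * psum i) + Const (qpow 1) * (G * psum i) - Const (qpow 1) * (G * psum (i - 1)) - G * psum (Suc i)"
    unfolding adj_psum[OF assms] by (simp add: Const_1 Q_def algebra_simps)
  then show ?thesis by (simp only: bracket_diff bracket_add bracket_Const distrib_right)
qed

lemma bracket_harmonic:
  assumes i: "1 \<le> i" "i \<le> r" and f: "f \<in> homog {1..Suc r} d" "d + 2 = r" and G: "G = f * psum i"
  shows "(1 + qpow 1) * bracket r (G * psum i) = qpow 1 * bracket r (G * psum (i - 1)) + bracket r (G * psum (Suc i))"
proof -
  have *: "a = b + c" if "0 = a - b - c" for a b c :: qpoly
    using that by (simp add: algebra_simps)
  have "bracket r (G * adj i) = 0" using bracket_psum_adj[OF i f] by (simp add: G mult.assoc)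
  then show ?thesis using bracket_adj[OF i(1), of r G] by (intro *) simp
qed

text \<open>
  Consecutive differences of \<open>F\<close> grow by the factor \<open>q\<close>, so \<open>F s - F 0\<close> is proportional to
  \<open>(s)\<^sub>q\<close>. This gives the exit probabilities, times \<open>(m + 1)\<^sub>q\<close>, of a biased walk on \<open>{0..m + 1}\<close>.
\<close>

lemma q_harmonic_solution:
  assumes F: "\<And>s. 1 \<le> s \<Longrightarrow> s \<le> m \<Longrightarrow> (1 + qpow 1) * F s = qpow 1 * F (s - 1) + F (Suc s)"
    and s: "s \<le> Suc m"
  shows "q_int (Suc m) * F s = qpow s * q_int (Suc m - s) * F 0 + q_int s * F (Suc m)"
proof -
  have step: "F (Suc t) - F t = qpow t * (F 1 - F 0)" if "t \<le> m" for t
    using that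
  proof (induction t)
    case 0
    then show ?case by simp
  next
    case (Suc t)
    have "F (Suc (Suc t)) - F (Suc t) = qpow 1 * (F (Suc t) - F t)"
      using F[of "Suc t"] Suc.prems by (simp add: algebra_simps)
    then show ?case using Suc by (simp add: mult_monom flip: mult.assoc)
  qed
  have tot: "F t - F 0 = q_int t * (F 1 - F 0)" if "t \<le> Suc m" for t
    using that
  proof (induction t)
    case 0
    then show ?case by (simp add: q_int_0)
  next
    case (Suc t)
    then show ?case using step[of t] by (simp add: q_int_Suc algebra_simps)
  qed
  have "q_int (Suc m) * (F s - F 0) = q_int s * (F (Suc m) - F 0)"
    unfolding tot[OF s] tot[OF order_refl] by (simp add: ac_simps)
  moreover have "q_int (Suc m) = q_int s + qpow s * q_int (Suc m - s)"
    using q_int_add[of s "Suc m - s"] s by simp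
  ultimately have "q_int (Suc m) * F s - q_int (Suc m) * F 0 = q_int s * F (Suc m) - q_int s * F 0"
    "q_int (Suc m) * F 0 = q_int s * F 0 + qpow s * q_int (Suc m - s) * F 0"
    by (simp_all only: right_diff_distrib distrib_right)
  then show ?thesis by (simp add: algebra_simps)
qed

section \<open>The antisymmetrization of the product of all \<open>q x\<^sub>i - x\<^sub>j\<close>\<close>

text \<open>
  The hypothesis says that \<open>k + 1\<close> precedes \<open>k\<close> in the word of \<open>\<sigma>\<close> for every \<open>k\<close>, so that word is
  decreasing.
\<close>

lemma no_ascent_rev:
  assumes s: "\<sigma> permutes {1..n}" and na: "\<And>i j. (i, j) \<in> pairs n \<Longrightarrow> \<sigma> j \<noteq> Suc (\<sigma> i)" and k: "k \<in> {1..n}"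
  shows "\<sigma> k = Suc n - k"
proof -
  \<comment> \<open>This function is nonincreasing on \<open>{1..n}\<close>, at most \<open>n + 1\<close> at \<open>1\<close> and at least \<open>n + 1\<close> at \<open>n\<close>, hence constant.\<close>
  let ?g = "\<lambda>k. inv \<sigma> k + k"
  have g: "inv \<sigma> k \<in> {1..n}" if "k \<in> {1..n}" for k
    using permutes_in_image[OF permutes_inv[OF s], of k] that by blast
  have dec: "?g (Suc k) \<le> ?g k" if "1 \<le> k" "k < n" for k
  proof -
    have "\<sigma> (inv \<sigma> (Suc k)) = Suc (\<sigma> (inv \<sigma> k))" using permutes_inverses(1)[OF s] by simp
    then have "(inv \<sigma> k, inv \<sigma> (Suc k)) \<notin> pairs n" using na by metis
    moreover have "inv \<sigma> k \<noteq> inv \<sigma> (Suc k)" using permutes_inj[OF permutes_inv[OF s]] by (simp add: inj_eq)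
    ultimately show ?thesis using g[of k] g[of "Suc k"] that by (auto simp: pairs_def)
  qed
  have mono: "?g l \<le> ?g k" if "1 \<le> k" "k \<le> l" "l \<le> n" for k l
    using that(2,3)
  proof (induction l rule: dec_induct)
    case base
    then show ?case by simp
  next
    case (step l)
    then show ?case using dec[of l] that(1) by linarith
  qed
  have all: "inv \<sigma> k = Suc n - k" if k: "k \<in> {1..n}" for k
  proof -
    have "?g n \<ge> Suc n" "?g 1 \<le> Suc n" using g[of n] g[of 1] k by auto
    then have "?g k = Suc n" using mono[of 1 k] mono[of k n] k by auto
    then show ?thesis by linarith
  qed
  have k': "Suc n - k \<in> {1..n}" using k by auto
  have "k = inv \<sigma> (Suc n - k)" using all[OF k'] k by auto
  then show ?thesis using permutes_inverses(1)[OF s, of "Suc n - k"] by simp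
qed

definition rev_perm :: "nat \<Rightarrow> nat \<Rightarrow> nat" where
  "rev_perm n k = (if k \<in> {1..n} then Suc n - k else k)"

lemma rev_perm_permutes: "rev_perm n permutes {1..n}"
proof (rule bij_imp_permutes)
  show "bij_betw (rev_perm n) {1..n} {1..n}"
    by (rule bij_betw_byWitness[of _ "rev_perm n"]) (auto simp: rev_perm_def)
qed (auto simp: rev_perm_def)

lemma prod_pairs_rev:
  "(\<Prod>p\<in>pairs n. f (rev_perm n (fst p)) (rev_perm n (snd p))) = (\<Prod>p\<in>pairs n. (f (snd p) (fst p) :: qpoly))"
proof -
  let ?g = "\<lambda>p. (rev_perm n (snd p), rev_perm n (fst p))"
  have "bij_betw ?g (pairs n) (pairs n)"
    by (rule bij_betw_byWitness[of _ ?g]) (auto simp: pairs_def rev_perm_def)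
  from prod.reindex_bij_betw[OF this, of "\<lambda>p. f (snd p) (fst p)"] show ?thesis by simp
qed

lemma qpow_diff: "a \<le> b \<Longrightarrow> qpow b - qpow a = qpow a * (qpow 1 - 1) * q_int (b - a)"
proof -
  have *: "(qpow 1 - 1) * q_int k = qpow k - 1" for k
    by (induction k) (simp_all add: q_int_0 q_int_Suc mult_monom algebra_simps monom_0 one_pCons)
  assume "a \<le> b"
  then have "qpow b - qpow a = qpow a * (qpow (b - a) - 1)" by (simp add: mult_monom right_diff_distrib)
  then show ?thesis by (simp only: mult.assoc *)
qed

lemma pairs_Suc: "pairs (Suc n) = pairs n \<union> (\<lambda>a. (a, Suc n)) ` {1..n}"
  by (auto simp: pairs_def)

lemma prod_pairs_Suc: "(\<Prod>p\<in>pairs (Suc n). f p) = (\<Prod>p\<in>pairs n. f p) * (\<Prod>a=1..n. (f (a, Suc n) :: qpoly))"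
proof -
  have "pairs n \<inter> (\<lambda>a. (a, Suc n)) ` {1..n} = {}" by (auto simp: pairs_def)
  then show ?thesis
    unfolding pairs_Suc by (simp add: prod.union_disjoint prod.reindex inj_on_def)
qed

text \<open>
  Since \<open>q\<^sup>b - q\<^sup>a = q\<^sup>a (q - 1) (b - a)\<^sub>q\<close>, the ratio of the factors with second index \<open>b\<close>
  telescopes to \<open>(b)\<^sub>q\<close>.
\<close>

lemma prod_qpow_diff_ratio:
  "(\<Prod>p\<in>pairs n. qpow (Suc (snd p)) - qpow (fst p)) = q_fact n * (\<Prod>p\<in>pairs n. qpow (snd p) - qpow (fst p))"
proof (induction n)
  case 0
  then show ?case by (simp add: q_fact_0 pairs_Sigma)
next
  case (Suc n)
  let ?c = "\<Prod>a=1..n. qpow a * (qpow 1 - 1)"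
  have f: "(\<Prod>i=1..n. q_int (Suc i)) = q_fact (Suc n)"
    by (induction n) (simp_all add: q_fact_Suc q_fact_0 q_int_1)
  have "(\<Prod>a=1..n. qpow (Suc (Suc n)) - qpow a) = (\<Prod>a=1..n. qpow a * (qpow 1 - 1) * q_int (Suc (Suc n) - a))"
    by (intro prod.cong refl qpow_diff) auto
  also have "\<dots> = ?c * (\<Prod>a=1..n. q_int (Suc (Suc n) - a))" by (rule prod.distrib)
  also have "(\<Prod>a=1..n. q_int (Suc (Suc n) - a)) = (\<Prod>i=1..n. q_int (Suc i))"
    by (subst prod.atLeastAtMost_rev) (intro prod.cong refl, auto simp: Suc_diff_le)
  finally have 1: "(\<Prod>a=1..n. qpow (Suc (Suc n)) - qpow a) = ?c * q_fact (Suc n)" unfolding f .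
  have "(\<Prod>a=1..n. qpow (Suc n) - qpow a) = (\<Prod>a=1..n. qpow a * (qpow 1 - 1) * q_int (Suc n - a))"
    by (intro prod.cong refl qpow_diff) auto
  also have "\<dots> = ?c * (\<Prod>a=1..n. q_int (Suc n - a))" by (rule prod.distrib)
  also have "(\<Prod>a=1..n. q_int (Suc n - a)) = q_fact n"
    unfolding q_fact_def by (subst prod.atLeastAtMost_rev) simp
  finally have 2: "(\<Prod>a=1..n. qpow (Suc n) - qpow a) = ?c * q_fact n" .
  show ?case
    unfolding prod_pairs_Suc Suc.IH fst_conv snd_conv 1 2 by (simp only: ac_simps)
qed

text \<open>
  Evaluate at \<open>x\<^sub>k = q\<^sup>k\<close>. The factor \<open>q x\<^sub>i - x\<^sub>j\<close> of the summand for \<open>\<sigma>\<close> vanishes as soon as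
  \<open>\<sigma> j = \<sigma> i + 1\<close> for some \<open>i < j\<close>, so only the order-reversing permutation contributes. Its
  summand and the evaluated Vandermonde product are explicit products.
\<close>

lemma alt_coeff_q_factors_pairs: "alt_coeff n (q_factors (pairs n)) = q_fact n"
proof -
  let ?F = "q_factors (pairs n)" and ?P = "alt_coeff n (q_factors (pairs n))" and ?w = "rev_perm n"
  let ?D = "\<Prod>p\<in>pairs n. qpow (snd p) - qpow (fst p)"
  let ?sg = "of_int (sign ?w) :: qpoly"
  have w: "?w permutes {1..n}" by (rule rev_perm_permutes)
  have "?F \<in> homog {1..n} (card (pairs n))"
    by (rule homog_q_factors[OF finite_pairs]) (auto simp: pairs_def)
  then have A: "antisymmetrize n ?F = vandermonde n * Const ?P"
    using antisymmetrize_eq_vandermonde[of ?F n] by (simp add: card_pairs)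
  have evF: "evaluate qpow (perm_act \<sigma> ?F) = (\<Prod>p\<in>pairs n. qpow (Suc (\<sigma> (fst p))) - qpow (\<sigma> (snd p)))"
    if "\<sigma> permutes {1..n}" for \<sigma>
    using that by (simp add: permutes_bij perm_act_q_factors evaluate_prod evaluate_diff evaluate_mult evaluate_Q evaluate_X mult_monom)
  have "evaluate qpow (antisymmetrize n ?F)
      = (\<Sum>\<sigma> | \<sigma> permutes {1..n}. of_int (sign \<sigma>) * evaluate qpow (perm_act \<sigma> ?F))"
    by (simp add: antisymmetrize_def evaluate_sum evaluate_mult evaluate_of_int)
  also have "\<dots> = (\<Sum>\<sigma> | \<sigma> permutes {1..n}. if \<sigma> = ?w then ?sg * evaluate qpow (perm_act ?w ?F) else 0)"
  proof (intro sum.cong refl)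
    fix \<sigma> assume "\<sigma> \<in> {\<sigma>. \<sigma> permutes {1..n}}"
    then have s: "\<sigma> permutes {1..n}" by simp
    show "of_int (sign \<sigma>) * evaluate qpow (perm_act \<sigma> ?F) = (if \<sigma> = ?w then ?sg * evaluate qpow (perm_act ?w ?F) else 0)"
    proof (cases "\<sigma> = ?w")
      case False
      then obtain k where "\<sigma> k \<noteq> ?w k" by blast
      then have "k \<in> {1..n}" "\<sigma> k \<noteq> Suc n - k"
        using s unfolding rev_perm_def permutes_def by (metis, metis)
      then obtain i j where ij: "(i, j) \<in> pairs n" "\<sigma> j = Suc (\<sigma> i)"
        using no_ascent_rev[OF s] by blast
      then have "evaluate qpow (perm_act \<sigma> ?F) = 0"
        unfolding evF[OF s] by (intro prod_zero) (auto intro!: bexI[of _ "(i, j)"])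
      then show ?thesis using False by simp
    qed simp
  qed
  also have "\<dots> = ?sg * evaluate qpow (perm_act ?w ?F)" using w by (simp add: finite_permutations)
  also have "evaluate qpow (perm_act ?w ?F) = (\<Prod>p\<in>pairs n. qpow (Suc (snd p)) - qpow (fst p))"
    unfolding evF[OF w] by (rule prod_pairs_rev[of "\<lambda>a b. qpow (Suc a) - qpow b"])
  finally have L: "evaluate qpow (antisymmetrize n ?F) = ?sg * (q_fact n * ?D)"
    by (simp only: prod_qpow_diff_ratio)
  have "?sg * evaluate qpow (vandermonde n) = evaluate qpow (perm_act ?w (vandermonde n))"
    using alternating_vandermonde[of n] w by (simp add: alternating_def evaluate_mult evaluate_of_int)
  also have "\<dots> = (\<Prod>p\<in>pairs n. qpow (?w (fst p)) - qpow (?w (snd p)))"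
    using w by (simp add: vandermonde_pairs permutes_bij perm_act_prod perm_act_diff perm_act_X evaluate_prod evaluate_diff evaluate_X)
  also have "\<dots> = ?D" by (rule prod_pairs_rev[of "\<lambda>a b. qpow a - qpow b"])
  finally have V: "?sg * evaluate qpow (vandermonde n) = ?D" .
  have sg2: "?sg * ?sg = 1" by (cases ?w rule: sign_cases) auto
  have "?D * q_fact n = ?sg * (?sg * (q_fact n * ?D))" using sg2 by (simp flip: mult.assoc)
  also have "\<dots> = ?sg * evaluate qpow (vandermonde n * Const ?P)" using L A by simp
  also have "\<dots> = ?D * ?P" unfolding evaluate_mult evaluate_Const mult.assoc[symmetric] V ..
  finally have "?D * q_fact n = ?D * ?P" .
  moreover have "?D \<noteq> 0"
  proof -
    have "qpow (snd p) - qpow (fst p) \<noteq> 0" if "p \<in> pairs n" for p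
      using that by (auto simp: pairs_def dest: monom_eq_iff'[THEN iffD1])
    then show ?thesis by (simp add: prod_zero_iff)
  qed
  ultimately show ?thesis by simp
qed

section \<open>The remixed Eulerian number of the all-ones sequence\<close>

text \<open>
  Interpolate between the product of all adjacent factors, which completes the product in the
  bracket to all pairs and so has bracket \<open>(r + 1)\<^sub>q!\<close>, and the product of all partial sums. Write \<open>C k\<close> for the
  bracket of \<open>y\<^sub>1 \<dots> y\<^sub>k\<close> times the adjacent factors with indices \<open>k + 1, \<dots>, r\<close>, where
  \<open>y\<^sub>i\<close> is the \<open>i\<close>-th partial sum. Expanding one adjacent factor into partial sums and
  solving the harmonic relation on \<open>{0..k + 1}\<close> gives \<open>(k + 1)\<^sub>q C k = (k + 2)\<^sub>q C (k + 1)\<close>.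
\<close>

lemma bracket_all_ones: "bracket r (\<Prod>i=1..r. psum i) = q_fact r"
proof -
  define Y where "Y k = (\<Prod>i=1..k. psum i)" for k
  define Z where "Z k = (\<Prod>i=k..r. adj i)" for k
  have homY: "Y k \<in> homog {1..Suc r} k" if "k \<le> r" for k
    using homog_prod[of "{1..k}" psum "{1..Suc r}" "\<lambda>_. 1"] that homog_psum[of _ "Suc r"] by (simp add: Y_def)
  have homZ: "Z k \<in> homog {1..Suc r} (Suc r - k)" if "1 \<le> k" for k
    using homog_prod[of "{k..r}" adj "{1..Suc r}" "\<lambda>_. 1"] that homog_adj[of _ "Suc r"] by (simp add: Z_def)
  have Zrec: "Z k = adj k * Z (Suc k)" if "k \<le> r" for k
    using that by (simp add: Z_def prod.atLeast_Suc_atMost)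
  have Ysplit: "\<exists>g\<in>homog {1..Suc r} (k - 1). Y k = g * psum j" if "1 \<le> j" "j \<le> k" "k \<le> r" for j k
  proof
    let ?g = "\<Prod>i\<in>{1..k} - {j}. psum i"
    show "Y k = ?g * psum j" using that by (simp add: Y_def prod.remove[of _ j] mult.commute)
    have "?g \<in> homog {1..Suc r} (\<Sum>i\<in>{1..k} - {j}. 1)"
      using that by (intro homog_prod homog_psum) auto
    then show "?g \<in> homog {1..Suc r} (k - 1)" using that by simp
  qed
  have start: "bracket r (Z 1) = q_fact (Suc r)"
  proof -
    let ?I = "(\<lambda>i. (i, Suc i)) ` {1..r}"
    have "pairs (Suc r) = ?I \<union> nonadj 0 (Suc r)"
      by (auto simp: pairs_def nonadj_def image_iff)
    moreover have "?I \<inter> nonadj 0 (Suc r) = {}" by (auto simp: nonadj_def)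
    moreover have "q_factors ?I = Z 1"
      by (subst prod.reindex) (auto simp: inj_on_def Z_def adj_def)
    ultimately have "q_factors (pairs (Suc r)) = Z 1 * q_factors (nonadj 0 (Suc r))"
      by (simp add: prod.union_disjoint)
    then show ?thesis using alt_coeff_q_factors_pairs[of "Suc r"] by (simp add: bracket_def)
  qed
  have step: "q_int (Suc k) * bracket r (Y k * Z (Suc k)) = q_int (Suc (Suc k)) * bracket r (Y (Suc k) * Z (Suc (Suc k)))"
    if k: "k < r" for k
  proof -
    let ?G = "Y k * Z (Suc (Suc k))"
    let ?F = "\<lambda>j. bracket r (?G * psum j)"
    have harm: "(1 + qpow 1) * ?F j = qpow 1 * ?F (j - 1) + ?F (Suc j)" if j: "1 \<le> j" "j \<le> k" for j
    proof -
      obtain g where g: "g \<in> homog {1..Suc r} (k - 1)" "Y k = g * psum j"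
        using Ysplit[OF j] k by auto
      show ?thesis
      proof (rule bracket_harmonic)
        show "g * Z (Suc (Suc k)) \<in> homog {1..Suc r} ((k - 1) + (Suc r - Suc (Suc k)))"
          by (rule homog_mult[OF g(1) homZ]) simp
        show "?G = g * Z (Suc (Suc k)) * psum j" using g(2) by (simp add: ac_simps)
      qed (use j k in auto)
    qed
    have F0: "?F 0 = 0" by (simp add: psum_0 bracket_0)
    \<comment> \<open>The next adjacent factor kills the product; after the last one, symmetry does.\<close>
    have FS: "?F (Suc (Suc k)) = 0"
    proof (cases "Suc k = r")
      case True
      then show ?thesis
        using bracket_psum_last[of ?G r "k + (Suc r - Suc (Suc k))"] homog_mult[OF homY homZ, of k "Suc (Suc k)"] k
        by simp
    next
      case False
      have "bracket r ((Y k * Z (Suc (Suc (Suc k)))) * (psum (Suc (Suc k)) * adj (Suc (Suc k)))) = 0"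
        using homog_mult[OF homY homZ, of k "Suc (Suc (Suc k))"] k False
        by (intro bracket_psum_adj[of _ _ _ "k + (Suc r - Suc (Suc (Suc k)))"]) auto
      then show ?thesis using Zrec[of "Suc (Suc k)"] k False by (simp add: ac_simps)
    qed
    have "bracket r (Y k * Z (Suc k)) = bracket r (?G * adj (Suc k))"
      using Zrec[of "Suc k"] k by (simp add: ac_simps)
    also have "\<dots> = (1 + qpow 1) * ?F (Suc k) - qpow 1 * ?F k"
      using bracket_adj[of "Suc k" r ?G] FS by simp
    finally have C: "bracket r (Y k * Z (Suc k)) = (1 + qpow 1) * ?F (Suc k) - qpow 1 * ?F k" .
    have sol: "q_int (Suc k) * ?F k = q_int k * ?F (Suc k)"
      using q_harmonic_solution[of k ?F k] harm F0 by simp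
    have "q_int (Suc k) * bracket r (Y k * Z (Suc k))
        = q_int (Suc k) * (1 + qpow 1) * ?F (Suc k) - qpow 1 * (q_int (Suc k) * ?F k)"
      unfolding C by (simp add: algebra_simps)
    also have "\<dots> = (q_int (Suc k) * (1 + qpow 1) - qpow 1 * q_int k) * ?F (Suc k)"
      unfolding sol by (simp add: algebra_simps)
    also have "q_int (Suc k) * (1 + qpow 1) - qpow 1 * q_int k = q_int (Suc (Suc k))"
      by (simp add: q_int_Suc mult_monom algebra_simps)
    also have "?F (Suc k) = bracket r (Y (Suc k) * Z (Suc (Suc k)))"
      by (simp add: Y_def ac_simps)
    finally show ?thesis .
  qed
  have "q_int (Suc k) * bracket r (Y k * Z (Suc k)) = q_fact (Suc r)" if "k \<le> r" for k
    using that
  proof (induction k)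
    case 0
    then show ?case using start by (simp add: Y_def q_int_1)
  next
    case (Suc k)
    then show ?case using step[of k] by simp
  qed
  from this[of r] have "q_int (Suc r) * bracket r (Y r) = q_int (Suc r) * q_fact r"
    by (simp add: Z_def q_fact_Suc mult.commute)
  then show ?thesis using q_int_nonzero[of "Suc r"] by (simp add: Y_def)
qed

section \<open>Maximal intervals of a set of sites\<close>

lemma max_intervals_iff:
  assumes "0 \<notin> S"
  shows "I \<in> max_intervals S \<longleftrightarrow>
    (\<exists>a b. 1 \<le> a \<and> a \<le> b \<and> I = {a..b} \<and> {a..b} \<subseteq> S \<and> a - 1 \<notin> S \<and> Suc b \<notin> S)"
proof
  assume I: "I \<in> max_intervals S"
  then obtain a b where ab: "a \<le> b" "I = {a..b}" "{a..b} \<subseteq> S"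
    by (auto simp: max_intervals_def intervals_in_def)
  have max: "J = I" if "c \<le> d" "J = {c..d}" "J \<subseteq> S" "I \<subseteq> J" for J c d
    using I that by (auto simp: max_intervals_def intervals_in_def)
  have a: "1 \<le> a" using ab assms by (cases a) auto
  have "a - 1 \<notin> S"
  proof
    assume "a - 1 \<in> S"
    moreover have "{a - 1..b} = insert (a - 1) {a..b}" using ab(1) a by auto
    ultimately have "{a - 1..b} = I" using ab by (intro max[of "a - 1" b]) auto
    then show False using ab a by auto
  qed
  moreover have "Suc b \<notin> S"
  proof
    assume "Suc b \<in> S"
    moreover have "{a..Suc b} = insert (Suc b) {a..b}" using ab(1) by auto
    ultimately have "{a..Suc b} = I" using ab by (intro max[of a "Suc b"]) auto
    then show False using ab by auto
  qed
  ultimately show "\<exists>a b. 1 \<le> a \<and> a \<le> b \<and> I = {a..b} \<and> {a..b} \<subseteq> S \<and> a - 1 \<notin> S \<and> Suc b \<notin> S"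
    using a ab by blast
next
  assume "\<exists>a b. 1 \<le> a \<and> a \<le> b \<and> I = {a..b} \<and> {a..b} \<subseteq> S \<and> a - 1 \<notin> S \<and> Suc b \<notin> S"
  then obtain a b where ab: "1 \<le> a" "a \<le> b" "I = {a..b}" "{a..b} \<subseteq> S" "a - 1 \<notin> S" "Suc b \<notin> S"
    by blast
  show "I \<in> max_intervals S"
    unfolding max_intervals_def
  proof (intro CollectI conjI ballI impI)
    show "I \<in> intervals_in S" using ab by (auto simp: intervals_in_def)
    fix J assume "J \<in> intervals_in S" and IJ: "I \<subseteq> J"
    then obtain c d where J: "J = {c..d}" "J \<subseteq> S" by (auto simp: intervals_in_def)
    have "a - 1 \<notin> J" "Suc b \<notin> J" using J ab by auto
    moreover have "a \<in> J" "b \<in> J" using IJ ab by auto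
    ultimately have "c = a" "d = b" using J ab by auto
    then show "J = I" using J ab by simp
  qed
qed

lemma max_interval_unique:
  assumes "0 \<notin> S" "I \<in> max_intervals S" "J \<in> max_intervals S" "x \<in> I" "x \<in> J"
  shows "I = J"
proof -
  obtain a b where I: "1 \<le> a" "a \<le> b" "I = {a..b}" "{a..b} \<subseteq> S" "a - 1 \<notin> S" "Suc b \<notin> S"
    using assms max_intervals_iff by metis
  obtain c d where J: "1 \<le> c" "c \<le> d" "J = {c..d}" "{c..d} \<subseteq> S" "c - 1 \<notin> S" "Suc d \<notin> S"
    using assms max_intervals_iff by metis
  have *: "a - 1 \<notin> {c..d}" "Suc b \<notin> {c..d}" "c - 1 \<notin> {a..b}" "Suc d \<notin> {a..b}"
    using I J by blast+
  have "a = c" "b = d" using * assms(4,5) I(1,3) J(1,3) by auto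
  then show ?thesis using I J by simp
qed

lemma finite_max_intervals: "finite S \<Longrightarrow> finite (max_intervals S)"
  by (rule finite_subset[of _ "Pow S"]) (auto simp: max_intervals_def intervals_in_def)

lemma empty_not_max_interval: "{} \<notin> max_intervals S"
  by (auto simp: max_intervals_def intervals_in_def)

text \<open>
  A new site \<open>x\<close> joins the run of length \<open>l\<close> on its left and the run of length \<open>m\<close> on its right.
  Either run may be empty, in which case it is not among the maximal intervals.
\<close>

lemma max_intervals_insert:
  assumes S0: "0 \<notin> S" and x: "x \<notin> S" "l < x"
    and L: "{x - l..<x} \<subseteq> S" "x - l - 1 \<notin> S" and R: "{x<..x + m} \<subseteq> S" "Suc (x + m) \<notin> S"
  defines "K \<equiv> max_intervals S - {{x - l..<x}, {x<..x + m}}"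
  shows "max_intervals S = K \<union> ({{x - l..<x}, {x<..x + m}} - {{}})"
    and "max_intervals (insert x S) = insert {x - l..x + m} K"
    and "{x - l..x + m} \<notin> K"
proof -
  have Lmax: "{x - l..<x} \<in> max_intervals S" if "l \<noteq> 0"
  proof -
    have eq: "{x - l..<x} = {x - l..x - 1}" using x by auto
    show ?thesis
      unfolding max_intervals_iff[OF S0]
      by (rule exI[of _ "x - l"], rule exI[of _ "x - 1"]) (use x L that eq in auto)
  qed
  have Rmax: "{x<..x + m} \<in> max_intervals S" if "m \<noteq> 0"
  proof -
    have eq: "{x<..x + m} = {Suc x..x + m}" by auto
    show ?thesis
      unfolding max_intervals_iff[OF S0]
      by (rule exI[of _ "Suc x"], rule exI[of _ "x + m"]) (use x R that eq in auto)
  qed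
  show "max_intervals S = K \<union> ({{x - l..<x}, {x<..x + m}} - {{}})"
    using Lmax Rmax empty_not_max_interval[of S] unfolding K_def by (cases "l = 0"; cases "m = 0") auto
  have xm: "x \<notin> I" if "I \<in> max_intervals S" for I
    using that x by (auto simp: max_intervals_def intervals_in_def)
  then show "{x - l..x + m} \<notin> K" by (force simp: K_def)
  have S0': "0 \<notin> insert x S" using S0 x by auto
  let ?M = "{x - l..x + m}"
  have M: "?M \<in> max_intervals (insert x S)"
    unfolding max_intervals_iff[OF S0']
  proof (intro exI conjI)
    show "?M \<subseteq> insert x S"
    proof
      fix y assume "y \<in> ?M"
      then have "y \<in> {x - l..<x} \<or> y = x \<or> y \<in> {x<..x + m}" by auto
      then show "y \<in> insert x S" using L R by blast
    qed
  qed (use x L R in auto)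
  show "max_intervals (insert x S) = insert ?M K"
  proof (intro equalityI subsetI)
    fix I assume I: "I \<in> max_intervals (insert x S)"
    show "I \<in> insert ?M K"
    proof (cases "I = ?M")
      case False
      obtain a b where ab: "1 \<le> a" "a \<le> b" "I = {a..b}" "{a..b} \<subseteq> insert x S" "a - 1 \<notin> insert x S" "Suc b \<notin> insert x S"
        using I max_intervals_iff[OF S0'] by blast
      have disj: "I \<inter> ?M = {}" using max_interval_unique[OF S0' I M] False by blast
      then have "x \<notin> I" by auto
      then have "I \<in> max_intervals S" unfolding max_intervals_iff[OF S0] using ab by blast
      moreover have "I \<noteq> {}" using ab by auto
      moreover have "{x - l..<x} \<subseteq> ?M" "{x<..x + m} \<subseteq> ?M" by auto
      ultimately show ?thesis using disj unfolding K_def by blast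
    qed simp
  next
    fix I assume "I \<in> insert ?M K"
    then consider "I = ?M" | "I \<in> K" by blast
    then show "I \<in> max_intervals (insert x S)"
    proof cases
      case 2
      then have I: "I \<in> max_intervals S" "I \<noteq> {x - l..<x}" "I \<noteq> {x<..x + m}" by (auto simp: K_def)
      obtain a b where ab: "1 \<le> a" "a \<le> b" "I = {a..b}" "{a..b} \<subseteq> S" "a - 1 \<notin> S" "Suc b \<notin> S"
        using I max_intervals_iff[OF S0] by blast
      have "Suc b \<noteq> x"
      proof
        assume b: "Suc b = x"
        then have "l \<noteq> 0" using ab L(2) by auto
        then have "I = {x - l..<x}"
          using b ab x by (intro max_interval_unique[OF S0 I(1) Lmax, of b]) auto
        then show False using I by simp
      qed
      moreover have "a - 1 \<noteq> x"
      proof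
        assume a: "a - 1 = x"
        then have "m \<noteq> 0" using ab R(2) x by (cases m) auto
        then have "I = {x<..x + m}"
          using a ab x by (intro max_interval_unique[OF S0 I(1) Rmax, of a]) auto
        then show False using I by simp
      qed
      ultimately show ?thesis unfolding max_intervals_iff[OF S0'] using ab by blast
    qed (use M in simp)
  qed
qed

definition interval_fact :: "nat set \<Rightarrow> qpoly" where
  "interval_fact S = (\<Prod>I\<in>max_intervals S. q_fact (card I))"

definition interval_choose :: "nat set \<Rightarrow> nat" where
  "interval_choose S = (\<Sum>I\<in>max_intervals S. card I choose 2)"

text \<open>
  The two products differ only in the runs that merge; empty runs contribute the neutral element.
\<close>

lemma interval_insert:
  assumes fin: "finite S" and S0: "0 \<notin> S" and x: "x \<notin> S" "l < x"
    and L: "{x - l..<x} \<subseteq> S" "x - l - 1 \<notin> S" and R: "{x<..x + m} \<subseteq> S" "Suc (x + m) \<notin> S"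
  shows "interval_fact (insert x S) * (q_fact l * q_fact m) = interval_fact S * q_fact (l + m + 1)"
    and "interval_choose (insert x S) + (l choose 2) + (m choose 2) = interval_choose S + (l + m + 1 choose 2)"
proof -
  let ?L = "{x - l..<x}" and ?R = "{x<..x + m}" and ?M = "{x - l..x + m}"
  let ?K = "max_intervals S - {?L, ?R}"
  note mi = max_intervals_insert[OF S0 x L R]
  have fK: "finite ?K" using finite_max_intervals[OF fin] by simp
  have disj: "?K \<inter> ({?L, ?R} - {{}}) = {}" by blast
  have cards: "card ?L = l" "card ?R = m" "card ?M = l + m + 1" using x by auto
  have xl: "x - (x - l) = l" using x by simp
  have LR: "?L \<inter> ?R = {}" by auto
  have two: "(\<Prod>I\<in>{?L, ?R} - {{}}. f I) = f ?L * f ?R" if "f {} = (1::'b::comm_monoid_mult)" for f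
  proof (cases "?L = ?R")
    case True
    then have "?L = {}" using LR by blast
    then show ?thesis using True that by simp
  next
    case False
    then have "f ?L * f ?R = (\<Prod>I\<in>{?L, ?R}. f I)" by simp
    also have "\<dots> = (\<Prod>I\<in>{?L, ?R} - {{}}. f I)"
      using that by (intro prod.mono_neutral_right) auto
    finally show ?thesis by simp
  qed
  have two': "(\<Sum>I\<in>{?L, ?R} - {{}}. f I) = f ?L + f ?R" if "f {} = (0::nat)" for f
  proof (cases "?L = ?R")
    case True
    then have "?L = {}" using LR by blast
    then show ?thesis using True that by simp
  next
    case False
    then have "f ?L + f ?R = (\<Sum>I\<in>{?L, ?R}. f I)" by simp
    also have "\<dots> = (\<Sum>I\<in>{?L, ?R} - {{}}. f I)"
      using that by (intro sum.mono_neutral_right) auto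
    finally show ?thesis by simp
  qed
  have "interval_fact S = (\<Prod>I\<in>?K. q_fact (card I)) * (q_fact l * q_fact m)"
    unfolding interval_fact_def
    by (subst mi(1), subst prod.union_disjoint[OF fK _ disj]) (simp_all add: two q_fact_0 xl)
  moreover have "interval_fact (insert x S) = q_fact (l + m + 1) * (\<Prod>I\<in>?K. q_fact (card I))"
    unfolding interval_fact_def
    by (subst mi(2), subst prod.insert[OF fK mi(3)]) (simp only: cards)
  ultimately show "interval_fact (insert x S) * (q_fact l * q_fact m) = interval_fact S * q_fact (l + m + 1)"
    by (simp add: ac_simps)
  have "interval_choose S = (\<Sum>I\<in>?K. card I choose 2) + ((l choose 2) + (m choose 2))"
    unfolding interval_choose_def
    by (subst mi(1), subst sum.union_disjoint[OF fK _ disj]) (simp_all add: two' xl numeral_2_eq_2)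
  moreover have "interval_choose (insert x S) = (l + m + 1 choose 2) + (\<Sum>I\<in>?K. card I choose 2)"
    unfolding interval_choose_def
    by (subst mi(2), subst sum.insert[OF fK mi(3)]) (simp only: cards)
  ultimately show "interval_choose (insert x S) + (l choose 2) + (m choose 2) = interval_choose S + (l + m + 1 choose 2)"
    by linarith
qed

lemma left_run:
  fixes S :: "nat set" and x :: nat
  assumes "0 \<notin> S" "1 \<le> x"
  obtains l where "l < x" "{x - l..<x} \<subseteq> S" "x - l - 1 \<notin> S"
proof -
  have "\<exists>l<x. {x - l..<x} \<subseteq> S \<and> x - l - 1 \<notin> S"
    using assms(2)
  proof (induction x rule: dec_induct)
    case base
    then show ?case using assms(1) by (intro exI[of _ 0]) auto
  next
    case (step x)
    show ?case
    proof (cases "x \<in> S")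
      case True
      obtain l where l: "l < x" "{x - l..<x} \<subseteq> S" "x - l - 1 \<notin> S" using step by blast
      have "{Suc x - Suc l..<Suc x} = insert x {x - l..<x}" using l(1) by auto
      then show ?thesis using l True by (intro exI[of _ "Suc l"]) auto
    qed (auto intro: exI[of _ 0])
  qed
  then show ?thesis using that by blast
qed

lemma right_run:
  fixes S :: "nat set" and x :: nat
  assumes "finite S"
  obtains m where "{x<..x + m} \<subseteq> S" "Suc (x + m) \<notin> S"
proof -
  have ex: "\<exists>m. Suc (x + m) \<notin> S"
  proof (rule ccontr)
    assume "\<not> ?thesis"
    then have "range (\<lambda>m. Suc (x + m)) \<subseteq> S" by auto
    moreover have "infinite (range (\<lambda>m. Suc (x + m)))"
      by (rule range_inj_infinite) (simp add: inj_def)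
    ultimately show False using assms finite_subset by blast
  qed
  define m where "m = (LEAST m. Suc (x + m) \<notin> S)"
  have "y \<in> S" if "y \<in> {x<..x + m}" for y
  proof -
    have "y = Suc (x + (y - x - 1))" "y - x - 1 < m" using that by auto
    then show ?thesis using not_less_Least[of "y - x - 1" "\<lambda>m. Suc (x + m) \<notin> S"] m_def by metis
  qed
  moreover have "Suc (x + m) \<notin> S" unfolding m_def by (rule LeastI_ex[OF ex])
  ultimately show ?thesis using that by blast
qed

section \<open>Positive recurrence and conclusion\<close>

text \<open>
  One unit moves from \<open>i\<close> to \<open>j\<close>; the subtraction does not truncate when \<open>c i\<close> is positive.
\<close>

definition move :: "(nat \<Rightarrow> nat) \<Rightarrow> nat \<Rightarrow> nat \<Rightarrow> (nat \<Rightarrow> nat)" where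
  "move c i j = (\<lambda>k. c k + of_bool (k = j) - of_bool (k = i))"

lemma move_int: "c i \<ge> 1 \<Longrightarrow> int (move c i j k) = int (c k) + of_bool (k = j) - of_bool (k = i)"
  by (auto simp: move_def)

lemma sum_move:
  assumes "c i \<ge> 1" "1 \<le> i" "1 \<le> j"
  shows "(\<Sum>k=1..t. int (move c i j k)) = (\<Sum>k=1..t. int (c k)) + of_bool (j \<le> t) - of_bool (i \<le> t)"
proof -
  have "(\<Sum>k=1..t. of_bool (k = a)) = (of_bool (a \<le> t) :: int)" if "1 \<le> a" for a
    using that by (simp add: of_bool_def)
  then show ?thesis using assms by (simp add: move_int sum_subtractf sum.distrib)
qed

lemma move_W:
  assumes "c \<in> W r" "c i \<ge> 1" "1 \<le> i" "i \<le> r" "1 \<le> j" "j \<le> r"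
  shows "move c i j \<in> W r"
proof -
  have "(\<Sum>k=1..r. int (move c i j k)) = int r"
    using sum_move[of c i j r] assms by (simp add: W_def flip: of_nat_sum)
  then have "(\<Sum>k=1..r. move c i j k) = r" by (simp flip: of_nat_sum)
  then show ?thesis using assms by (auto simp: W_def move_def)
qed

lemma support_move:
  assumes "c i \<ge> 2" "1 \<le> j" "j \<le> r"
  shows "support r (move c i j) = insert j (support r c)"
  using assms by (auto simp: support_def move_def)

lemma H_move:
  assumes "c i \<ge> 1" "1 \<le> i" "1 \<le> j" "i \<le> r" "j \<le> r"
  shows "H r (move c i j) = H r c + (int i - int j)"
proof -
  have h: "h (move c i j) k = h c k + of_bool (j \<le> k) - of_bool (i \<le> k)" for k
    using sum_move[of c i j k] assms by (simp add: h_def sum_subtractf)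
  have cnt: "(\<Sum>k=1..r - 1. of_bool (a \<le> k)) = int r - int a" if "1 \<le> a" "a \<le> r" for a
  proof -
    have "(\<Sum>k=1..r - 1. of_bool (a \<le> k)) = (\<Sum>k\<in>{a..r - 1}. (1::int))"
      using that by (intro sum.mono_neutral_cong_right) auto
    then show ?thesis using that by simp
  qed
  show ?thesis
    using cnt[of i] cnt[of j] assms by (simp add: H_def h sum.distrib sum_subtractf)
qed

lemma psum_monomial_Suc:
  assumes "1 \<le> j" "j \<le> r" "c j = Suc (b j)" "\<And>k. k \<noteq> j \<Longrightarrow> c k = b k"
  shows "psum_monomial r c = psum_monomial r b * psum j"
proof -
  have "(\<Prod>k\<in>{1..r} - {j}. psum k ^ c k) = (\<Prod>k\<in>{1..r} - {j}. psum k ^ b k)"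
    using assms(4) by (intro prod.cong) auto
  moreover have "psum_monomial r e = psum j ^ e j * (\<Prod>k\<in>{1..r} - {j}. psum k ^ e k)" for e
    unfolding psum_monomial_def using assms(1,2) by (intro prod.remove) auto
  ultimately show ?thesis by (simp only: assms(3) power_Suc ac_simps)
qed

text \<open>
  Take one of the units at \<open>i\<close> and regard the bracket as a function of the position of this
  unit. The remaining units still occupy every site of \<open>{a..b}\<close>, so the function is
  \<open>q\<close>-harmonic there. It is determined by its values at the two neighbouring sites, where it is the
  remixed Eulerian number of the resulting sequence, or zero if the site is \<open>0\<close> or
  \<open>r + 1\<close>. If \<open>{a..b}\<close> is a maximal run, the resulting sequence has a larger support.
\<close>

lemma remixed_eulerian_move:
  assumes c: "c \<in> W r" and i: "c i \<ge> 2" "a \<le> i" "i \<le> b"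
    and ab: "1 \<le> a" "b \<le> r" "{a..b} \<subseteq> support r c"
  shows "q_int (b - a + 2) * remixed_eulerian r c
    = qpow (i - a + 1) * q_int (b - i + 1) * (if a = 1 then 0 else remixed_eulerian r (move c i (a - 1)))
      + q_int (i - a + 1) * (if b = r then 0 else remixed_eulerian r (move c i (b + 1)))"
proof -
  \<comment> \<open>The sequence without the moving unit.\<close>
  define d where "d = c(i := c i - 1)"
  let ?G = "psum_monomial r d"
  let ?F = "\<lambda>s. bracket r (?G * psum (a - 1 + s))"
  let ?m = "b - a + 1"
  have sc: "(\<Sum>k=1..r. c k) = r" using c by (simp add: W_def)
  have ir: "1 \<le> i" "i \<le> r" using i ab by auto
  have sd: "(\<Sum>k=1..r. d k) + 1 = r"
  proof -
    have "(\<Sum>k=1..r. c k) = c i + (\<Sum>k\<in>{1..r} - {i}. c k)" using ir by (simp add: sum.remove)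
    moreover have "(\<Sum>k=1..r. d k) = d i + (\<Sum>k\<in>{1..r} - {i}. d k)" using ir by (simp add: sum.remove)
    moreover have "(\<Sum>k\<in>{1..r} - {i}. d k) = (\<Sum>k\<in>{1..r} - {i}. c k)"
      by (intro sum.cong) (auto simp: d_def)
    moreover have "d i + 1 = c i" using i by (simp add: d_def)
    ultimately show ?thesis using sc by linarith
  qed
  have mv: "remixed_eulerian r (move c i j) = bracket r (?G * psum j)" if "1 \<le> j" "j \<le> r" for j
  proof -
    have "move c i j \<in> W r" using move_W[OF c] i ir that by simp
    moreover have "psum_monomial r (move c i j) = ?G * psum j"
      using that i by (intro psum_monomial_Suc) (auto simp: move_def d_def)
    ultimately show ?thesis by (simp add: remixed_eulerian_eq_bracket W_def)
  qed
  have self: "remixed_eulerian r c = bracket r (?G * psum i)"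
  proof -
    have "psum_monomial r c = ?G * psum i" using ir i by (intro psum_monomial_Suc) (auto simp: d_def)
    then show ?thesis using sc by (simp add: remixed_eulerian_eq_bracket)
  qed
  have harm: "(1 + qpow 1) * ?F s = qpow 1 * ?F (s - 1) + ?F (Suc s)" if s: "1 \<le> s" "s \<le> ?m" for s
  proof -
    let ?j = "a - 1 + s"
    have j: "?j \<in> {a..b}" using s ab(1) i by auto
    then have jr: "1 \<le> ?j" "?j \<le> r" using ab by auto
    have "c ?j \<ge> 1" using j ab(3) by (auto simp: support_def)
    then have dj: "d ?j \<ge> 1" using i(1) by (cases "?j = i") (simp_all add: d_def)
    define e where "e = d(?j := d ?j - 1)"
    have G: "?G = psum_monomial r e * psum ?j" using jr dj by (intro psum_monomial_Suc) (auto simp: e_def)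
    have se: "(\<Sum>k=1..r. e k) + 1 = (\<Sum>k=1..r. d k)"
    proof -
      have "(\<Sum>k=1..r. d k) = d ?j + (\<Sum>k\<in>{1..r} - {?j}. d k)" using jr by (simp add: sum.remove)
      moreover have "(\<Sum>k=1..r. e k) = e ?j + (\<Sum>k\<in>{1..r} - {?j}. e k)" using jr by (simp add: sum.remove)
      moreover have "(\<Sum>k\<in>{1..r} - {?j}. e k) = (\<Sum>k\<in>{1..r} - {?j}. d k)"
        by (intro sum.cong) (auto simp: e_def)
      moreover have "e ?j + 1 = d ?j" using dj by (simp add: e_def)
      ultimately show ?thesis by linarith
    qed
    have "(1 + qpow 1) * bracket r (?G * psum ?j) = qpow 1 * bracket r (?G * psum (?j - 1)) + bracket r (?G * psum (Suc ?j))"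
      using bracket_harmonic[OF jr homog_psum_monomial _ G] sd se by simp
    moreover have "?j - 1 = a - 1 + (s - 1)" "Suc ?j = a - 1 + Suc s" using s by auto
    ultimately show ?thesis by simp
  qed
  have F0: "?F 0 = (if a = 1 then 0 else remixed_eulerian r (move c i (a - 1)))"
    using mv[of "a - 1"] ab i by (auto simp: psum_0 bracket_0)
  have Fm: "?F (Suc ?m) = (if b = r then 0 else remixed_eulerian r (move c i (b + 1)))"
  proof -
    have eq: "a - 1 + Suc ?m = Suc b" using ab i by auto
    show ?thesis
    proof (cases "b = r")
      case True
      have "bracket r (?G * psum (Suc r)) = 0" using bracket_psum_last[OF homog_psum_monomial] sd by simp
      then show ?thesis using True eq by simp
    next
      case False
      then show ?thesis using mv[of "Suc b"] ab eq by simp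
    qed
  qed
  have "q_int (Suc ?m) * ?F (i - a + 1) = qpow (i - a + 1) * q_int (Suc ?m - (i - a + 1)) * ?F 0 + q_int (i - a + 1) * ?F (Suc ?m)"
    using harm i by (intro q_harmonic_solution) auto
  moreover have "Suc ?m - (i - a + 1) = b - i + 1" "a - 1 + (i - a + 1) = i" "Suc ?m = b - a + 2"
    using i ab(1) by auto
  ultimately show ?thesis using F0 Fm self by simp
qed

text \<open>
  Nonnegative coefficients cannot cancel.
\<close>

lemma psu_cone_sum_nonzero:
  assumes "psu_cone N P" "psu_cone N R" "P \<noteq> 0" shows "P + R \<noteq> 0"
proof
  assume "P + R = 0"
  then have eq: "coeff P k = - coeff R k" for k
    by (metis add_eq_0_iff2 coeff_minus)
  have "coeff P k = 0" for k
  proof -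
    have "Re (coeff P k) = 0"
      using eq[of k] psu_cone_coeff(5)[OF assms(1), of k] psu_cone_coeff(5)[OF assms(2), of k] by simp
    then show ?thesis
      using psu_cone_coeff(1)[OF assms(1), of k] by (metis Reals_cases Re_complex_of_real of_real_0)
  qed
  then have "P = 0" by (intro poly_eqI) simp
  then show False using assms by simp
qed

text \<open>
  Twice the center of symmetry of the reduced remixed Eulerian number.
\<close>

definition center :: "nat \<Rightarrow> (nat \<Rightarrow> nat) \<Rightarrow> int" where
  "center r c = int (r choose 2) - H r c - int (interval_choose (support r c))"

definition reduced_cone :: "nat \<Rightarrow> (nat \<Rightarrow> nat) \<Rightarrow> qpoly \<Rightarrow> nat \<Rightarrow> bool" where
  "reduced_cone r c P N \<longleftrightarrow> interval_fact (support r c) * P = remixed_eulerian r c \<and> P \<noteq> 0 \<and> psu_cone N P \<and> int N = center r c"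

lemma choose_two_merge: "(l + m + 1) choose 2 = (l choose 2) + (m choose 2) + l * m + l + m"
  by (induction l) (simp_all add: choose_two_Suc numeral_2_eq_2)

lemma support_W: "c \<in> W r \<Longrightarrow> finite (support r c) \<and> 0 \<notin> support r c \<and> support r c \<subseteq> {1..r}"
  by (auto simp: support_def)

text \<open>
  For a run of length \<open>m\<close> that is extended by one site and thereby meets a run of length \<open>l\<close>, the
  factor \<open>(m + 1)\<^sub>q\<close> cancels the denominator in the recurrence, and a Gaussian binomial
  coefficient is left over.
\<close>

lemma interval_fact_merge:
  assumes "D' * (q_fact l * q_fact m) = D * q_fact (l + m + 1)"
  shows "D' = D * q_int (m + 1) * qbinom l (m + 1)"
proof -
  have "q_fact (l + m + 1) = q_fact l * (q_fact m * q_int (m + 1)) * qbinom l (m + 1)"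
    using q_fact_qbinom[of l "m + 1"] q_fact_Suc[of m] by simp
  then have "(q_fact l * q_fact m) * D' = (q_fact l * q_fact m) * (D * q_int (m + 1) * qbinom l (m + 1))"
    using assms by (simp add: ac_simps)
  then show ?thesis using q_fact_nonzero by simp
qed

text \<open>
  Induction on the number of unoccupied sites. If every site is occupied, the sequence is the
  all-ones sequence. Otherwise some site \<open>i\<close> carries at least two units; with \<open>{a..b}\<close> the run
  around \<open>i\<close>, moving a unit to \<open>a - 1\<close> or \<open>b + 1\<close> gives, after division by the interval factorials,
  a recurrence whose coefficients are products of powers of \<open>q\<close>, \<open>q\<close>-integers and Gaussian
  binomial coefficients. Each of its terms lies in the cone, and both are symmetric about the same
  center. The two target sites cannot both lie outside \<open>{1..r}\<close>, since there
  would be more than \<open>r\<close> units, so the result is not zero.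
\<close>

lemma reduced_cone_exists:
  assumes "c \<in> W r"
  shows "\<exists>P N. reduced_cone r c P N"
  using assms
proof (induction "r - card (support r c)" arbitrary: c rule: less_induct)
  case less
  let ?S = "support r c"
  have S: "finite ?S" "0 \<notin> ?S" "?S \<subseteq> {1..r}" using support_W[OF less.prems] by auto
  have sc: "(\<Sum>k=1..r. c k) = r" using less.prems by (simp add: W_def)
  show ?case
  proof (cases "\<exists>i\<in>{1..r}. c i \<ge> 2")
    case False
    then have le: "c k \<le> 1" if "k \<in> {1..r}" for k using that by force
    have one: "c k = 1" if k: "k \<in> {1..r}" for k
    proof (rule ccontr)
      assume "c k \<noteq> 1"
      then have "c k < 1" using le[OF k] by simp
      then have "(\<Sum>k=1..r. c k) < (\<Sum>k=1..r. 1)"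
        using le k by (intro sum_strict_mono_ex1) auto
      then show False using sc by simp
    qed
    have supp: "?S = {1..r}" using one by (auto simp: support_def)
    have mi: "max_intervals {1..r} = (if r = 0 then {} else {{1..r}})"
    proof (rule set_eqI)
      fix I
      show "I \<in> max_intervals {1..r} \<longleftrightarrow> I \<in> (if r = 0 then {} else {{1..r}})"
      proof
        assume "I \<in> max_intervals {1..r}"
        then obtain a b where ab: "1 \<le> a" "a \<le> b" "I = {a..b}" "{a..b} \<subseteq> {1..r}" "a - 1 \<notin> {1..r}" "Suc b \<notin> {1..r}"
          using max_intervals_iff[of "{1..r}" I] by auto
        have "a \<in> {a..b}" "b \<in> {a..b}" using ab by auto
        then have "a \<le> r" "b \<le> r" using ab(4) by auto
        then have "a = 1" "b = r" using ab by auto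
        then show "I \<in> (if r = 0 then {} else {{1..r}})" using ab by auto
      next
        assume "I \<in> (if r = 0 then {} else {{1..r}})"
        then show "I \<in> max_intervals {1..r}"
          by (subst max_intervals_iff) (auto split: if_splits intro!: exI[of _ 1] exI[of _ r])
      qed
    qed
    have fact: "interval_fact ?S = q_fact r" and choose: "interval_choose ?S = r choose 2"
      unfolding interval_fact_def interval_choose_def supp mi by (simp_all add: q_fact_0 numeral_2_eq_2)
    have "remixed_eulerian r c = q_fact r"
    proof -
      have "psum_monomial r c = (\<Prod>i=1..r. psum i)" unfolding psum_monomial_def using one by (intro prod.cong) auto
      then show ?thesis using remixed_eulerian_eq_bracket[OF sc] bracket_all_ones by simp
    qed
    moreover have "H r c = 0"
    proof -
      have "h c k = 0" if "k \<in> {1..r - 1}" for k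
        unfolding h_def using that one by (intro sum.neutral) auto
      then show ?thesis by (simp add: H_def)
    qed
    ultimately have "reduced_cone r c 1 0"
      using psu_cone_q_int[of 0] fact choose by (simp add: reduced_cone_def center_def q_int_1)
    then show ?thesis by blast
  next
    case True
    then obtain i where i: "i \<in> {1..r}" "c i \<ge> 2" by blast
    have iS: "i \<in> ?S" using i by (auto simp: support_def)
    obtain u where u: "u < i" "{i - u..<i} \<subseteq> ?S" "i - u - 1 \<notin> ?S"
      using left_run[OF S(2), of i] i by auto
    obtain v where v: "{i<..i + v} \<subseteq> ?S" "Suc (i + v) \<notin> ?S"
      using right_run[OF S(1)] by blast
    define a b where "a = i - u" and "b = i + v"
    have ab: "1 \<le> a" "a \<le> i" "i \<le> b" "a - 1 \<notin> ?S" "Suc b \<notin> ?S" using u v by (auto simp: a_def b_def)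
    have sub: "{a..b} \<subseteq> ?S"
    proof
      fix y assume "y \<in> {a..b}"
      then have "y \<in> {i - u..<i} \<or> y = i \<or> y \<in> {i<..i + v}" by (auto simp: a_def b_def)
      then show "y \<in> ?S" using u v iS by blast
    qed
    have b_le_r: "b \<le> r" using sub S(3) ab by (meson atLeastAtMost_iff order_trans order_refl subsetD)
    define m where "m = b - a + 1"
    let ?D = "interval_fact ?S"
    have IH: "\<exists>P N. reduced_cone r (move c i j) P N" if j: "1 \<le> j" "j \<le> r" "j \<notin> ?S" for j
    proof (rule less.hyps)
      have "card (insert j ?S) \<le> card {1..r}" using S j by (intro card_mono) auto
      then show "r - card (support r (move c i j)) < r - card ?S"
        using support_move[of c i j r] i j S(1) by simp
      show "move c i j \<in> W r" using move_W[OF less.prems] i j by simp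
    qed
    have left: "\<exists>P N. remixed_eulerian r (move c i (a - 1)) = ?D * q_int (m + 1) * P \<and> P \<noteq> 0 \<and>
        psu_cone N (qpow (i - a + 1) * q_int (b - i + 1) * P) \<and> int N = center r c" if a1: "a \<noteq> 1"
    proof -
      let ?x = "a - 1" and ?c = "move c i (a - 1)"
      have x: "1 \<le> ?x" "?x \<le> r" "?x \<notin> ?S" using a1 ab b_le_r by auto
      obtain P N where P: "reduced_cone r ?c P N" using IH[OF x] by blast
      obtain l where l: "l < ?x" "{?x - l..<?x} \<subseteq> ?S" "?x - l - 1 \<notin> ?S"
        using left_run[OF S(2) x(1)] by blast
      have R: "{?x<..?x + m} \<subseteq> ?S" "Suc (?x + m) \<notin> ?S"
      proof -
        have "{?x<..?x + m} = {a..b}" "Suc (?x + m) = Suc b" using ab by (auto simp: m_def)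
        then show "{?x<..?x + m} \<subseteq> ?S" "Suc (?x + m) \<notin> ?S" using sub ab by auto
      qed
      note ins = interval_insert[OF S(1,2) x(3) l R]
      have supp: "support r ?c = insert ?x ?S" using support_move[of c i ?x r] i x by simp
      have D': "interval_fact (insert ?x ?S) = ?D * q_int (m + 1) * qbinom l (m + 1)"
        by (rule interval_fact_merge[OF ins(1)])
      let ?P = "qbinom l (m + 1) * P"
      have "?P \<noteq> 0" using P D' supp q_fact_qbinom[of l "m + 1"] q_fact_nonzero by (auto simp: reduced_cone_def)
      moreover have "remixed_eulerian r ?c = ?D * q_int (m + 1) * ?P"
        using P D' supp by (simp add: reduced_cone_def mult.assoc)
      moreover have "psu_cone ((b - i) + (l * (m + 1) + N) + 2 * (i - a + 1)) (qpow (i - a + 1) * (q_int (b - i + 1) * ?P))"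
        using P psu_cone_q_int[of "b - i"] psu_cone_qbinom[of l "m + 1"]
        by (intro psu_cone_shift psu_cone_mult) (simp_all add: reduced_cone_def)
      moreover have "int ((b - i) + (l * (m + 1) + N) + 2 * (i - a + 1)) = center r c"
      proof -
        have N: "int N = int (r choose 2) - H r ?c - int (interval_choose (insert ?x ?S))"
          using P supp by (simp add: reduced_cone_def center_def)
        have "H r ?c = H r c + (int i - int ?x)" using H_move[of c i ?x r] i x by simp
        moreover have "interval_choose (insert ?x ?S) = interval_choose ?S + l * m + l + m"
          using ins(2) choose_two_merge[of l m] by linarith
        moreover have "int (b - i) = int b - int i" "int ?x = int a - 1" "int (i - a + 1) = int i - int a + 1"
          "int m = int b - int a + 1"
          using ab by (auto simp: m_def)
        ultimately show ?thesis unfolding center_def using N by (simp add: algebra_simps)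
      qed
      ultimately show ?thesis by (metis mult.assoc)
    qed
    have right: "\<exists>P N. remixed_eulerian r (move c i (b + 1)) = ?D * q_int (m + 1) * P \<and> P \<noteq> 0 \<and>
        psu_cone N (q_int (i - a + 1) * P) \<and> int N = center r c" if b1: "b \<noteq> r"
    proof -
      let ?x = "b + 1" and ?c = "move c i (b + 1)"
      have x: "1 \<le> ?x" "?x \<le> r" "?x \<notin> ?S" using b1 ab b_le_r by auto
      obtain P N where P: "reduced_cone r ?c P N" using IH[OF x] by blast
      obtain l where l: "{?x<..?x + l} \<subseteq> ?S" "Suc (?x + l) \<notin> ?S"
        using right_run[OF S(1)] by blast
      have L: "m < ?x" "{?x - m..<?x} \<subseteq> ?S" "?x - m - 1 \<notin> ?S"
      proof -
        have "?x - m = a" using ab by (auto simp: m_def)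
        moreover have "{a..<?x} = {a..b}" by auto
        ultimately show "m < ?x" "{?x - m..<?x} \<subseteq> ?S" "?x - m - 1 \<notin> ?S" using sub ab by auto
      qed
      note ins = interval_insert[OF S(1,2) x(3) L l]
      have supp: "support r ?c = insert ?x ?S" using support_move[of c i ?x r] i x by simp
      have D': "interval_fact (insert ?x ?S) = ?D * q_int (m + 1) * qbinom l (m + 1)"
        using ins(1) by (intro interval_fact_merge) (simp add: ac_simps)
      let ?P = "qbinom l (m + 1) * P"
      have "?P \<noteq> 0" using P D' supp q_fact_qbinom[of l "m + 1"] q_fact_nonzero by (auto simp: reduced_cone_def)
      moreover have "remixed_eulerian r ?c = ?D * q_int (m + 1) * ?P"
        using P D' supp by (simp add: reduced_cone_def mult.assoc)
      moreover have "psu_cone ((i - a) + (l * (m + 1) + N)) (q_int (i - a + 1) * ?P)"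
        using P psu_cone_q_int[of "i - a"] psu_cone_qbinom[of l "m + 1"]
        by (intro psu_cone_mult) (simp_all add: reduced_cone_def)
      moreover have "int ((i - a) + (l * (m + 1) + N)) = center r c"
      proof -
        have N: "int N = int (r choose 2) - H r ?c - int (interval_choose (insert ?x ?S))"
          using P supp by (simp add: reduced_cone_def center_def)
        have "H r ?c = H r c + (int i - int ?x)" using H_move[of c i ?x r] i x by simp
        moreover have "interval_choose (insert ?x ?S) = interval_choose ?S + l * m + l + m"
          using ins(2) choose_two_merge[of m l] by (simp add: mult.commute)
        moreover have "int (i - a) = int i - int a" "int m = int b - int a + 1"
          using ab by (auto simp: m_def)
        ultimately show ?thesis unfolding center_def using N by (simp add: algebra_simps)
      qed
      ultimately show ?thesis by blast
    qed
    have rel: "q_int (m + 1) * remixed_eulerian r c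
      = qpow (i - a + 1) * q_int (b - i + 1) * (if a = 1 then 0 else remixed_eulerian r (move c i (a - 1)))
      + q_int (i - a + 1) * (if b = r then 0 else remixed_eulerian r (move c i (b + 1)))"
      using remixed_eulerian_move[OF less.prems i(2) ab(2,3,1) b_le_r sub] by (simp add: m_def)
    have qm: "q_int (m + 1) \<noteq> 0" by (rule q_int_nonzero) simp
    have finish: "?D * R = remixed_eulerian r c" if "q_int (m + 1) * remixed_eulerian r c = ?D * q_int (m + 1) * R" for R
    proof -
      have "q_int (m + 1) * remixed_eulerian r c = q_int (m + 1) * (?D * R)" using that by (simp add: ac_simps)
      then show ?thesis using qm by simp
    qed
    have nz: "qpow (i - a + 1) * q_int (b - i + 1) \<noteq> 0" "q_int (i - a + 1) \<noteq> 0"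
      using q_int_nonzero by simp_all
    consider "a = 1" "b = r" | "a \<noteq> 1" "b = r" | "a = 1" "b \<noteq> r" | "a \<noteq> 1" "b \<noteq> r" by blast
    then show ?thesis
    proof cases
      case 1
      have "c k \<ge> 1" if "k \<in> {1..r}" for k using sub 1 that by (auto simp: support_def)
      then have "(\<Sum>k=1..r. 1) < (\<Sum>k=1..r. c k)"
        using i by (intro sum_strict_mono_ex1) (auto intro!: bexI[of _ i])
      then show ?thesis using sc by simp
    next
      case 2
      obtain P N where P: "remixed_eulerian r (move c i (a - 1)) = ?D * q_int (m + 1) * P" "P \<noteq> 0"
        "psu_cone N (qpow (i - a + 1) * q_int (b - i + 1) * P)" "int N = center r c" using left[OF 2(1)] by blast
      have "reduced_cone r c (qpow (i - a + 1) * q_int (b - i + 1) * P) N"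
        using finish[of "qpow (i - a + 1) * q_int (b - i + 1) * P"] rel 2 P nz
        unfolding reduced_cone_def by (simp add: ac_simps)
      then show ?thesis by blast
    next
      case 3
      obtain P N where P: "remixed_eulerian r (move c i (b + 1)) = ?D * q_int (m + 1) * P" "P \<noteq> 0"
        "psu_cone N (q_int (i - a + 1) * P)" "int N = center r c" using right[OF 3(2)] by blast
      have "reduced_cone r c (q_int (i - a + 1) * P) N"
        using finish[of "q_int (i - a + 1) * P"] rel 3 P nz
        unfolding reduced_cone_def by (simp add: ac_simps)
      then show ?thesis by blast
    next
      case 4
      obtain P N where P: "remixed_eulerian r (move c i (a - 1)) = ?D * q_int (m + 1) * P" "P \<noteq> 0"
        "psu_cone N (qpow (i - a + 1) * q_int (b - i + 1) * P)" "int N = center r c" using left[OF 4(1)] by blast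
      obtain P' N' where P': "remixed_eulerian r (move c i (b + 1)) = ?D * q_int (m + 1) * P'" "P' \<noteq> 0"
        "psu_cone N' (q_int (i - a + 1) * P')" "int N' = center r c" using right[OF 4(2)] by blast
      have NN: "N' = N" using P P' by simp
      let ?R = "qpow (i - a + 1) * q_int (b - i + 1) * P + q_int (i - a + 1) * P'"
      have "?R \<noteq> 0" using P P' nz unfolding NN by (intro psu_cone_sum_nonzero) auto
      moreover have "psu_cone N ?R" using P P' unfolding NN by (intro psu_cone_add)
      moreover have "?D * ?R = remixed_eulerian r c"
        using rel 4 P P' by (intro finish) (simp add: algebra_simps)
      ultimately have "reduced_cone r c ?R N" using P by (simp add: reduced_cone_def)
      then show ?thesis by blast
    qed
  qed
qed

lemma psu_cone_interval_fact: "finite S \<Longrightarrow> psu_cone (interval_choose S) (interval_fact S)"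
proof -
  have one: "psu_cone 0 1" using psu_cone_q_int[of 0] by (simp add: q_int_1)
  have "psu_cone (\<Sum>I\<in>\<I>. card I choose 2) (\<Prod>I\<in>\<I>. q_fact (card I))" for \<I> :: "nat set set"
    by (induction \<I> rule: infinite_finite_induct) (auto intro: one psu_cone_mult psu_cone_q_fact)
  then show ?thesis by (simp add: interval_choose_def interval_fact_def)
qed

theorem theorem5p6:
  fixes r :: nat and c :: "nat \<Rightarrow> nat"
  assumes "r \<ge> 1" and "c \<in> W r"
  shows "psu (reduced_remixed_eulerian r c)
           (int (r choose 2) - H r c - (\<Sum>I\<in>max_intervals (support r c). int (card I choose 2)))
         \<and> psu (remixed_eulerian r c) (int (r choose 2) - H r c)"
proof -
  let ?S = "support r c"
  obtain P N where P: "reduced_cone r c P N" using reduced_cone_exists[OF assms(2)] by blast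
  have fin: "finite ?S" by (simp add: support_def)
  have nz: "interval_fact ?S \<noteq> 0"
    using finite_max_intervals[OF fin] by (simp add: interval_fact_def q_fact_nonzero)
  have red: "reduced_remixed_eulerian r c = P"
    unfolding reduced_remixed_eulerian_def
  proof (rule the_equality)
    show "(\<Prod>I\<in>max_intervals ?S. q_fact (card I)) * P = remixed_eulerian r c"
      using P by (simp add: reduced_cone_def interval_fact_def)
    fix R assume "(\<Prod>I\<in>max_intervals ?S. q_fact (card I)) * R = remixed_eulerian r c"
    then have "interval_fact ?S * R = interval_fact ?S * P" using P by (simp add: reduced_cone_def interval_fact_def)
    then show "R = P" using nz by simp
  qed
  have N: "int N = int (r choose 2) - H r c - (\<Sum>I\<in>max_intervals ?S. int (card I choose 2))"
    using P by (simp add: reduced_cone_def center_def interval_choose_def)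
  have "psu P (int N)" using P by (intro psu_if_psu_cone) (auto simp: reduced_cone_def)
  moreover have "psu (remixed_eulerian r c) (int (r choose 2) - H r c)"
  proof -
    have "psu_cone (interval_choose ?S + N) (interval_fact ?S * P)"
      using P psu_cone_interval_fact[OF fin] by (intro psu_cone_mult) (auto simp: reduced_cone_def)
    then have "psu (interval_fact ?S * P) (int (interval_choose ?S + N))"
      using nz P by (intro psu_if_psu_cone) (auto simp: reduced_cone_def)
    moreover have "int (interval_choose ?S + N) = int (r choose 2) - H r c"
      using N by (simp add: interval_choose_def)
    ultimately show ?thesis using P by (simp only: reduced_cone_def)
  qed
  ultimately show ?thesis using N red by simp
qed

end
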